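(* Let $\mathbb{D}=\{z\in\mathbb{C}:|z|<1\}$, let $A^2(\mathbb{D})$ be the Bergman space, and let $\mathbb{P}_K$ be the Bergman determinantal point process on $\mathbb{D}$ (both defined in the context). For any $1<s<3/2$ and any $z\in\mathbb{D}$, \[ \mathbb{P}_K\Big(\Big\{X\in\mathrm{Conf}(\mathbb{D})\,\Big|\,\sum_{k=0}^\infty\sum_{x\in X,\ k\le d_{\mathrm{h}}(z,x)<k+1}e^{-sd_{\mathrm{h}}(z,x)}f(x)\ \text{converges for all } f\in A^2(\mathbb{D})\Big\}\Big)=0. \]
   Context: $\mu$ denotes the normalized Lebesgue measure $\mathrm{d}\mu=\frac{1}{\pi}\mathrm{d}x\,\mathrm{d}y$ on $\mathbb{D}$. $A^2(\mathbb{D})$ is the Hilbert space of holomorphic $f:\mathbb{D}\to\mathbb{C}$ with $\int_{\mathbb{D}}|f|^2\,\mathrm{d}\mu<\infty$; its reproducing kernel is $K(z,w)=(1-z\overline{w})^{-2}$. $\mathrm{Conf}(\mathbb{D})$ is the space of locally finite configurations (locally finite subsets) of $\mathbb{D}$, and $\mathbb{P}_K$ is the determinantal point process on $\mathbb{D}$ with kernel $K$ with respect to $\mu$, i.e. its $k$-point correlation functions with respect to $\mu^{\otimes k}$ are $\rho_k(x_1,\dots,x_k)=\det[K(x_i,x_j)]_{1\le i,j\le k}$. The hyperbolic distance is $d_{\mathrm{h}}(z,x)=\log\frac{1+|\varphi_z(x)|}{1-|\varphi_z(x)|}$ with $\varphi_z(x)=\frac{z-x}{1-\overline{z}x}$.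 For each $k$ the inner sum is a finite sum, and "converges" refers to convergence of the series over $k$. *)

theory Defs
  imports "HOL-Probability.Probability"
begin

definition disc_mu :: "complex measure" where
  "disc_mu = density lborel (\<lambda>z. ennreal (indicator (ball 0 1) z / pi))"

definition bergman_space :: "(complex \<Rightarrow> complex) set" where
  "bergman_space = {f. f holomorphic_on ball 0 1 \<and>
      (\<integral>\<^sup>+ z. ennreal ((cmod (f z))\<^sup>2) \<partial>disc_mu) < \<infinity>}"

definition bergman_kernel :: "complex \<Rightarrow> complex \<Rightarrow> complex" where
  "bergman_kernel z w = 1 / (1 - z * cnj w)\<^sup>2"

definition moebius :: "complex \<Rightarrow> complex \<Rightarrow> complex" where
  "moebius z x = (z - x) / (1 - cnj z * x)"

definition hyp_dist :: "complex \<Rightarrow> complex \<Rightarrow> real" where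
  "hyp_dist z x = ln ((1 + cmod (moebius z x)) / (1 - cmod (moebius z x)))"

definition Conf :: "complex set set" where
  "Conf = {X. X \<subseteq> ball 0 1 \<and>
      (\<forall>C. compact C \<and> C \<subseteq> ball 0 1 \<longrightarrow> finite (X \<inter> C))}"

definition rc_borel :: "complex set \<Rightarrow> bool" where
  "rc_borel B \<longleftrightarrow> B \<in> sets borel \<and> closure B \<subseteq> ball 0 1"

definition conf_space :: "complex set measure" where
  "conf_space = sigma Conf
     {{X \<in> Conf. card (X \<inter> B) = n} | B n. rc_borel B}"

definition kernel_det :: "(complex \<Rightarrow> complex \<Rightarrow> complex) \<Rightarrow> nat \<Rightarrow> (nat \<Rightarrow> complex) \<Rightarrow> complex" where
  "kernel_det K k x = (\<Sum>p \<in> {p. p permutes {..<k}}.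
       of_int (sign p) * (\<Prod>i<k. K (x i) (x (p i))))"

text \<open>P is a determinantal point process on D with kernel K w.r.t. disc_mu:
  its k-point correlation functions w.r.t. disc_mu^k are det[K(x_i,x_j)],
  i.e. for disjoint relatively compact Borel sets B_0..B_{k-1},
  E[prod card(X \<inter> B_i)] = integral over B_0 x ... x B_{k-1} of rho_k.\<close>
definition is_DPP :: "complex set measure \<Rightarrow> (complex \<Rightarrow> complex \<Rightarrow> complex) \<Rightarrow> bool" where
  "is_DPP P K \<longleftrightarrow> prob_space P \<and> space P = Conf \<and> sets P = sets conf_space \<and>
     (\<forall>k B. (\<forall>i<k. rc_borel (B i)) \<and> disjoint_family_on B {..<k} \<longrightarrow>
        (\<integral>\<^sup>+ X. (\<Prod>i<k. of_nat (card (X \<inter> B i))) \<partial>P) =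
        (\<integral>\<^sup>+ x. indicator (\<Pi>\<^sub>E i\<in>{..<k}. B i) x * ennreal (Re (kernel_det K k x))
            \<partial>(PiM {..<k} (\<lambda>_. disc_mu))))"

end

theory Submission
  imports Defs "HOL-Complex_Analysis.Complex_Analysis" "HOL-Real_Asymp.Real_Asymp"
begin

text \<open>
  Let \<open>S\<close> be the part of a configuration in the hyperbolic shell \<open>k \<le> d < k + 1\<close> around \<open>z\<close>. It has about
  \<open>e\<^sup>k\<close> points, all at Euclidean distance about \<open>e\<^sup>-\<^sup>k\<close> from the circle. Multiplying, for every \<open>x \<in> S\<close>,
  the Blaschke product of the other points of \<open>S\<close> by a bump \<open>((1 - |x|\<^sup>2) / (1 - cnj x y))\<^sup>4\<close> and a
  unimodular constant, and summing over \<open>x\<close>, gives a function whose value at \<open>x\<close> is the positive number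
  \<open>\<Prod>|moebius w x|\<close> over \<open>w \<noteq> x\<close>. By Jensen's inequality these values have a mean of size at least
  \<open>e\<^sup>-\<^sup>A\<close> as soon as the logarithmic energy of \<open>S\<close> is at most \<open>A\<close> per point, and the squared Bergman
  norm is controlled by the pair sum of \<open>|K|\<^sup>2\<close>. Since the two-point correlation is at most the product of
  the intensities, both pair sums have expectation of the expected order; Markov's inequality bounds them,
  and Chebyshev's inequality bounds the number of points from below, outside an event of probability
  \<open>O(1/k)\<close>. So along \<open>k = 2\<^sup>j\<close>, almost surely, there are functions of squared norm about \<open>e\<^sup>-\<^sup>k\<close> on
  which the k-th term of the series has size about \<open>e\<^bsup>(1-s)k\<^esup>\<close>. As \<open>s - 1 < 1/2\<close>, they can be rescaled
  so that their norms are summable while these terms are unbounded, and a gliding hump argument yields one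
  function for which the terms of the series are unbounded.
\<close>

section \<open>Integrals over thin annuli\<close>

text \<open>The gap between \<open>s\<close> and 3/2 is open, so losses of size
  \<open>exp (\<eta> * k)\<close> are affordable. This is why the energy per point is only required
  to be at most \<open>\<eta> * k\<close> instead of bounded: Markov's inequality then fails with
  probability \<open>O(1/k)\<close>, which is not summable over all \<open>k\<close> but is along
  powers of 2, while Jensen's inequality loses no more than \<open>exp (- \<eta> * k)\<close>.
  Second moments are needed from above only, even for the lower bound on the number of points, and
  the determinant supplies them by its sign. One function has to serve infinitely many shells. A
  function built for a late shell is tiny on all earlier ones, by a pointwise bound, but nothing
  controls an early function on later shells, where it might cancel the new term. Hence each new
  function is either added or omitted, whichever leaves a large sum on its own shell. The event
  itself is not shown to be measurable; it is enclosed in a measurable null set. For the same reason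
  pair sums are handled through measurable majorants.\<close>

lemma lborel_complex_eq_distr:
  "(lborel :: complex measure) = distr (lborel \<Otimes>\<^sub>M lborel) borel (\<lambda>(a, b). Complex a b)"
proof (rule lborel_eqI)
  fix l u :: complex
  assume le: "\<And>b. b \<in> Basis \<Longrightarrow> l \<bullet> b \<le> u \<bullet> b"
  have [measurable]: "(\<lambda>(a, b). Complex a b) \<in> borel_measurable (lborel \<Otimes>\<^sub>M lborel)"
    unfolding Complex_eq by measurable
  have eq: "(\<lambda>(a, b). Complex a b) -` box l u = {Re l<..<Re u} \<times> {Im l<..<Im u}"
    by (auto simp: in_box_complex_iff)
  have "l \<bullet> 1 \<le> u \<bullet> 1" "l \<bullet> \<i> \<le> u \<bullet> \<i>"
    by (intro le; simp add: Basis_complex_def)+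
  hence "Re l \<le> Re u" "Im l \<le> Im u" by (auto simp: inner_complex_def)
  thus "emeasure (distr (lborel \<Otimes>\<^sub>M lborel) borel (\<lambda>(a, b). Complex a b)) (box l u)
          = ennreal (prod ((\<bullet>) (u - l)) Basis)"
    by (subst emeasure_distr)
       (auto simp: eq space_pair_measure lborel.emeasure_pair_measure_Times Basis_complex_def
          ennreal_mult')
qed auto

text \<open>Both orders of integration are recorded because the annulus estimate slices along
  whichever axis crosses the circle transversally.\<close>

lemma nn_integral_lborel_complex:
  assumes [measurable]: "f \<in> borel_measurable borel"
  shows "(\<integral>\<^sup>+ y. f y \<partial>(lborel :: complex measure)) = (\<integral>\<^sup>+ a. \<integral>\<^sup>+ b. f (Complex a b) \<partial>lborel \<partial>lborel)"
    and "(\<integral>\<^sup>+ y. f y \<partial>(lborel :: complex measure)) = (\<integral>\<^sup>+ b. \<integral>\<^sup>+ a. f (Complex a b) \<partial>lborel \<partial>lborel)"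
proof -
  have C [measurable]: "(\<lambda>(a, b). Complex a b) \<in> borel_measurable (lborel \<Otimes>\<^sub>M lborel)"
    unfolding Complex_eq by measurable
  have fC [measurable]: "(\<lambda>(a, b). f (Complex a b)) \<in> borel_measurable (lborel \<Otimes>\<^sub>M lborel)"
    using measurable_compose[OF C assms] by (simp add: case_prod_beta)
  have eq: "(\<integral>\<^sup>+ y. f y \<partial>(lborel :: complex measure))
      = (\<integral>\<^sup>+ p. f (case p of (a, b) \<Rightarrow> Complex a b) \<partial>(lborel \<Otimes>\<^sub>M lborel))"
    by (subst lborel_complex_eq_distr, subst nn_integral_distr) auto
  show "(\<integral>\<^sup>+ y. f y \<partial>(lborel :: complex measure)) = (\<integral>\<^sup>+ a. \<integral>\<^sup>+ b. f (Complex a b) \<partial>lborel \<partial>lborel)"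
    unfolding eq using lborel.nn_integral_fst[OF fC] by (simp add: case_prod_unfold)
  show "(\<integral>\<^sup>+ y. f y \<partial>(lborel :: complex measure)) = (\<integral>\<^sup>+ b. \<integral>\<^sup>+ a. f (Complex a b) \<partial>lborel \<partial>lborel)"
    unfolding eq using lborel_pair.nn_integral_snd[of "\<lambda>(a, b). f (Complex a b)"] fC
    by (simp add: case_prod_unfold)
qed

text \<open>Squaring does not contract distances between numbers of equal sign and modulus at least
  1/2, and \<open>b\<^sup>2\<close> is confined to a window of length \<open>t\<close>. So each of
  the two branches has diameter at most \<open>t\<close> and fits into an interval of length
  \<open>2 * t\<close> about any of its points.\<close>

lemma emeasure_circular_slice_le:
  fixes a t :: real
  assumes "0 \<le> t"
  shows "emeasure lborel {b :: real. 1/2 \<le> \<bar>b\<bar> \<and> 1 - t \<le> a\<^sup>2 + b\<^sup>2 \<and> a\<^sup>2 + b\<^sup>2 < 1} \<le> ennreal (4 * t)"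
proof -
  define A where "A = {b :: real. 1/2 \<le> b \<and> 1 - t \<le> a\<^sup>2 + b\<^sup>2 \<and> a\<^sup>2 + b\<^sup>2 < 1}"
  define B where "B = {b :: real. b \<le> -(1/2) \<and> 1 - t \<le> a\<^sup>2 + b\<^sup>2 \<and> a\<^sup>2 + b\<^sup>2 < 1}"
  have [measurable]: "A \<in> sets borel" "B \<in> sets borel" unfolding A_def B_def by measurable
  have close: "\<bar>c - b\<bar> \<le> t" if "1 \<le> \<bar>b + c\<bar>" "\<bar>c\<^sup>2 - b\<^sup>2\<bar> \<le> t" for b c :: real
  proof -
    have "\<bar>c - b\<bar> * 1 \<le> \<bar>c - b\<bar> * \<bar>b + c\<bar>" using that by (intro mult_left_mono) auto
    also have "\<dots> = \<bar>c\<^sup>2 - b\<^sup>2\<bar>" by (simp add: abs_mult[symmetric] power2_eq_square algebra_simps)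
    finally show ?thesis using that by simp
  qed
  have "emeasure lborel A \<le> ennreal (2 * t)"
  proof (cases "A = {}")
    case False
    then obtain b where b: "b \<in> A" by auto
    have "A \<subseteq> {b - t..b + t}"
    proof
      fix c assume "c \<in> A"
      hence "1 \<le> \<bar>b + c\<bar>" "\<bar>c\<^sup>2 - b\<^sup>2\<bar> \<le> t"
        using b unfolding A_def mem_Collect_eq by linarith+
      hence "\<bar>c - b\<bar> \<le> t" by (rule close)
      thus "c \<in> {b - t..b + t}" by auto
    qed
    hence "emeasure lborel A \<le> emeasure lborel {b - t..b + t}" by (intro emeasure_mono) auto
    thus ?thesis using assms by simp
  qed auto
  moreover have "emeasure lborel B \<le> ennreal (2 * t)"
  proof (cases "B = {}")
    case False
    then obtain b where b: "b \<in> B" by auto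
    have "B \<subseteq> {b - t..b + t}"
    proof
      fix c assume "c \<in> B"
      hence "1 \<le> \<bar>b + c\<bar>" "\<bar>c\<^sup>2 - b\<^sup>2\<bar> \<le> t"
        using b unfolding B_def mem_Collect_eq by linarith+
      hence "\<bar>c - b\<bar> \<le> t" by (rule close)
      thus "c \<in> {b - t..b + t}" by auto
    qed
    hence "emeasure lborel B \<le> emeasure lborel {b - t..b + t}" by (intro emeasure_mono) auto
    thus ?thesis using assms by simp
  qed auto
  moreover have "{b :: real. 1/2 \<le> \<bar>b\<bar> \<and> 1 - t \<le> a\<^sup>2 + b\<^sup>2 \<and> a\<^sup>2 + b\<^sup>2 < 1} = A \<union> B"
    by (auto simp: A_def B_def)
  moreover have "emeasure lborel (A \<union> B) \<le> emeasure lborel A + emeasure lborel B"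
    by (intro emeasure_subadditive) auto
  moreover have "ennreal (2 * t) + ennreal (2 * t) = ennreal (4 * t)"
    using assms by (subst ennreal_plus[symmetric]) auto
  ultimately show ?thesis
    using add_mono[of "emeasure lborel A" "ennreal (2 * t)" "emeasure lborel B" "ennreal (2 * t)"]
    by simp
qed

definition annulus :: "real \<Rightarrow> complex set" where
  "annulus t = {y. 1 - t \<le> (cmod y)\<^sup>2 \<and> (cmod y)\<^sup>2 < 1}"

lemma annulus_borel [measurable]: "annulus t \<in> sets borel"
  unfolding annulus_def by measurable

text \<open>This replaces polar coordinates. For \<open>t \<le> 1/2\<close> a point of the annulus
  has a coordinate of modulus at least 1/2. In the direction of that coordinate the slice has length
  at most \<open>4 * t\<close>, while \<open>h\<close> of the other coordinate bounds
  \<open>f\<close>; so the planar integral costs one factor \<open>t\<close> and becomes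
  one-dimensional.\<close>

lemma nn_integral_annulus_le:
  fixes f :: "complex \<Rightarrow> ennreal" and h :: "real \<Rightarrow> ennreal" and a0 b0 t :: real
  assumes [measurable]: "f \<in> borel_measurable borel" "h \<in> borel_measurable borel"
    and t: "0 \<le> t" "t \<le> 1/2"
    and Re: "\<And>y. y \<in> annulus t \<Longrightarrow> f y \<le> h (Re y - a0)"
    and Im: "\<And>y. y \<in> annulus t \<Longrightarrow> f y \<le> h (Im y - b0)"
  shows "(\<integral>\<^sup>+ y. f y * indicator (annulus t) y \<partial>lborel) \<le> ennreal (8 * t) * (\<integral>\<^sup>+ u. h u \<partial>lborel)"
proof -
  define sl where "sl = (\<lambda>a. {b :: real. 1/2 \<le> \<bar>b\<bar> \<and> 1 - t \<le> a\<^sup>2 + b\<^sup>2 \<and> a\<^sup>2 + b\<^sup>2 < 1})"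
  have sl_meas [measurable]: "sl a \<in> sets borel" for a unfolding sl_def by measurable
  define U where "U = annulus t \<inter> {y. 1/2 \<le> \<bar>Im y\<bar>}"
  define V where "V = annulus t \<inter> {y. 1/2 \<le> \<bar>Re y\<bar>}"
  have [measurable]: "U \<in> sets borel" "V \<in> sets borel" unfolding U_def V_def by measurable
  have shift: "(\<integral>\<^sup>+ u. h (u - c) \<partial>lborel) = (\<integral>\<^sup>+ u. h u \<partial>lborel)" for c
    using nn_integral_real_affine[of h 1 "-c"] by simp
  have slice: "(\<integral>\<^sup>+ b. indicator (sl a) b \<partial>lborel) \<le> ennreal (4 * t)" for a
    using emeasure_circular_slice_le[OF t(1), of a] by (simp add: sl_def)
  have "(\<integral>\<^sup>+ y. f y * indicator U y \<partial>lborel)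
      = (\<integral>\<^sup>+ a. \<integral>\<^sup>+ b. f (Complex a b) * indicator U (Complex a b) \<partial>lborel \<partial>lborel)"
    by (rule nn_integral_lborel_complex) auto
  also have "\<dots> \<le> (\<integral>\<^sup>+ a. \<integral>\<^sup>+ b. h (a - a0) * indicator (sl a) b \<partial>lborel \<partial>lborel)"
  proof (intro nn_integral_mono)
    fix a b :: real
    show "f (Complex a b) * indicator U (Complex a b) \<le> h (a - a0) * indicator (sl a) b"
      using Re[of "Complex a b"] by (auto simp: U_def annulus_def sl_def cmod_power2 indicator_def)
  qed
  also have "\<dots> = (\<integral>\<^sup>+ a. h (a - a0) * (\<integral>\<^sup>+ b. indicator (sl a) b \<partial>lborel) \<partial>lborel)"
    by (subst nn_integral_cmult) auto
  also have "\<dots> \<le> (\<integral>\<^sup>+ a. h (a - a0) * ennreal (4 * t) \<partial>lborel)"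
    by (intro nn_integral_mono mult_left_mono slice) auto
  also have "\<dots> = ennreal (4 * t) * (\<integral>\<^sup>+ u. h u \<partial>lborel)"
    by (subst nn_integral_multc) (auto simp: shift mult.commute)
  finally have U: "(\<integral>\<^sup>+ y. f y * indicator U y \<partial>lborel) \<le> ennreal (4 * t) * (\<integral>\<^sup>+ u. h u \<partial>lborel)" .
  have "(\<integral>\<^sup>+ y. f y * indicator V y \<partial>lborel)
      = (\<integral>\<^sup>+ b. \<integral>\<^sup>+ a. f (Complex a b) * indicator V (Complex a b) \<partial>lborel \<partial>lborel)"
    by (rule nn_integral_lborel_complex) auto
  also have "\<dots> \<le> (\<integral>\<^sup>+ b. \<integral>\<^sup>+ a. h (b - b0) * indicator (sl b) a \<partial>lborel \<partial>lborel)"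
  proof (intro nn_integral_mono)
    fix a b :: real
    show "f (Complex a b) * indicator V (Complex a b) \<le> h (b - b0) * indicator (sl b) a"
      using Im[of "Complex a b"]
      by (auto simp: V_def annulus_def sl_def cmod_power2 indicator_def add.commute)
  qed
  also have "\<dots> = (\<integral>\<^sup>+ b. h (b - b0) * (\<integral>\<^sup>+ a. indicator (sl b) a \<partial>lborel) \<partial>lborel)"
    by (subst nn_integral_cmult) auto
  also have "\<dots> \<le> (\<integral>\<^sup>+ b. h (b - b0) * ennreal (4 * t) \<partial>lborel)"
    by (intro nn_integral_mono mult_left_mono slice) auto
  also have "\<dots> = ennreal (4 * t) * (\<integral>\<^sup>+ u. h u \<partial>lborel)"
    by (subst nn_integral_multc) (auto simp: shift mult.commute)
  finally have V: "(\<integral>\<^sup>+ y. f y * indicator V y \<partial>lborel) \<le> ennreal (4 * t) * (\<integral>\<^sup>+ u. h u \<partial>lborel)" .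
  have "(\<integral>\<^sup>+ y. f y * indicator (annulus t) y \<partial>lborel)
      \<le> (\<integral>\<^sup>+ y. f y * indicator U y + f y * indicator V y \<partial>lborel)"
  proof (intro nn_integral_mono)
    fix y :: complex
    have "y \<in> U \<or> y \<in> V" if y: "y \<in> annulus t"
    proof (rule ccontr)
      assume "\<not> ?thesis"
      hence "\<bar>Re y\<bar> < 1/2" "\<bar>Im y\<bar> < 1/2" using y by (auto simp: U_def V_def)
      hence "\<bar>Re y\<bar>\<^sup>2 < (1/2)\<^sup>2" "\<bar>Im y\<bar>\<^sup>2 < (1/2)\<^sup>2" by (intro power_strict_mono; simp)+
      moreover have "1 - t \<le> (Re y)\<^sup>2 + (Im y)\<^sup>2" using y by (auto simp: annulus_def cmod_power2)
      ultimately show False using t by (simp add: power_divide)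
    qed
    thus "f y * indicator (annulus t) y \<le> f y * indicator U y + f y * indicator V y"
      by (auto simp: indicator_def)
  qed
  also have "\<dots> = (\<integral>\<^sup>+ y. f y * indicator U y \<partial>lborel) + (\<integral>\<^sup>+ y. f y * indicator V y \<partial>lborel)"
    by (rule nn_integral_add) auto
  also have "\<dots> \<le> ennreal (4 * t) * (\<integral>\<^sup>+ u. h u \<partial>lborel) + ennreal (4 * t) * (\<integral>\<^sup>+ u. h u \<partial>lborel)"
    by (intro add_mono U V)
  also have "\<dots> = ennreal (8 * t) * (\<integral>\<^sup>+ u. h u \<partial>lborel)"
    using t by (subst distrib_right[symmetric], subst ennreal_plus[symmetric]) auto
  finally show ?thesis .
qed

text \<open>The value at 0 is set apart because \<open>1 / 0 = 0\<close> would make it 0.\<close>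
definition log_majorant :: "real \<Rightarrow> ennreal" where
  "log_majorant u = (if u = 0 then \<infinity> else ennreal (ln (1 + 1 / u\<^sup>2)))"

lemma log_majorant_measurable [measurable]: "log_majorant \<in> borel_measurable borel"
  unfolding log_majorant_def by measurable

lemma nn_integral_log_majorant_finite: "(\<integral>\<^sup>+ u. log_majorant u \<partial>lborel) < \<infinity>"
proof -
  define f :: "real \<Rightarrow> real" where "f = (\<lambda>u. ln (1 + 1 / u\<^sup>2))"
  have [measurable]: "f \<in> borel_measurable borel" unfolding f_def by measurable
  have f0: "0 \<le> f u" for u by (auto simp: f_def)
  have "set_integrable lborel (einterval 0 \<infinity>) f"
  \<comment> \<open>Integration by parts gives this antiderivative: the term from differentiating
    the logarithm cancels against the derivative of \<open>2 * arctan u\<close>. Its limits at 0 and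
    at infinity are finite.\<close>
  proof (rule interval_integral_FTC_nonneg(1)[where F = "\<lambda>u. u * ln (1 + 1 / u\<^sup>2) + 2 * arctan u"])
    fix x :: real assume "0 < ereal x"
    hence x: "x > 0" by simp
    have p: "1 + 1 / x\<^sup>2 > 0" by (intro add_pos_nonneg) auto
    have p2: "1 + x\<^sup>2 > 0" by (intro add_pos_nonneg) auto
    have "((\<lambda>u. u * ln (1 + 1 / u\<^sup>2) + 2 * arctan u) has_real_derivative
            (ln (1 + 1 / x\<^sup>2) + x * ((- 2 / x ^ 3) / (1 + 1 / x\<^sup>2)) + 2 * inverse (1 + x\<^sup>2))) (at x)"
      using x p by (auto intro!: derivative_eq_intros)
        (simp add: power2_eq_square power3_eq_cube power4_eq_xxxx)
    moreover have "x * ((- 2 / x ^ 3) / (1 + 1 / x\<^sup>2)) = - (2 * inverse (1 + x\<^sup>2))"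
      using x p p2 by (simp add: divide_simps power2_eq_square power3_eq_cube)
    ultimately show "((\<lambda>u. u * ln (1 + 1 / u\<^sup>2) + 2 * arctan u) has_real_derivative f x) (at x)"
      by (simp add: f_def)
    show "isCont f x" unfolding f_def using x p by (intro continuous_intros) auto
  next
    show "(((\<lambda>u. u * ln (1 + 1 / u\<^sup>2) + 2 * arctan u) \<circ> real_of_ereal) \<longlongrightarrow> 0) (at_right 0)"
      unfolding comp_def zero_ereal_def by (subst ereal_tendsto_simps1(2)[unfolded comp_def]) real_asymp
    show "(((\<lambda>u. u * ln (1 + 1 / u\<^sup>2) + 2 * arctan u) \<circ> real_of_ereal) \<longlongrightarrow> pi) (at_left \<infinity>)"
      unfolding comp_def by (subst ereal_tendsto_simps1(3)[unfolded comp_def]) real_asymp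
  qed (auto simp: f0)
  hence "integrable lborel (\<lambda>u. indicator {0<..} u * f u)"
    by (auto simp: set_integrable_def einterval_def greaterThan_def)
  hence "(\<integral>\<^sup>+ u. ennreal (norm (indicator {0<..} u * f u)) \<partial>lborel) < \<infinity>"
    by (simp add: integrable_iff_bounded)
  moreover have "(\<integral>\<^sup>+ u. ennreal (norm (indicator {0<..} u * f u)) \<partial>lborel)
      = (\<integral>\<^sup>+ u. log_majorant u * indicator {0<..} u \<partial>lborel)"
    by (intro nn_integral_cong) (auto simp: f_def log_majorant_def indicator_def)
  ultimately have pos: "(\<integral>\<^sup>+ u. log_majorant u * indicator {0<..} u \<partial>lborel) < \<infinity>" by simp
  have neg: "(\<integral>\<^sup>+ u. log_majorant u * indicator {..<0} u \<partial>lborel)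
      = (\<integral>\<^sup>+ u. log_majorant u * indicator {0<..} u \<partial>lborel)"
    by (subst nn_integral_real_affine[where c = "-1" and t = 0])
       (auto intro!: nn_integral_cong simp: log_majorant_def indicator_def)
  have "(\<integral>\<^sup>+ u. log_majorant u \<partial>lborel)
      = (\<integral>\<^sup>+ u. log_majorant u * indicator {0<..} u + log_majorant u * indicator {..<0} u \<partial>lborel)"
    using AE_lborel_singleton[of "0::real"]
    by (intro nn_integral_cong_AE) (auto simp: indicator_def elim!: eventually_mono)
  also have "\<dots> = (\<integral>\<^sup>+ u. log_majorant u * indicator {0<..} u \<partial>lborel)
      + (\<integral>\<^sup>+ u. log_majorant u * indicator {..<0} u \<partial>lborel)"
    by (rule nn_integral_add) auto
  finally show ?thesis using pos neg by simp
qed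

lemma nn_integral_log_majorant_scaled:
  assumes "c > 0"
  shows "(\<integral>\<^sup>+ u. log_majorant (u / c) \<partial>lborel) = ennreal c * (\<integral>\<^sup>+ u. log_majorant u \<partial>lborel)"
  using assms by (subst nn_integral_real_affine[where c = c and t = 0]) auto

text \<open>Made for \<open>r = cmod (x - y)\<close> and \<open>u\<close> one coordinate of that
  difference: \<open>log_majorant\<close> decreases in the modulus of \<open>u\<close>, so passing
  to a coordinate only enlarges it.\<close>

lemma log_majorant_ge_ln:
  assumes "0 < c" "\<bar>u\<bar> \<le> r" "0 < r" "t \<le> c\<^sup>2 / r\<^sup>2" "0 \<le> t"
  shows "ennreal (ln (1 + t)) \<le> log_majorant (u / c)"
proof (cases "u = 0")
  case False
  have "u\<^sup>2 \<le> r\<^sup>2" using assms by (metis abs_le_square_iff abs_of_pos)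
  hence "c\<^sup>2 / r\<^sup>2 \<le> c\<^sup>2 / u\<^sup>2" using False assms(3) by (intro divide_left_mono) auto
  hence "ln (1 + t) \<le> ln (1 + c\<^sup>2 / u\<^sup>2)" using assms by (subst ln_le_cancel_iff) (auto intro: add_pos_nonneg)
  thus ?thesis using False assms by (auto simp: log_majorant_def power_divide intro!: ennreal_leI)
qed (auto simp: log_majorant_def)

text \<open>From \<open>1 - 1 / (1 + t) \<le> ln (1 + t)\<close> with
  \<open>t = c\<^sup>2 / u\<^sup>2\<close>. Thus one integrable function dominates both the
  logarithmic energy and the algebraic kernels, and a single finite integral serves for all
  estimates.\<close>

lemma log_majorant_ge_inverse:
  assumes "0 < c"
  shows "ennreal (c\<^sup>2 / (c\<^sup>2 + u\<^sup>2)) \<le> log_majorant (u / c)"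
proof (cases "u = 0")
  case False
  have u: "u\<^sup>2 > 0" "c\<^sup>2 > 0" using False assms by auto
  define t where "t = c\<^sup>2 / u\<^sup>2"
  have t: "t > 0" using u by (simp add: t_def)
  have "ln (1 / (1 + t)) \<le> 1 / (1 + t) - 1" using t by (intro ln_le_minus_one) auto
  hence "1 - 1 / (1 + t) \<le> ln (1 + t)" using t by (simp add: ln_div)
  moreover have "1 - 1 / (1 + t) = c\<^sup>2 / (c\<^sup>2 + u\<^sup>2)" using u by (simp add: t_def field_simps)
  ultimately show ?thesis using False assms
    by (auto simp: log_majorant_def t_def power_divide intro!: ennreal_leI)
qed (auto simp: log_majorant_def)

text \<open>The variables separate because \<open>(c\<^sup>2 + p) * (c\<^sup>2 + q) \<le> (c\<^sup>2
  + p + q)\<^sup>2\<close> for nonnegative \<open>p\<close> and \<open>q\<close>; each factor is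
  then a one-dimensional integral of width \<open>c\<close>.\<close>

lemma nn_integral_inverse_square_le:
  fixes w :: complex
  assumes c: "c > 0"
  shows "(\<integral>\<^sup>+ y. ennreal (1 / (c\<^sup>2 + (cmod (y - w))\<^sup>2)\<^sup>2) \<partial>lborel)
     \<le> ennreal (1 / c\<^sup>2) * (\<integral>\<^sup>+ u. log_majorant u \<partial>lborel)\<^sup>2"
proof -
  let ?I = "\<integral>\<^sup>+ u. log_majorant u \<partial>lborel"
  have shift: "(\<integral>\<^sup>+ u. log_majorant ((u - r) / c) \<partial>lborel) = ennreal c * ?I" for r
    using nn_integral_real_affine[of "\<lambda>u. log_majorant ((u - r) / c)" 1 r]
    by (simp add: nn_integral_log_majorant_scaled[OF c])
  have "(\<integral>\<^sup>+ y. ennreal (1 / (c\<^sup>2 + (cmod (y - w))\<^sup>2)\<^sup>2) \<partial>lborel)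
     = (\<integral>\<^sup>+ a. \<integral>\<^sup>+ b. ennreal (1 / (c\<^sup>2 + (cmod (Complex a b - w))\<^sup>2)\<^sup>2) \<partial>lborel \<partial>lborel)"
    by (rule nn_integral_lborel_complex) measurable
  also have "\<dots> \<le> (\<integral>\<^sup>+ a. \<integral>\<^sup>+ b. ennreal (1 / c ^ 4) *
      (log_majorant ((a - Re w) / c) * log_majorant ((b - Im w) / c)) \<partial>lborel \<partial>lborel)"
  proof (intro nn_integral_mono)
    fix a b :: real
    define p where "p = (a - Re w)\<^sup>2"
    define q where "q = (b - Im w)\<^sup>2"
    have pq: "p \<ge> 0" "q \<ge> 0" "c\<^sup>2 > 0" using c by (auto simp: p_def q_def)
    have "(c\<^sup>2 + p) * (c\<^sup>2 + q) \<le> (c\<^sup>2 + (p + q)) * (c\<^sup>2 + (p + q))"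
      using pq by (intro mult_mono) auto
    hence "1 / (c\<^sup>2 + (p + q))\<^sup>2 \<le> 1 / ((c\<^sup>2 + p) * (c\<^sup>2 + q))"
      unfolding power2_eq_square[of "c\<^sup>2 + (p + q)"] using pq
      by (intro divide_left_mono mult_pos_pos add_pos_nonneg add_nonneg_nonneg) auto
    also have "\<dots> = 1 / c ^ 4 * (c\<^sup>2 / (c\<^sup>2 + p) * (c\<^sup>2 / (c\<^sup>2 + q)))"
      using c by (simp add: power2_eq_square power4_eq_xxxx)
    finally have "ennreal (1 / (c\<^sup>2 + (p + q))\<^sup>2)
        \<le> ennreal (1 / c ^ 4) * (ennreal (c\<^sup>2 / (c\<^sup>2 + p)) * ennreal (c\<^sup>2 / (c\<^sup>2 + q)))"
      using pq c by (subst ennreal_mult[symmetric], simp, simp, subst ennreal_mult[symmetric]) (auto intro!: ennreal_leI)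
    also have "\<dots> \<le> ennreal (1 / c ^ 4) *
      (log_majorant ((a - Re w) / c) * log_majorant ((b - Im w) / c))"
      unfolding p_def q_def by (intro mult_mono log_majorant_ge_inverse[OF c]) auto
    finally show "ennreal (1 / (c\<^sup>2 + (cmod (Complex a b - w))\<^sup>2)\<^sup>2) \<le> ennreal (1 / c ^ 4) *
      (log_majorant ((a - Re w) / c) * log_majorant ((b - Im w) / c))"
      by (simp add: cmod_power2 p_def q_def)
  qed
  also have "\<dots> = ennreal (1 / c ^ 4) * ((ennreal c * ?I) * (ennreal c * ?I))"
    by (simp add: nn_integral_cmult nn_integral_multc shift)
  also have "\<dots> = ennreal (1 / c ^ 4) * ennreal (c\<^sup>2) * ?I\<^sup>2"
    using c by (simp add: power2_eq_square ennreal_mult' mult_ac)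
  also have "ennreal (1 / c ^ 4) * ennreal (c\<^sup>2) = ennreal (1 / c\<^sup>2)"
    using c by (subst ennreal_mult'[symmetric]) (auto simp: power2_eq_square power4_eq_xxxx)
  finally show ?thesis .
qed

section \<open>First and second moments of the point process\<close>

lemma sets_disc_mu [simp, measurable_cong]: "sets disc_mu = sets borel"
  by (simp add: disc_mu_def)

lemma space_disc_mu [simp]: "space disc_mu = UNIV"
  by (simp add: disc_mu_def)

lemma nn_integral_disc_mu:
  assumes [measurable]: "f \<in> borel_measurable borel"
  shows "(\<integral>\<^sup>+ x. f x \<partial>disc_mu) = ennreal (1 / pi) * (\<integral>\<^sup>+ x. f x * indicator (ball 0 1) x \<partial>lborel)"
  unfolding disc_mu_def
  by (subst nn_integral_density; (subst nn_integral_cmult[symmetric])?)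
     (auto intro!: nn_integral_cong simp: indicator_def)

lemma finite_measure_disc_mu: "finite_measure disc_mu"
proof (rule finite_measureI)
  have "emeasure disc_mu (space disc_mu) = ennreal (1 / pi) * emeasure lborel (ball (0 :: complex) 1)"
    using nn_integral_disc_mu[of "\<lambda>_. 1"] by simp
  also have "\<dots> \<noteq> \<infinity>" by (simp add: emeasure_ball ennreal_mult_eq_top_iff)
  finally show "emeasure disc_mu (space disc_mu) \<noteq> \<infinity>" .
qed

interpretation disc_mu: finite_measure disc_mu
  by (rule finite_measure_disc_mu)

interpretation disc_mu_prod: product_sigma_finite "\<lambda>_. disc_mu"
  by unfold_locales

text \<open>The first correlation measure: the density is \<open>bergman_kernel x x\<close>. Up to a
  constant factor it is hyperbolic area on the disc.\<close>

definition intensity :: "complex measure" where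
  "intensity = density disc_mu (\<lambda>x. ennreal (1 / (1 - (cmod x)\<^sup>2)\<^sup>2))"

lemma sets_intensity [simp, measurable_cong]: "sets intensity = sets borel"
  by (simp add: intensity_def)

interpretation intensity: sigma_finite_measure intensity
  unfolding intensity_def by (subst disc_mu.sigma_finite_iff_density_finite) auto

lemma bergman_kernel_diag: "bergman_kernel x x = complex_of_real (1 / (1 - (cmod x)\<^sup>2)\<^sup>2)"
  unfolding bergman_kernel_def complex_norm_square[symmetric] by simp

lemma bergman_kernel_swap: "bergman_kernel y x = cnj (bergman_kernel x y)"
  by (simp add: bergman_kernel_def mult.commute)

lemma Re_kernel_det_1: "Re (kernel_det bergman_kernel 1 x) = 1 / (1 - (cmod (x 0))\<^sup>2)\<^sup>2"
  by (simp add: kernel_det_def permutes_sing lessThan_Suc bergman_kernel_diag sign_id)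

lemma Re_kernel_det_2_le:
  "Re (kernel_det bergman_kernel 2 x) \<le> (1 / (1 - (cmod (x 0))\<^sup>2)\<^sup>2) * (1 / (1 - (cmod (x 1))\<^sup>2)\<^sup>2)"
proof -
  have two: "{..<2} = {0, 1::nat}" by auto
  have f: "finite {1::nat}" "0 \<notin> {1::nat}" by auto
  have "kernel_det bergman_kernel 2 x
      = bergman_kernel (x 0) (x 0) * bergman_kernel (x 1) (x 1)
        - bergman_kernel (x 0) (x 1) * bergman_kernel (x 1) (x 0)"
    unfolding kernel_det_def two
    unfolding sum_over_permutations_insert[OF f]
    unfolding permutes_sing
    by (simp add: sign_swap_id sign_id swap_id_eq)
  also have "\<dots> = complex_of_real ((1 / (1 - (cmod (x 0))\<^sup>2)\<^sup>2) * (1 / (1 - (cmod (x 1))\<^sup>2)\<^sup>2)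
        - (cmod (bergman_kernel (x 0) (x 1)))\<^sup>2)"
    unfolding bergman_kernel_swap[of "x 1" "x 0"] bergman_kernel_diag
    unfolding complex_norm_square[symmetric] by simp
  finally show ?thesis by simp
qed

lemma rc_borel_subset: "rc_borel B \<Longrightarrow> A \<subseteq> B \<Longrightarrow> A \<in> sets borel \<Longrightarrow> rc_borel A"
  unfolding rc_borel_def using closure_mono by blast

lemma rc_borel_sets [measurable_dest]: "rc_borel B \<Longrightarrow> B \<in> sets borel"
  by (simp add: rc_borel_def)

lemma rc_borel_subset_ball: "rc_borel B \<Longrightarrow> B \<subseteq> ball 0 1"
  unfolding rc_borel_def using closure_subset by blast

lemma Conf_finite_Int:
  assumes "X \<in> Conf" "rc_borel B"
  shows "finite (X \<inter> B)"
proof -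
  have "bounded (closure B)"
    using assms(2) bounded_subset[OF bounded_ball] unfolding rc_borel_def by blast
  hence "compact (closure B)" by (simp add: compact_eq_bounded_closed)
  hence "finite (X \<inter> closure B)" using assms unfolding Conf_def rc_borel_def by blast
  thus ?thesis by (rule finite_subset[rotated]) (use closure_subset in blast)
qed

lemma indicator_PiE_eq_prod:
  assumes "x \<in> extensional I" "finite I"
  shows "(indicator (\<Pi>\<^sub>E i\<in>I. B i) x :: ennreal) = (\<Prod>i\<in>I. indicator (B i) (x i))"
proof (cases "x \<in> (\<Pi>\<^sub>E i\<in>I. B i)")
  case True
  thus ?thesis by (auto simp: PiE_iff)
next
  case False
  then obtain i where "i \<in> I" "x i \<notin> B i" using assms by (auto simp: PiE_iff)
  hence "(\<Prod>i\<in>I. indicator (B i) (x i) :: ennreal) = 0"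
    using assms(2) by (intro prod_zero bexI[of _ i]) auto
  thus ?thesis using False by simp
qed

lemma emeasure_intensity:
  assumes "B \<in> sets borel"
  shows "emeasure intensity B = (\<integral>\<^sup>+ x. indicator B x * ennreal (1 / (1 - (cmod x)\<^sup>2)\<^sup>2) \<partial>disc_mu)"
  unfolding intensity_def using assms by (subst emeasure_density) (auto simp: mult.commute)

lemma floor_eq_imp_dist_less:
  fixes a b :: real
  assumes "\<lfloor>2 ^ m * a\<rfloor> = \<lfloor>2 ^ m * b\<rfloor>"
  shows "\<bar>a - b\<bar> < (1/2) ^ m"
proof -
  have "\<bar>2 ^ m * a - 2 ^ m * b\<bar> < 1" using assms by linarith
  hence "2 ^ m * \<bar>a - b\<bar> < 1" by (simp add: abs_mult right_diff_distrib[symmetric])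
  thus ?thesis by (simp add: field_simps power_one_over)
qed

context
  fixes P :: "complex set measure"
  assumes dpp: "is_DPP P bergman_kernel"
begin

lemma DPP_space: "space P = Conf" using dpp by (simp add: is_DPP_def)

lemma DPP_prob_space: "prob_space P" using dpp by (simp add: is_DPP_def)

lemma DPP_card_measurable:
  assumes "rc_borel B"
  shows "(\<lambda>X. card (X \<inter> B)) \<in> measurable P (count_space UNIV)"
proof -
  let ?G = "{{X \<in> Conf. card (X \<inter> B) = n} | B n. rc_borel B}"
  have "?G \<subseteq> Pow Conf" by auto
  hence "{X \<in> Conf. card (X \<inter> B) = n} \<in> sets conf_space" for n
    unfolding conf_space_def using assms by (subst sets_measure_of) auto
  moreover have "sets P = sets conf_space" using dpp by (simp add: is_DPP_def)
  moreover have "(\<lambda>X. card (X \<inter> B)) -` {n} \<inter> space P = {X \<in> Conf. card (X \<inter> B) = n}" for n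
    by (auto simp: DPP_space)
  ultimately show ?thesis by (subst measurable_count_space_eq_countable) auto
qed

lemma DPP_card_borel_measurable:
  assumes "rc_borel B"
  shows "(\<lambda>X. (of_nat (card (X \<inter> B)) :: ennreal)) \<in> borel_measurable P"
  using measurable_compose[OF DPP_card_measurable[OF assms], of of_nat borel] by simp

lemma DPP_moment:
  assumes "\<And>i. i < k \<Longrightarrow> rc_borel (B i)" "disjoint_family_on B {..<k}"
  shows "(\<integral>\<^sup>+ X. (\<Prod>i<k. of_nat (card (X \<inter> B i))) \<partial>P) =
        (\<integral>\<^sup>+ x. indicator (\<Pi>\<^sub>E i\<in>{..<k}. B i) x * ennreal (Re (kernel_det bergman_kernel k x))
            \<partial>(PiM {..<k} (\<lambda>_. disc_mu)))"
  using dpp assms unfolding is_DPP_def by blast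

lemma DPP_mean:
  assumes B: "rc_borel B"
  shows "(\<integral>\<^sup>+ X. of_nat (card (X \<inter> B)) \<partial>P) = emeasure intensity B"
proof -
  have [measurable]: "B \<in> sets borel" using B by (rule rc_borel_sets)
  have "(\<integral>\<^sup>+ X. of_nat (card (X \<inter> B)) \<partial>P)
      = (\<integral>\<^sup>+ X. (\<Prod>i<(1::nat). of_nat (card (X \<inter> (\<lambda>_. B) i))) \<partial>P)" by simp
  also have "\<dots> = (\<integral>\<^sup>+ x. indicator (\<Pi>\<^sub>E i\<in>{..<1}. B) x * ennreal (Re (kernel_det bergman_kernel 1 x))
            \<partial>(PiM {..<1} (\<lambda>_. disc_mu)))"
    by (rule DPP_moment) (auto simp: B disjoint_family_on_def)
  also have "\<dots> = (\<integral>\<^sup>+ x. (\<Prod>i\<in>{..<1::nat}. indicator B (x i) * ennreal (1 / (1 - (cmod (x i))\<^sup>2)\<^sup>2))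
            \<partial>(PiM {..<1} (\<lambda>_. disc_mu)))"
    unfolding Re_kernel_det_1
    by (intro nn_integral_cong, subst indicator_PiE_eq_prod) (auto simp: space_PiM PiE_iff)
  also have "\<dots> = (\<Prod>i\<in>{..<1::nat}. \<integral>\<^sup>+ x. indicator B x * ennreal (1 / (1 - (cmod x)\<^sup>2)\<^sup>2) \<partial>disc_mu)"
    by (rule disc_mu_prod.product_nn_integral_prod) auto
  finally show ?thesis by (simp add: emeasure_intensity)
qed

text \<open>Disjointness is what makes the correlation formula applicable; for overlapping sets the
  product of counts would also contain diagonal pairs.\<close>

lemma DPP_pair_le:
  assumes B: "rc_borel B" and C: "rc_borel C" and disj: "B \<inter> C = {}"
  shows "(\<integral>\<^sup>+ X. of_nat (card (X \<inter> B)) * of_nat (card (X \<inter> C)) \<partial>P)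
    \<le> emeasure intensity B * emeasure intensity C"
proof -
  have [measurable]: "B \<in> sets borel" "C \<in> sets borel" using B C by (auto dest: rc_borel_sets)
  define D where "D = (\<lambda>i::nat. if i = 0 then B else C)"
  have two: "{..<2} = {0, 1::nat}" by auto
  have [measurable]: "D i \<in> sets borel" for i by (simp add: D_def)
  have "(\<integral>\<^sup>+ X. of_nat (card (X \<inter> B)) * of_nat (card (X \<inter> C)) \<partial>P)
      = (\<integral>\<^sup>+ X. (\<Prod>i<2. of_nat (card (X \<inter> D i))) \<partial>P)"
    unfolding two by (simp add: D_def)
  also have "\<dots> = (\<integral>\<^sup>+ x. indicator (\<Pi>\<^sub>E i\<in>{..<2}. D i) x * ennreal (Re (kernel_det bergman_kernel 2 x))
            \<partial>(PiM {..<2} (\<lambda>_. disc_mu)))"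
    using disj by (intro DPP_moment) (auto simp: B C D_def disjoint_family_on_def)
  also have "\<dots> \<le> (\<integral>\<^sup>+ x. (\<Prod>i\<in>{..<2::nat}. indicator (D i) (x i) * ennreal (1 / (1 - (cmod (x i))\<^sup>2)\<^sup>2))
            \<partial>(PiM {..<2} (\<lambda>_. disc_mu)))"
  proof (intro nn_integral_mono)
    fix x assume "x \<in> space (PiM {..<2::nat} (\<lambda>_. disc_mu))"
    hence x: "x \<in> extensional {..<2}" by (auto simp: space_PiM PiE_iff)
    have "ennreal (Re (kernel_det bergman_kernel 2 x))
        \<le> ennreal (1 / (1 - (cmod (x 0))\<^sup>2)\<^sup>2) * ennreal (1 / (1 - (cmod (x 1))\<^sup>2)\<^sup>2)"
      unfolding ennreal_mult[symmetric, OF zero_le_divide_1_iff[THEN iffD2] zero_le_divide_1_iff[THEN iffD2], OF zero_le_power2 zero_le_power2]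
      by (rule ennreal_leI) (rule Re_kernel_det_2_le)
    hence "indicator (\<Pi>\<^sub>E i\<in>{..<2}. D i) x * ennreal (Re (kernel_det bergman_kernel 2 x))
       \<le> (\<Prod>i\<in>{..<2::nat}. indicator (D i) (x i)) * (\<Prod>i\<in>{..<2::nat}. ennreal (1 / (1 - (cmod (x i))\<^sup>2)\<^sup>2))"
      unfolding indicator_PiE_eq_prod[OF x finite_lessThan]
      by (intro mult_left_mono) (auto simp: two)
    thus "indicator (\<Pi>\<^sub>E i\<in>{..<2}. D i) x * ennreal (Re (kernel_det bergman_kernel 2 x))
       \<le> (\<Prod>i\<in>{..<2::nat}. indicator (D i) (x i) * ennreal (1 / (1 - (cmod (x i))\<^sup>2)\<^sup>2))"
      by (simp add: prod.distrib)
  qed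
  also have "\<dots> = (\<Prod>i\<in>{..<2::nat}. \<integral>\<^sup>+ x. indicator (D i) x * ennreal (1 / (1 - (cmod x)\<^sup>2)\<^sup>2) \<partial>disc_mu)"
    by (rule disc_mu_prod.product_nn_integral_prod) auto
  also have "\<dots> = emeasure intensity B * emeasure intensity C"
    by (simp add: two D_def emeasure_intensity)
  finally show ?thesis .
qed

text \<open>Fatou's lemma over dyadic partitions: off the diagonal, the pair sum is the lower limit of
  sums over pairs of distinct, hence disjoint, cells, to which the correlation bound applies.\<close>
lemma DPP_pair_sum_majorant:
  fixes g :: "complex \<Rightarrow> complex \<Rightarrow> real"
  assumes B: "rc_borel B"
    and g0: "\<And>x y. 0 \<le> g x y"
    and gm [measurable]: "(\<lambda>p. g (fst p) (snd p)) \<in> borel_measurable (borel \<Otimes>\<^sub>M borel)"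
    and cont: "\<And>x y. x \<in> B \<Longrightarrow> y \<in> B \<Longrightarrow> x \<noteq> y \<Longrightarrow> isCont (\<lambda>p. g (fst p) (snd p)) (x, y)"
  obtains h where "h \<in> borel_measurable P"
    and "\<And>X. X \<in> Conf \<Longrightarrow> ennreal (\<Sum>x\<in>X \<inter> B. \<Sum>y\<in>X \<inter> B - {x}. g x y) \<le> h X"
    and "(\<integral>\<^sup>+ X. h X \<partial>P) \<le> (\<integral>\<^sup>+ x. (\<integral>\<^sup>+ y. ennreal (g x y) * indicator B y \<partial>intensity) * indicator B x \<partial>intensity)"
proof -
  have [measurable]: "B \<in> sets borel" using B by (rule rc_borel_sets)
  have gx [measurable]: "g x \<in> borel_measurable borel" for x
    using measurable_compose[OF measurable_Pair1'[of x borel borel] gm] by simp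
  \<comment> \<open>Index of the dyadic square of side \<open>(1/2) ^ m\<close> that contains the
    point.\<close>
  define idx :: "nat \<Rightarrow> complex \<Rightarrow> int \<times> int" where
    "idx = (\<lambda>m x. (\<lfloor>2 ^ m * Re x\<rfloor>, \<lfloor>2 ^ m * Im x\<rfloor>))"
  define I :: "nat \<Rightarrow> (int \<times> int) set" where "I = (\<lambda>m. {-(2 ^ m)..2 ^ m} \<times> {-(2 ^ m)..2 ^ m})"
  have finI: "finite (I m)" for m by (simp add: I_def)
  have idxI: "idx m x \<in> I m" if "x \<in> B" for m x
  proof -
    have "cmod x < 1" using rc_borel_subset_ball[OF B] that by auto
    hence "\<bar>Re x\<bar> \<le> 1" "\<bar>Im x\<bar> \<le> 1"
      using abs_Re_le_cmod[of x] abs_Im_le_cmod[of x] by linarith+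
    hence "\<bar>2 ^ m * Re x\<bar> \<le> 2 ^ m" "\<bar>2 ^ m * Im x\<bar> \<le> 2 ^ m" by (simp_all add: abs_mult)
    moreover have "\<lfloor>v\<rfloor> \<in> {-(2 ^ m)..2 ^ m}" if "\<bar>v\<bar> \<le> 2 ^ m" for v :: real
    proof -
      have "v < 2 ^ m + 1" "- (2 ^ m) \<le> v" using that by linarith+
      thus ?thesis by (simp add: le_floor_iff floor_le_iff)
    qed
    ultimately show ?thesis by (simp only: idx_def I_def mem_Times_iff fst_conv snd_conv)
  qed
  define C where "C = (\<lambda>m i. {x \<in> B. idx m x = i})"
  have C_meas [measurable]: "C m i \<in> sets borel" for m i
    by (cases i) (simp add: C_def idx_def)
  have C_rc: "rc_borel (C m i)" for m i
    by (rule rc_borel_subset[OF B _ C_meas]) (auto simp: C_def)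
  have C_disj: "C m i \<inter> C m j = {}" if "i \<noteq> j" for m i j using that by (auto simp: C_def)
  \<comment> \<open>The infimum serves both sides: it is below \<open>g\<close> in the integral and,
    by continuity, close to \<open>g\<close> at the points of a configuration. Over an empty cell it
    is infinite, but there the counts and the intensity vanish, and
    \<open>0 * \<infinity> = 0\<close> in \<open>ennreal\<close>.\<close>
  define \<gamma> where "\<gamma> = (\<lambda>m i j. INF p\<in>C m i \<times> C m j. ennreal (g (fst p) (snd p)))"
  have \<gamma>_le: "\<gamma> m i j \<le> ennreal (g x y)" if "x \<in> C m i" "y \<in> C m j" for m i j x y
    unfolding \<gamma>_def by (rule INF_lower2[of "(x, y)"]) (use that in auto)
  define H where "H = (\<lambda>m X. \<Sum>i\<in>I m. \<Sum>j\<in>I m - {i}.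
      \<gamma> m i j * (of_nat (card (X \<inter> C m i)) * of_nat (card (X \<inter> C m j))))"
  note [measurable] = DPP_card_borel_measurable[OF C_rc]
  have [measurable]: "H m \<in> borel_measurable P" for m unfolding H_def by measurable
  define J where "J = (\<integral>\<^sup>+ x. (\<integral>\<^sup>+ y. ennreal (g x y) * indicator B y \<partial>intensity) * indicator B x \<partial>intensity)"

  have H_int: "(\<integral>\<^sup>+ X. H m X \<partial>P) \<le> J" for m
  proof -
    have "(\<integral>\<^sup>+ X. H m X \<partial>P) = (\<Sum>i\<in>I m. \<Sum>j\<in>I m - {i}.
        \<gamma> m i j * (\<integral>\<^sup>+ X. of_nat (card (X \<inter> C m i)) * of_nat (card (X \<inter> C m j)) \<partial>P))"
      unfolding H_def by (simp add: nn_integral_sum nn_integral_cmult)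
    also have "\<dots> \<le> (\<Sum>i\<in>I m. \<Sum>j\<in>I m - {i}.
        \<gamma> m i j * (emeasure intensity (C m i) * emeasure intensity (C m j)))"
      by (intro sum_mono mult_left_mono DPP_pair_le[OF C_rc C_rc] C_disj) auto
    also have "\<dots> \<le> (\<Sum>i\<in>I m. \<Sum>j\<in>I m - {i}.
        (\<integral>\<^sup>+ x. (\<integral>\<^sup>+ y. ennreal (g x y) * indicator (C m j) y \<partial>intensity) * indicator (C m i) x \<partial>intensity))"
    proof (intro sum_mono)
      fix i j
      have "\<gamma> m i j * (emeasure intensity (C m i) * emeasure intensity (C m j))
         = (\<integral>\<^sup>+ x. (\<integral>\<^sup>+ y. \<gamma> m i j * indicator (C m j) y \<partial>intensity) * indicator (C m i) x \<partial>intensity)"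
        by (subst nn_integral_cmult_indicator, simp, subst nn_integral_cmult_indicator) (auto simp: mult_ac)
      also have "\<dots> \<le> (\<integral>\<^sup>+ x. (\<integral>\<^sup>+ y. ennreal (g x y) * indicator (C m j) y \<partial>intensity) * indicator (C m i) x \<partial>intensity)"
      proof (intro nn_integral_mono)
        fix x
        show "(\<integral>\<^sup>+ y. \<gamma> m i j * indicator (C m j) y \<partial>intensity) * indicator (C m i) x
          \<le> (\<integral>\<^sup>+ y. ennreal (g x y) * indicator (C m j) y \<partial>intensity) * indicator (C m i) x"
          by (cases "x \<in> C m i")
             (auto intro!: nn_integral_mono simp: indicator_def \<gamma>_le)
      qed
      finally show "\<gamma> m i j * (emeasure intensity (C m i) * emeasure intensity (C m j))
        \<le> (\<integral>\<^sup>+ x. (\<integral>\<^sup>+ y. ennreal (g x y) * indicator (C m j) y \<partial>intensity) * indicator (C m i) x \<partial>intensity)" .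
    qed
    \<comment> \<open>The pairs \<open>i = j\<close> are added back: with them the cells tile
      \<open>B\<close> in both variables and the double sum collapses to \<open>J\<close>.\<close>
    also have "\<dots> \<le> (\<Sum>i\<in>I m. \<Sum>j\<in>I m.
        (\<integral>\<^sup>+ x. (\<integral>\<^sup>+ y. ennreal (g x y) * indicator (C m j) y \<partial>intensity) * indicator (C m i) x \<partial>intensity))"
      by (intro sum_mono sum_mono2 finI) auto
    also have "\<dots> = (\<integral>\<^sup>+ x. (\<integral>\<^sup>+ y. (\<Sum>j\<in>I m. ennreal (g x y) * indicator (C m j) y) \<partial>intensity)
        * (\<Sum>i\<in>I m. indicator (C m i) x) \<partial>intensity)"
    proof -
      have [measurable]: "(\<lambda>x. \<integral>\<^sup>+ y. ennreal (g x y) * indicator (C m j) y \<partial>intensity)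
          \<in> borel_measurable intensity" for j
        by (rule intensity.borel_measurable_nn_integral) (simp add: case_prod_beta)
      have "(\<integral>\<^sup>+ y. (\<Sum>j\<in>I m. ennreal (g x y) * indicator (C m j) y) \<partial>intensity)
          * (\<Sum>i\<in>I m. indicator (C m i) x)
        = (\<Sum>i\<in>I m. \<Sum>j\<in>I m. (\<integral>\<^sup>+ y. ennreal (g x y) * indicator (C m j) y \<partial>intensity)
            * indicator (C m i) x)" for x
        by (subst nn_integral_sum) (auto simp: sum_distrib_left sum_distrib_right)
      thus ?thesis by (simp add: nn_integral_sum)
    qed
    also have "\<dots> \<le> J"
    proof -
      have one: "(\<Sum>i\<in>I m. indicator (C m i) x) = (indicator B x :: ennreal)" for x
      proof (cases "x \<in> B")
        case True
        have "(\<Sum>i\<in>I m. indicator (C m i) x) = (\<Sum>i\<in>I m. if i = idx m x then 1 else 0 :: ennreal)"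
          using True by (intro sum.cong) (auto simp: C_def indicator_def)
        also have "\<dots> = 1" using idxI[OF True] finI by (simp add: sum.delta)
        finally show ?thesis using True by simp
      qed (auto simp: C_def)
      show ?thesis unfolding J_def sum_distrib_left[symmetric] one by simp
    qed
    finally show ?thesis .
  qed

  have H_ge: "ennreal (\<Sum>x\<in>X \<inter> B. \<Sum>y\<in>X \<inter> B - {x}. g x y) \<le> liminf (\<lambda>m. H m X)" if X: "X \<in> Conf" for X
  proof -
    define F where "F = X \<inter> B"
    have finF: "finite F" unfolding F_def using Conf_finite_Int[OF X B] .
    have ev: "\<forall>\<^sub>F m in sequentially. idx m x \<noteq> idx m y \<and> ennreal (g x y - e) \<le> \<gamma> m (idx m x) (idx m y)"
      if e: "e > 0" and xy: "x \<in> F" "y \<in> F" "x \<noteq> y" for x y e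
    proof -
      have "isCont (\<lambda>p. g (fst p) (snd p)) (x, y)" using xy by (intro cont) (auto simp: F_def)
      then obtain d where d: "d > 0"
        "\<And>p. dist p (x, y) < d \<Longrightarrow> dist (g (fst p) (snd p)) (g x y) < e"
        using e unfolding continuous_at_eps_delta by (auto simp: dist_commute)
      define d' where "d' = min d (dist x y)"
      have d': "d' > 0" using d xy by (auto simp: d'_def)
      \<comment> \<open>Two points of one cell are less than \<open>2 * (1/2) ^ m\<close> apart, and
        a pair of points moves by at most the sum of two such distances, whence the 4. The minimum
        in \<open>d'\<close> makes the same bound separate \<open>x\<close> from
        \<open>y\<close>.\<close>
      have "(\<lambda>m. 4 * (1/2 :: real) ^ m) \<longlonglongrightarrow> 4 * 0" by (intro tendsto_intros LIMSEQ_power_zero) auto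
      hence "\<forall>\<^sub>F m in sequentially. 4 * (1/2 :: real) ^ m < d'"
        using d' by (intro order_tendstoD) auto
      thus ?thesis
      proof (rule eventually_mono)
        fix m assume m: "4 * (1/2 :: real) ^ m < d'"
        have close: "dist a b < 2 * (1/2) ^ m" if "idx m a = idx m b" for a b
        proof -
          have "\<bar>Re a - Re b\<bar> < (1/2) ^ m" "\<bar>Im a - Im b\<bar> < (1/2) ^ m"
            using that by (auto intro!: floor_eq_imp_dist_less simp: idx_def)
          moreover have "cmod (a - b) \<le> \<bar>Re (a - b)\<bar> + \<bar>Im (a - b)\<bar>" by (rule cmod_le)
          ultimately show ?thesis by (simp add: dist_norm)
        qed
        have "idx m x \<noteq> idx m y"
        proof
          assume "idx m x = idx m y"
          hence "dist x y < 2 * (1/2) ^ m" by (rule close)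
          also have "\<dots> \<le> 4 * (1/2) ^ m" by simp
          finally show False using m by (simp add: d'_def)
        qed
        moreover have "ennreal (g x y - e) \<le> \<gamma> m (idx m x) (idx m y)"
          unfolding \<gamma>_def
        proof (rule INF_greatest)
          fix p assume "p \<in> C m (idx m x) \<times> C m (idx m y)"
          hence "dist (fst p) x < 2 * (1/2) ^ m" "dist (snd p) y < 2 * (1/2) ^ m"
            by (auto simp: C_def intro!: close)
          moreover have "dist p (x, y) \<le> dist (fst p) x + dist (snd p) y"
            unfolding dist_prod_def by (simp add: sqrt_sum_squares_le_sum)
          ultimately have "dist p (x, y) < d" using m by (simp add: d'_def)
          from d(2)[OF this] show "ennreal (g x y - e) \<le> ennreal (g (fst p) (snd p))"
            by (intro ennreal_leI) (auto simp: dist_real_def)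
        qed
        ultimately show "idx m x \<noteq> idx m y \<and> ennreal (g x y - e) \<le> \<gamma> m (idx m x) (idx m y)" by simp
      qed
    qed
    have low: "(\<Sum>x\<in>F. \<Sum>y\<in>F - {x}. ennreal (g x y - e)) \<le> liminf (\<lambda>m. H m X)" if e: "e > 0" for e
    proof (rule Liminf_bounded)
      have "\<forall>\<^sub>F m in sequentially. \<forall>x\<in>F. \<forall>y\<in>F - {x}.
          idx m x \<noteq> idx m y \<and> ennreal (g x y - e) \<le> \<gamma> m (idx m x) (idx m y)"
        using finF by (intro eventually_ball_finite ballI) (auto intro!: ev e)
      thus "\<forall>\<^sub>F m in sequentially. (\<Sum>x\<in>F. \<Sum>y\<in>F - {x}. ennreal (g x y - e)) \<le> H m X"
      proof (rule eventually_mono)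
        fix m assume m: "\<forall>x\<in>F. \<forall>y\<in>F - {x}.
          idx m x \<noteq> idx m y \<and> ennreal (g x y - e) \<le> \<gamma> m (idx m x) (idx m y)"
        have inj: "inj_on (idx m) F" using m by (auto simp: inj_on_def)
        let ?G = "\<lambda>i j. \<gamma> m i j * (of_nat (card (X \<inter> C m i)) * of_nat (card (X \<inter> C m j)))"
        have card_pos: "(1 :: ennreal) \<le> of_nat (card (X \<inter> C m (idx m x)))" if "x \<in> F" for x
        proof -
          have "x \<in> X \<inter> C m (idx m x)" using that by (auto simp: F_def C_def)
          hence "card (X \<inter> C m (idx m x)) \<noteq> 0" using Conf_finite_Int[OF X C_rc] by auto
          hence "real 1 \<le> real (card (X \<inter> C m (idx m x)))" by linarith
          thus ?thesis by (simp add: ennreal_of_nat_eq_real_of_nat)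
        qed
        have "(\<Sum>x\<in>F. \<Sum>y\<in>F - {x}. ennreal (g x y - e)) \<le> (\<Sum>x\<in>F. \<Sum>y\<in>F - {x}. ?G (idx m x) (idx m y))"
        proof (intro sum_mono)
          fix x y assume "x \<in> F" "y \<in> F - {x}"
          hence "ennreal (g x y - e) * (1 * 1) \<le> ?G (idx m x) (idx m y)"
            using m by (intro mult_mono card_pos) auto
          thus "ennreal (g x y - e) \<le> ?G (idx m x) (idx m y)" by simp
        qed
        also have "\<dots> = (\<Sum>x\<in>F. \<Sum>j\<in>idx m ` F - {idx m x}. ?G (idx m x) j)"
        proof (intro sum.cong refl)
          fix x assume x: "x \<in> F"
          have "idx m ` F - {idx m x} = idx m ` (F - {x})" using inj x by (auto simp: inj_on_def)
          moreover have "inj_on (idx m) (F - {x})" using inj by (rule inj_on_subset) auto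
          ultimately show "(\<Sum>y\<in>F - {x}. ?G (idx m x) (idx m y)) = (\<Sum>j\<in>idx m ` F - {idx m x}. ?G (idx m x) j)"
            by (simp add: sum.reindex)
        qed
        also have "\<dots> = (\<Sum>i\<in>idx m ` F. \<Sum>j\<in>idx m ` F - {i}. ?G i j)"
          using inj by (simp add: sum.reindex)
        also have "\<dots> \<le> (\<Sum>i\<in>idx m ` F. \<Sum>j\<in>I m - {i}. ?G i j)"
          using idxI finI by (intro sum_mono sum_mono2) (auto simp: F_def)
        also have "\<dots> \<le> (\<Sum>i\<in>I m. \<Sum>j\<in>I m - {i}. ?G i j)"
          using idxI finI by (intro sum_mono2) (auto simp: F_def)
        finally show "(\<Sum>x\<in>F. \<Sum>y\<in>F - {x}. ennreal (g x y - e)) \<le> H m X" by (simp add: H_def)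
      qed
    qed
    define M where "M = (\<Sum>x\<in>F. \<Sum>y\<in>F - {x}. 1 :: real)"
    have M0: "M \<ge> 0" unfolding M_def by (intro sum_nonneg) auto
    have "ennreal (\<Sum>x\<in>F. \<Sum>y\<in>F - {x}. g x y) \<le> liminf (\<lambda>m. H m X)"
    proof (rule ennreal_le_epsilon)
      fix e :: real assume e: "e > 0"
      \<comment> \<open>\<open>M\<close> counts ordered pairs, so a loss of \<open>e'\<close> in
        each adds up to at most \<open>e\<close>; the added 1 covers \<open>M = 0\<close>.\<close>
      define e' where "e' = e / (M + 1)"
      have e': "e' > 0" "M * e' \<le> e" using e M0 by (auto simp: e'_def field_simps)
      have "ennreal (\<Sum>x\<in>F. \<Sum>y\<in>F - {x}. g x y)
          \<le> ennreal ((\<Sum>x\<in>F. \<Sum>y\<in>F - {x}. max 0 (g x y - e')) + M * e')"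
        unfolding M_def sum_distrib_right sum.distrib[symmetric]
        by (intro ennreal_leI sum_mono) auto
      also have "\<dots> = ennreal (\<Sum>x\<in>F. \<Sum>y\<in>F - {x}. max 0 (g x y - e')) + ennreal (M * e')"
        using M0 e' by (intro ennreal_plus sum_nonneg) auto
      also have "ennreal (\<Sum>x\<in>F. \<Sum>y\<in>F - {x}. max 0 (g x y - e'))
          = (\<Sum>x\<in>F. \<Sum>y\<in>F - {x}. ennreal (max 0 (g x y - e')))"
        by (subst sum_ennreal, simp, subst sum_ennreal) (auto intro!: sum_nonneg)
      also have "\<dots> = (\<Sum>x\<in>F. \<Sum>y\<in>F - {x}. ennreal (g x y - e'))"
        by (simp add: ennreal_max_0')
      also have "\<dots> + ennreal (M * e') \<le> liminf (\<lambda>m. H m X) + ennreal e"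
        using e' by (intro add_mono low ennreal_leI) auto
      finally show "ennreal (\<Sum>x\<in>F. \<Sum>y\<in>F - {x}. g x y) \<le> liminf (\<lambda>m. H m X) + ennreal e" .
    qed
    thus ?thesis by (simp add: F_def)
  qed

  show thesis
  proof (rule that)
    show "(\<lambda>X. liminf (\<lambda>m. H m X)) \<in> borel_measurable P" by measurable
    show "ennreal (\<Sum>x\<in>X \<inter> B. \<Sum>y\<in>X \<inter> B - {x}. g x y) \<le> liminf (\<lambda>m. H m X)" if "X \<in> Conf" for X
      using H_ge[OF that] .
    have "(\<integral>\<^sup>+ X. liminf (\<lambda>m. H m X) \<partial>P) \<le> liminf (\<lambda>m. \<integral>\<^sup>+ X. H m X \<partial>P)"
      by (rule nn_integral_liminf) measurable
    also have "\<dots> \<le> liminf (\<lambda>m. J)" by (intro Liminf_mono always_eventually allI H_int)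
    also have "\<dots> = J" by (simp add: Liminf_const)
    finally show "(\<integral>\<^sup>+ X. liminf (\<lambda>m. H m X) \<partial>P)
      \<le> (\<integral>\<^sup>+ x. (\<integral>\<^sup>+ y. ennreal (g x y) * indicator B y \<partial>intensity) * indicator B x \<partial>intensity)"
      by (simp add: J_def)
  qed
qed

end

section \<open>Hyperbolic shells\<close>

text \<open>The basic identity of the pseudo-hyperbolic metric. It gives the comparison of
  \<open>cmod (x - y)\<close> with \<open>cmod (1 - cnj x * y)\<close>, the formula for
  \<open>1 - (cmod (moebius x y))\<^sup>2\<close> and the logarithmic energy.\<close>

lemma cmod_one_minus_cnj_mult_sq:
  "(cmod (1 - cnj x * y))\<^sup>2 = (cmod (x - y))\<^sup>2 + (1 - (cmod x)\<^sup>2) * (1 - (cmod y)\<^sup>2)"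
  unfolding cmod_power2 by (simp add: power2_eq_square algebra_simps)

lemma one_minus_cnj_mult_bounds:
  assumes "cmod x < 1" "cmod y < 1"
  shows "1 - cmod x \<le> cmod (1 - cnj x * y)" "1 - cmod y \<le> cmod (1 - cnj x * y)"
    "cmod (x - y) \<le> cmod (1 - cnj x * y)" "cmod (1 - cnj x * y) \<le> 2" "0 < cmod (1 - cnj x * y)"
proof -
  have "cmod (cnj x * y) \<le> cmod x * 1" "cmod (cnj x * y) \<le> 1 * cmod y"
    unfolding norm_mult complex_mod_cnj using assms by (intro mult_mono; simp)+
  moreover have "cmod 1 - cmod (cnj x * y) \<le> cmod (1 - cnj x * y)"
     "cmod (1 - cnj x * y) \<le> cmod 1 + cmod (cnj x * y)"
    by (rule norm_triangle_ineq2, rule norm_triangle_ineq4)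
  ultimately show "1 - cmod x \<le> cmod (1 - cnj x * y)" "1 - cmod y \<le> cmod (1 - cnj x * y)"
     "cmod (1 - cnj x * y) \<le> 2" "0 < cmod (1 - cnj x * y)"
    using assms unfolding norm_one by linarith+
  have "(cmod x)\<^sup>2 < 1" "(cmod y)\<^sup>2 < 1" using assms by (simp_all add: abs_square_less_1)
  hence "(cmod (x - y))\<^sup>2 \<le> (cmod (1 - cnj x * y))\<^sup>2"
    unfolding cmod_one_minus_cnj_mult_sq by simp
  thus "cmod (x - y) \<le> cmod (1 - cnj x * y)" by (rule power2_le_imp_le) simp
qed

lemma one_minus_cmod_sq_pos: "cmod x < 1 \<Longrightarrow> 0 < 1 - (cmod x)\<^sup>2"
  by (simp add: abs_square_less_1)

lemma cmod_moebius: "cmod (moebius x y) = cmod (x - y) / cmod (1 - cnj x * y)"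
  by (simp add: moebius_def norm_divide)

lemma one_minus_cmod_moebius_sq:
  assumes "cmod x < 1" "cmod y < 1"
  shows "1 - (cmod (moebius x y))\<^sup>2 = (1 - (cmod x)\<^sup>2) * (1 - (cmod y)\<^sup>2) / (cmod (1 - cnj x * y))\<^sup>2"
proof -
  have "cmod (1 - cnj x * y) > 0" using one_minus_cnj_mult_bounds(5)[OF assms] .
  thus ?thesis unfolding cmod_moebius power_divide
    using cmod_one_minus_cnj_mult_sq[of x y] by (simp add: field_simps)
qed

lemma cmod_moebius_less_1:
  assumes "cmod x < 1" "cmod y < 1"
  shows "cmod (moebius x y) < 1"
proof -
  have "0 < (1 - (cmod x)\<^sup>2) * (1 - (cmod y)\<^sup>2) / (cmod (1 - cnj x * y))\<^sup>2"
    using one_minus_cnj_mult_bounds(5)[OF assms] one_minus_cmod_sq_pos[OF assms(1)]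
      one_minus_cmod_sq_pos[OF assms(2)]
    by (intro divide_pos_pos mult_pos_pos) (auto simp del: zero_less_norm_iff)
  hence "(cmod (moebius x y))\<^sup>2 < 1" using one_minus_cmod_moebius_sq[OF assms] by linarith
  thus ?thesis by (simp add: abs_square_less_1)
qed

text \<open>The form \<open>ln (1 + t)\<close> is the one that \<open>log_majorant\<close>
  dominates: on a shell the numerator of \<open>t\<close> is of order \<open>exp (- 2 * k)\<close>,
  so the energy lives at Euclidean scale \<open>exp (- k)\<close>.\<close>

lemma minus_ln_cmod_moebius:
  assumes "cmod x < 1" "cmod y < 1" "x \<noteq> y"
  shows "- ln (cmod (moebius x y))
    = ln (1 + (1 - (cmod x)\<^sup>2) * (1 - (cmod y)\<^sup>2) / (cmod (x - y))\<^sup>2) / 2"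
proof -
  let ?d = "cmod (x - y)" and ?e = "cmod (1 - cnj x * y)"
  have d: "?d > 0" and e: "?e > 0" using assms one_minus_cnj_mult_bounds(5) by auto
  have "1 + (1 - (cmod x)\<^sup>2) * (1 - (cmod y)\<^sup>2) / ?d\<^sup>2 = ?e\<^sup>2 / ?d\<^sup>2"
    using d unfolding cmod_one_minus_cnj_mult_sq by (simp add: field_simps)
  hence "ln (1 + (1 - (cmod x)\<^sup>2) * (1 - (cmod y)\<^sup>2) / ?d\<^sup>2) = 2 * ln ?e - 2 * ln ?d"
    using d e by (simp add: ln_div ln_realpow)
  thus ?thesis unfolding cmod_moebius using d e by (simp add: ln_div)
qed

text \<open>With \<open>r\<close> the modulus of the Moebius image,
  \<open>exp (- hyp_dist z x)\<close> is \<open>(1 - r) / (1 + r)\<close>, which differs from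
  \<open>1 - r\<^sup>2\<close> by the factor \<open>(1 + r)\<^sup>2\<close>, between 1 and
  4.\<close>

lemma hyp_dist_bounds:
  assumes "cmod z < 1" "cmod x < 1"
  shows "exp (- hyp_dist z x) \<le> 1 - (cmod (moebius z x))\<^sup>2"
    "1 - (cmod (moebius z x))\<^sup>2 \<le> 4 * exp (- hyp_dist z x)"
proof -
  define r where "r = cmod (moebius z x)"
  have r: "0 \<le> r" "r < 1" using cmod_moebius_less_1[OF assms] by (auto simp: r_def)
  have e: "exp (- hyp_dist z x) = (1 - r) / (1 + r)"
    unfolding hyp_dist_def r_def[symmetric] exp_minus using r by (subst exp_ln) auto
  have "(1 - r) / (1 + r) \<le> (1 - r) * (1 + r)"
  proof -
    have "(1 - r) / (1 + r) \<le> (1 - r) / 1" using r by (intro divide_left_mono) auto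
    also have "\<dots> \<le> (1 - r) * (1 + r)" using r by (simp add: mult_left_mono)
    finally show ?thesis .
  qed
  thus "exp (- hyp_dist z x) \<le> 1 - (cmod (moebius z x))\<^sup>2"
    unfolding e r_def[symmetric] by (simp add: power2_eq_square algebra_simps)
  have "(1 - r) * ((1 + r) * (1 + r)) \<le> (1 - r) * (2 * 2)"
    using r by (intro mult_left_mono mult_mono) auto
  hence "(1 - r) * (1 + r) \<le> 4 * ((1 - r) / (1 + r))"
    using r by (simp add: pos_le_divide_eq mult_ac)
  thus "1 - (cmod (moebius z x))\<^sup>2 \<le> 4 * exp (- hyp_dist z x)"
    unfolding e r_def[symmetric] by (simp add: power2_eq_square algebra_simps)
qed

definition shell :: "complex \<Rightarrow> nat \<Rightarrow> complex set" where
  "shell z k = {x \<in> ball 0 1. real k \<le> hyp_dist z x \<and> hyp_dist z x < real k + 1}"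

lemma shell_borel [measurable]: "shell z k \<in> sets borel"
  unfolding shell_def hyp_dist_def moebius_def by measurable

text \<open>Moving the centre from \<open>z\<close> to 0 multiplies
  \<open>1 - (cmod (moebius z x))\<^sup>2\<close> by
  \<open>(cmod (1 - cnj z * x))\<^sup>2 / (1 - (cmod z)\<^sup>2)\<close>, which is bounded above and
  below in terms of \<open>z\<close> alone. The factor \<open>exp (-1)\<close> in \<open>a\<close>
  comes from the outer edge \<open>k + 1\<close> of the shell.\<close>

lemma shell_bounds:
  assumes z: "cmod z < 1" 
  obtains a b where "0 < a" "0 < b"
    "\<And>k x. x \<in> shell z k \<Longrightarrow> a * exp (- real k) \<le> 1 - (cmod x)\<^sup>2"
    "\<And>k x. x \<in> shell z k \<Longrightarrow> 1 - (cmod x)\<^sup>2 \<le> b * exp (- real k)"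
proof -
  have z2: "0 < 1 - (cmod z)\<^sup>2" by (rule one_minus_cmod_sq_pos[OF z])
  define a where "a = exp (-1) * (1 - cmod z)\<^sup>2 / (1 - (cmod z)\<^sup>2)"
  define b where "b = 16 / (1 - (cmod z)\<^sup>2)"
  have *: "a * exp (- real k) \<le> 1 - (cmod x)\<^sup>2 \<and> 1 - (cmod x)\<^sup>2 \<le> b * exp (- real k)"
    if "x \<in> shell z k" for x k
  proof -
    have x: "cmod x < 1" and d: "real k \<le> hyp_dist z x" "hyp_dist z x < real k + 1"
      using that by (auto simp: shell_def)
    let ?m = "1 - (cmod (moebius z x))\<^sup>2" and ?e = "cmod (1 - cnj z * x)"
    note e = one_minus_cnj_mult_bounds[OF z x]
    have eq: "1 - (cmod x)\<^sup>2 = ?m * ?e\<^sup>2 / (1 - (cmod z)\<^sup>2)"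
      unfolding one_minus_cmod_moebius_sq[OF z x] using z2 e(5) by simp
    have m: "exp (-1) * exp (- real k) \<le> ?m" "?m \<le> 4 * exp (- real k)"
    proof -
      have "exp (-1) * exp (- real k) = exp (- (real k + 1))" by (simp add: exp_add[symmetric])
      also have "\<dots> \<le> exp (- hyp_dist z x)" using d by simp
      also have "\<dots> \<le> ?m" by (rule hyp_dist_bounds[OF z x])
      finally show "exp (-1) * exp (- real k) \<le> ?m" .
      have "?m \<le> 4 * exp (- hyp_dist z x)" by (rule hyp_dist_bounds[OF z x])
      also have "\<dots> \<le> 4 * exp (- real k)" using d by simp
      finally show "?m \<le> 4 * exp (- real k)" .
    qed
    have e2: "(1 - cmod z)\<^sup>2 \<le> ?e\<^sup>2" "?e\<^sup>2 \<le> 2\<^sup>2" using e z by (intro power_mono; simp)+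
    have "a * exp (- real k) = (exp (-1) * exp (- real k)) * (1 - cmod z)\<^sup>2 / (1 - (cmod z)\<^sup>2)"
      by (simp add: a_def)
    also have "\<dots> \<le> ?m * ?e\<^sup>2 / (1 - (cmod z)\<^sup>2)"
      using z m(1) e2(1) z2 cmod_moebius_less_1[OF z x]
      by (intro divide_right_mono mult_mono) (auto simp: abs_square_le_1)
    finally have 1: "a * exp (- real k) \<le> 1 - (cmod x)\<^sup>2" unfolding eq .
    have "?m * ?e\<^sup>2 / (1 - (cmod z)\<^sup>2) \<le> 4 * exp (- real k) * 2\<^sup>2 / (1 - (cmod z)\<^sup>2)"
      using m(2) e2(2) z2 by (intro divide_right_mono mult_mono) auto
    hence "1 - (cmod x)\<^sup>2 \<le> b * exp (- real k)" unfolding eq by (simp add: b_def)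
    with 1 show ?thesis by simp
  qed
  have "a > 0" "b > 0" using z z2 by (auto simp: a_def b_def)
  thus thesis using that * by blast
qed

text \<open>Pseudo-hyperbolic discs are Euclidean discs. The explicit radius is needed to compute
  the area of a shell.\<close>

lemma moebius_ball_eq:
  assumes z: "cmod z < 1" and r: "0 \<le> r" "r < 1"
  shows "{x \<in> ball 0 1. cmod (moebius z x) < r}
    = ball (of_real ((1 - r\<^sup>2) / (1 - r\<^sup>2 * (cmod z)\<^sup>2)) * z) (r * (1 - (cmod z)\<^sup>2) / (1 - r\<^sup>2 * (cmod z)\<^sup>2))"
proof -
  define D where "D = 1 - r\<^sup>2 * (cmod z)\<^sup>2"
  have z2: "(cmod z)\<^sup>2 < 1" "0 \<le> (cmod z)\<^sup>2" using z by (auto simp: abs_square_less_1)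
  have r2: "r\<^sup>2 < 1" "0 \<le> r\<^sup>2" using r by (auto simp: abs_square_less_1)
  have "r\<^sup>2 * (cmod z)\<^sup>2 \<le> 1 * (cmod z)\<^sup>2" using r2 by (intro mult_right_mono) auto
  hence D: "D > 0" using z2 by (simp add: D_def)
  define R where "R = r * (1 - (cmod z)\<^sup>2) / D"
  define c where "c = of_real ((1 - r\<^sup>2) / D) * z"
  have R0: "R \<ge> 0" using r z2 D by (simp add: R_def)
  \<comment> \<open>Completing the square in \<open>x\<close>. The proof multiplies by
    \<open>D\<close> once more to clear the denominators of \<open>c\<close> and
    \<open>R\<close>.\<close>
  have sq: "(cmod (z - x))\<^sup>2 - r\<^sup>2 * (cmod (1 - cnj z * x))\<^sup>2 = D * ((cmod (c - x))\<^sup>2 - R\<^sup>2)" for x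
  proof -
    have "D * (D * ((cmod (c - x))\<^sup>2 - R\<^sup>2)) = (cmod (of_real D * c - of_real D * x))\<^sup>2 - (D * R)\<^sup>2"
      unfolding right_diff_distrib[symmetric] norm_mult power_mult_distrib
      by (simp add: power2_eq_square algebra_simps)
    also have "of_real D * c = of_real (1 - r\<^sup>2) * z" using D by (simp add: c_def)
    also have "D * R = r * (1 - (cmod z)\<^sup>2)" using D by (simp add: R_def)
    also have "(cmod (of_real (1 - r\<^sup>2) * z - of_real D * x))\<^sup>2 - (r * (1 - (cmod z)\<^sup>2))\<^sup>2
       = D * ((cmod (z - x))\<^sup>2 - r\<^sup>2 * (cmod (1 - cnj z * x))\<^sup>2)"
    proof -
      \<comment> \<open>In these four quantities both sides are polynomials; \<open>m\<close> is the
        real inner product of \<open>z\<close> and \<open>x\<close>.\<close>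
      define p q m s where "p = (cmod z)\<^sup>2" "q = (cmod x)\<^sup>2" "m = Re z * Re x + Im z * Im x" "s = r\<^sup>2"
      have lin: "(cmod (of_real u * z - of_real v * x))\<^sup>2 = u\<^sup>2 * p + v\<^sup>2 * q - 2 * u * v * m" for u v
        unfolding p_q_m_s_def cmod_power2 by (simp add: power2_eq_square algebra_simps)
      have 1: "(cmod (z - x))\<^sup>2 = p + q - 2 * m" using lin[of 1 1] by simp
      have "(r * (1 - (cmod z)\<^sup>2))\<^sup>2 = s * (1 - p)\<^sup>2" by (simp add: p_q_m_s_def power_mult_distrib)
      thus ?thesis
        unfolding lin cmod_one_minus_cnj_mult_sq 1 D_def
        unfolding p_q_m_s_def(1,2,4)[symmetric]
        by (simp add: power2_eq_square algebra_simps)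
    qed
    finally show ?thesis using D by simp
  qed
  have sqlt: "u\<^sup>2 < v\<^sup>2 \<longleftrightarrow> u < v" if "0 \<le> u" "0 \<le> v" for u v :: real
    using that by (metis linorder_not_le pos2 power_mono_iff)
  have iff: "cmod (z - x) < r * cmod (1 - cnj z * x) \<longleftrightarrow> x \<in> ball c R" for x
  proof -
    have "cmod (z - x) < r * cmod (1 - cnj z * x) \<longleftrightarrow> (cmod (z - x))\<^sup>2 < (r * cmod (1 - cnj z * x))\<^sup>2"
      using r by (subst sqlt) auto
    also have "\<dots> \<longleftrightarrow> D * ((cmod (c - x))\<^sup>2 - R\<^sup>2) < 0"
      unfolding sq[symmetric] power_mult_distrib by linarith
    also have "\<dots> \<longleftrightarrow> (cmod (c - x))\<^sup>2 < R\<^sup>2" using D by (simp add: mult_less_0_iff)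
    also have "\<dots> \<longleftrightarrow> x \<in> ball c R" using R0 by (simp add: dist_norm sqlt)
    finally show ?thesis .
  qed
  \<comment> \<open>The defining inequality forces \<open>x\<close> into the unit disc by itself:
    outside, the basic identity gives the opposite comparison.\<close>
  have "cmod x < 1" if "cmod (z - x) < r * cmod (1 - cnj z * x)" for x
  proof (rule ccontr)
    assume "\<not> cmod x < 1"
    hence "1 - (cmod x)\<^sup>2 \<le> 0" by (simp add: abs_square_less_1[symmetric] not_less)
    hence "(1 - (cmod z)\<^sup>2) * (1 - (cmod x)\<^sup>2) \<le> 0" using z2 by (intro mult_nonneg_nonpos) auto
    hence "(cmod (1 - cnj z * x))\<^sup>2 \<le> (cmod (z - x))\<^sup>2" unfolding cmod_one_minus_cnj_mult_sq by simp
    hence "cmod (1 - cnj z * x) \<le> cmod (z - x)" by (rule power2_le_imp_le) simp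
    moreover have "r * cmod (1 - cnj z * x) \<le> 1 * cmod (1 - cnj z * x)"
      using r by (intro mult_right_mono) auto
    ultimately show False using that by simp
  qed
  moreover have "cmod (moebius z x) < r \<longleftrightarrow> cmod (z - x) < r * cmod (1 - cnj z * x)" if "cmod x < 1" for x
    unfolding cmod_moebius using one_minus_cnj_mult_bounds(5)[OF z that] by (rule pos_divide_less_eq)
  ultimately have "{x \<in> ball 0 1. cmod (moebius z x) < r} = ball c R"
    by (auto simp: iff simp del: mem_ball)
  thus ?thesis by (simp add: c_def R_def D_def)
qed

lemma rc_borel_shell:
  assumes z: "cmod z < 1"
  shows "rc_borel (shell z k)"
proof -
  obtain a b where a: "0 < a" "\<And>k x. x \<in> shell z k \<Longrightarrow> a * exp (- real k) \<le> 1 - (cmod x)\<^sup>2"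
    using shell_bounds[OF z] by metis
  define C where "C = {x. (cmod x)\<^sup>2 \<le> 1 - a * exp (- real k)}"
  have "closed C" unfolding C_def by (intro closed_Collect_le continuous_intros)
  moreover have "shell z k \<subseteq> C" using a(2) unfolding C_def by force
  ultimately have "closure (shell z k) \<subseteq> C" by (simp add: closure_minimal)
  moreover have "C \<subseteq> ball 0 1"
  proof
    fix x assume "x \<in> C"
    moreover have "a * exp (- real k) > 0" using a by simp
    ultimately have "(cmod x)\<^sup>2 < 1" unfolding C_def by simp
    thus "x \<in> ball 0 1" by (simp add: abs_square_less_1)
  qed
  ultimately show ?thesis by (simp add: rc_borel_def)
qed

text \<open>The bound on the right is \<open>tanh (t / 2)\<close>, the Euclidean radius of a
  hyperbolic disc of radius \<open>t\<close> about the origin.\<close>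

lemma hyp_dist_less_iff:
  assumes "cmod z < 1" "cmod x < 1"
  shows "hyp_dist z x < t \<longleftrightarrow> cmod (moebius z x) < (exp t - 1) / (exp t + 1)"
proof -
  define r where "r = cmod (moebius z x)"
  have r: "0 \<le> r" "r < 1" using cmod_moebius_less_1[OF assms] by (auto simp: r_def)
  have p: "0 < (1 + r) / (1 - r)" using r by simp
  have "hyp_dist z x < t \<longleftrightarrow> exp (ln ((1 + r) / (1 - r))) < exp t"
    by (simp add: hyp_dist_def r_def)
  also have "\<dots> \<longleftrightarrow> (1 + r) / (1 - r) < exp t" using p by simp
  also have "\<dots> \<longleftrightarrow> 1 + r < exp t * (1 - r)" using r by (simp add: pos_divide_less_eq)
  also have "\<dots> \<longleftrightarrow> r * (exp t + 1) < exp t - 1" by (auto simp: algebra_simps)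
  also have "\<dots> \<longleftrightarrow> r < (exp t - 1) / (exp t + 1)"
    by (simp add: pos_less_divide_eq add_pos_pos)
  finally show ?thesis by (simp add: r_def)
qed

text \<open>A shell is the difference of two Euclidean discs, not necessarily concentric, so its
  area is \<open>pi * (R2 - R1) * (R2 + R1)\<close> in terms of their radii. The first factor
  inherits the order \<open>exp (- k)\<close> from the gap of \<open>tanh\<close>; the second stays
  away from 0 because the outer hyperbolic radius is at least 1.\<close>

lemma emeasure_shell_ge:
  assumes z: "cmod z < 1"
  obtains c where "0 < c" "\<And>k. ennreal (c * exp (- real k)) \<le> emeasure lborel (shell z k)"
proof -
  define q where "q = (cmod z)\<^sup>2"
  have q: "0 \<le> q" "q < 1" using z by (auto simp: q_def abs_square_less_1)
  define \<rho> where "\<rho> = (\<lambda>t::real. (exp t - 1) / (exp t + 1))"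
  define R where "R = (\<lambda>r. r * (1 - q) / (1 - r\<^sup>2 * q))"
  have \<rho>: "0 \<le> \<rho> t" "\<rho> t < 1" if "t \<ge> 0" for t
    using that by (auto simp: \<rho>_def divide_simps add_pos_pos)
  define c where "c = pi * (1 - q)\<^sup>2 * ((exp 1 - 1) / (2 * exp 1)) * \<rho> 1"
  have "exp (1::real) > 1" by simp
  hence "\<rho> 1 > 0" unfolding \<rho>_def by (intro divide_pos_pos add_pos_pos) auto
  hence c: "c > 0" using q by (auto simp: c_def)
  show thesis
  proof (rule that[OF c])
    fix k :: nat
    define r1 r2 where "r1 = \<rho> (real k)" and "r2 = \<rho> (real k + 1)"
    have r1: "0 \<le> r1" "r1 < 1" and r2: "0 \<le> r2" "r2 < 1" using \<rho> by (auto simp: r1_def r2_def)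
    define E where "E = exp (real k)"
    have E: "E \<ge> 1" by (simp add: E_def)
    have E1: "exp (real k + 1) = E * exp 1" by (simp add: E_def exp_add)
    have e1: "exp (1::real) > 1" by simp
    have Ee: "E * exp 1 \<ge> 1" using mult_mono[of 1 E 1 "exp 1"] E e1 by simp
    \<comment> \<open>Each of \<open>E + 1\<close> and \<open>E * exp 1 + 1\<close> is at most twice
      its leading term, which leaves a multiple of \<open>1 / E\<close>.\<close>
    have diff: "r2 - r1 \<ge> (exp 1 - 1) / (2 * exp 1) * exp (- real k)"
    proof -
      have "r2 - r1 = (2 * (exp 1 - 1) * E) / ((E + 1) * (E * exp 1 + 1))"
        unfolding r1_def r2_def \<rho>_def E1 E_def[symmetric]
        using E Ee by (simp add: field_simps)
      also have "\<dots> \<ge> (2 * (exp 1 - 1) * E) / ((E + E) * (E * exp 1 + E * exp 1))"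
        using E Ee e1 by (intro divide_left_mono mult_mono mult_nonneg_nonneg mult_pos_pos add_pos_pos) auto
      also have "(2 * (exp 1 - 1) * E) / ((E + E) * (E * exp 1 + E * exp 1)) = (exp 1 - 1) / (2 * exp 1) * (1 / E)"
        using E by (simp add: field_simps)
      also have "1 / E = exp (- real k)" by (simp add: E_def exp_minus field_simps)
      finally show ?thesis .
    qed
    have r12: "r1 \<le> r2"
      using diff by (smt (verit) divide_nonneg_nonneg e1 exp_ge_zero mult_nonneg_nonneg)
    have "r2 \<ge> \<rho> 1"
    proof -
      have "\<rho> t = 1 - 2 / (exp t + 1)" for t
        using exp_gt_zero[of t] by (simp add: \<rho>_def field_simps add_pos_pos del: exp_gt_zero)
      moreover have "2 / (exp (real k + 1) + 1) \<le> 2 / (exp (1::real) + 1)"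
        by (intro divide_left_mono add_right_mono mult_pos_pos add_pos_pos) auto
      ultimately show ?thesis by (simp add: r2_def)
    qed
    define A1 where "A1 = {x \<in> ball 0 1. cmod (moebius z x) < r1}"
    define A2 where "A2 = {x \<in> ball 0 1. cmod (moebius z x) < r2}"
    have den: "0 < 1 - r\<^sup>2 * q \<and> 1 - r\<^sup>2 * q \<le> 1" if "0 \<le> r" "r < 1" for r
    proof -
      have "r\<^sup>2 * q \<le> 1 * q" using that q by (intro mult_right_mono) (auto simp: abs_square_le_1)
      thus ?thesis using q by auto
    qed
    have R0: "R r \<ge> 0" if "0 \<le> r" "r < 1" for r using den[OF that] that q by (simp add: R_def)
    have emA: "emeasure lborel {x \<in> ball 0 1. cmod (moebius z x) < r} = ennreal (pi * (R r)\<^sup>2)"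
      if "0 \<le> r" "r < 1" for r
      unfolding moebius_ball_eq[OF z that] q_def[symmetric]
      using R0[OF that] by (subst emeasure_ball) (auto simp: R_def unit_ball_vol_2)
    have "shell z k = A2 - A1"
      using hyp_dist_less_iff[OF z] unfolding shell_def A1_def A2_def r1_def r2_def \<rho>_def
      by (auto simp: not_less[symmetric])
    moreover have "A1 \<subseteq> A2" using r12 by (auto simp: A1_def A2_def)
    moreover have "A1 \<in> sets lborel" "A2 \<in> sets lborel"
      unfolding A1_def A2_def moebius_ball_eq[OF z r1] moebius_ball_eq[OF z r2] by auto
    ultimately have "emeasure lborel (shell z k) = emeasure lborel A2 - emeasure lborel A1"
      using emA[OF r1, folded A1_def] by (simp add: emeasure_Diff)
    also have "\<dots> = ennreal (pi * (R r2)\<^sup>2 - pi * (R r1)\<^sup>2)"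
      unfolding A1_def A2_def emA[OF r1] emA[OF r2] by (rule ennreal_minus) simp
    finally have em: "emeasure lborel (shell z k) = ennreal (pi * (R r2)\<^sup>2 - pi * (R r1)\<^sup>2)" .
    have Rd: "R r2 - R r1 \<ge> (1 - q) * (r2 - r1)"
    proof -
      have "R r2 - R r1 = (1 - q) * (r2 - r1) * (1 + r1 * r2 * q) / ((1 - r2\<^sup>2 * q) * (1 - r1\<^sup>2 * q))"
        using den[OF r1] den[OF r2] by (simp add: R_def divide_simps) (simp add: algebra_simps power2_eq_square)
      moreover have "(1 - q) * (r2 - r1) * 1 / 1 \<le> (1 - q) * (r2 - r1) * (1 + r1 * r2 * q) / ((1 - r2\<^sup>2 * q) * (1 - r1\<^sup>2 * q))"
        using q r12 r1 r2 den[OF r1] den[OF r2]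
        by (intro frac_le mult_left_mono mult_nonneg_nonneg mult_pos_pos mult_le_one) auto
      ultimately show ?thesis by simp
    qed
    have R2: "R r2 \<ge> (1 - q) * r2"
    proof -
      have "r2 * (1 - q) / 1 \<le> r2 * (1 - q) / (1 - r2\<^sup>2 * q)"
        using q r2 den[OF r2] by (intro divide_left_mono) auto
      thus ?thesis by (simp add: R_def mult.commute)
    qed
    have "c * exp (- real k) = pi * (((1 - q) * ((exp 1 - 1) / (2 * exp 1) * exp (- real k))) * ((1 - q) * \<rho> 1))"
      by (simp add: c_def power2_eq_square)
    also have "\<dots> \<le> pi * ((R r2 - R r1) * (R r2 + R r1))"
    proof (intro mult_left_mono mult_mono)
      show "(1 - q) * ((exp 1 - 1) / (2 * exp 1) * exp (- real k)) \<le> R r2 - R r1"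
        using Rd mult_left_mono[OF diff, of "1 - q"] q by linarith
      show "(1 - q) * \<rho> 1 \<le> R r2 + R r1"
        using R2 mult_left_mono[OF \<open>r2 \<ge> \<rho> 1\<close>, of "1 - q"] q R0[OF r1] by linarith
      have "0 \<le> (1 - q) * (r2 - r1)" using q r12 by simp
      thus "0 \<le> R r2 - R r1" using Rd by linarith
      show "0 \<le> (1 - q) * \<rho> 1" using q \<rho>(1)[of 1] by simp
    qed simp
    also have "\<dots> = pi * (R r2)\<^sup>2 - pi * (R r1)\<^sup>2" by (simp add: power2_eq_square algebra_simps)
    finally show "ennreal (c * exp (- real k)) \<le> emeasure lborel (shell z k)"
      unfolding em by (rule ennreal_leI)
  qed
qed

lemma nn_integral_intensity:
  assumes [measurable]: "f \<in> borel_measurable borel"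
  shows "(\<integral>\<^sup>+ x. f x \<partial>intensity)
    = ennreal (1 / pi) * (\<integral>\<^sup>+ x. ennreal (1 / (1 - (cmod x)\<^sup>2)\<^sup>2) * f x * indicator (ball 0 1) x \<partial>lborel)"
  unfolding intensity_def by (subst nn_integral_density; (subst nn_integral_disc_mu)?) auto

text \<open>On the shell the density of \<open>intensity\<close> is at most of order
  \<open>exp (2 * k)\<close>, and the shell lies in an annulus about 0 of thickness of order
  \<open>exp (- k)\<close>, whatever \<open>z\<close> is. This is the passage from the process to
  the planar estimates.\<close>

lemma nn_integral_intensity_shell_le:
  assumes [measurable]: "f \<in> borel_measurable borel"
    and a: "0 < a" "\<And>x. x \<in> shell z k \<Longrightarrow> a * exp (- real k) \<le> 1 - (cmod x)\<^sup>2"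
    and b: "\<And>x. x \<in> shell z k \<Longrightarrow> 1 - (cmod x)\<^sup>2 \<le> b * exp (- real k)"
  shows "(\<integral>\<^sup>+ x. f x * indicator (shell z k) x \<partial>intensity)
    \<le> ennreal (exp (2 * real k) / (pi * a\<^sup>2)) * (\<integral>\<^sup>+ x. f x * indicator (annulus (b * exp (- real k))) x \<partial>lborel)"
proof -
  let ?c = "exp (2 * real k) / a\<^sup>2"
  have "(\<integral>\<^sup>+ x. f x * indicator (shell z k) x \<partial>intensity) = ennreal (1 / pi) *
      (\<integral>\<^sup>+ x. ennreal (1 / (1 - (cmod x)\<^sup>2)\<^sup>2) * (f x * indicator (shell z k) x) * indicator (ball 0 1) x \<partial>lborel)"
    by (rule nn_integral_intensity) auto
  also have "\<dots> \<le> ennreal (1 / pi) * (\<integral>\<^sup>+ x. ennreal ?c * (f x * indicator (annulus (b * exp (- real k))) x) \<partial>lborel)"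
  proof (intro mult_left_mono nn_integral_mono)
    fix x
    show "ennreal (1 / (1 - (cmod x)\<^sup>2)\<^sup>2) * (f x * indicator (shell z k) x) * indicator (ball 0 1) x
       \<le> ennreal ?c * (f x * indicator (annulus (b * exp (- real k))) x)"
    proof (cases "x \<in> shell z k")
      case True
      have p: "a * exp (- real k) > 0" using a by simp
      have q: "1 - (cmod x)\<^sup>2 > 0" using p a(2)[OF True] by linarith
      have sq: "(a * exp (- real k))\<^sup>2 \<le> (1 - (cmod x)\<^sup>2)\<^sup>2" using p a(2)[OF True] by (intro power_mono) auto
      have "1 / (1 - (cmod x)\<^sup>2)\<^sup>2 \<le> 1 / (a * exp (- real k))\<^sup>2"
        by (intro divide_left_mono sq mult_pos_pos zero_less_power p q) simp
      also have "\<dots> = ?c" by (simp add: power_mult_distrib power_divide exp_minus exp_double inverse_eq_divide)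
      finally have "ennreal (1 / (1 - (cmod x)\<^sup>2)\<^sup>2) \<le> ennreal ?c" by (rule ennreal_leI)
      moreover have "x \<in> annulus (b * exp (- real k))"
        using b[OF True] a(2)[OF True] p unfolding annulus_def by auto
      ultimately show ?thesis using True by (auto simp: indicator_def intro!: mult_right_mono)
    qed auto
  qed simp
  also have "\<dots> = (ennreal (1 / pi) * ennreal ?c) * (\<integral>\<^sup>+ x. f x * indicator (annulus (b * exp (- real k))) x \<partial>lborel)"
    by (subst nn_integral_cmult) (auto simp: mult.assoc)
  also have "ennreal (1 / pi) * ennreal ?c = ennreal (exp (2 * real k) / (pi * a\<^sup>2))"
    by (subst ennreal_mult[symmetric]) auto
  finally show ?thesis .
qed

text \<open>Density \<open>exp (2 * k)\<close> times area \<open>exp (- k)\<close>. The upper bound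
  is only eventual because the annulus estimate needs thickness at most 1/2.\<close>

lemma emeasure_intensity_shell:
  assumes z: "cmod z < 1"
  obtains l c1 c2 where "0 < c1" "0 < c2"
    "\<And>k. emeasure intensity (shell z k) = ennreal (l k)"
    "\<And>k. c1 * exp (real k) \<le> l k"
    "\<forall>\<^sub>F k in sequentially. l k \<le> c2 * exp (real k)"
proof -
  obtain a b where a: "0 < a" "\<And>k x. x \<in> shell z k \<Longrightarrow> a * exp (- real k) \<le> 1 - (cmod x)\<^sup>2"
    and b: "0 < b" "\<And>k x. x \<in> shell z k \<Longrightarrow> 1 - (cmod x)\<^sup>2 \<le> b * exp (- real k)"
    using shell_bounds[OF z] by metis
  obtain c where c: "0 < c" "\<And>k. ennreal (c * exp (- real k)) \<le> emeasure lborel (shell z k)"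
    using emeasure_shell_ge[OF z] by metis
  define c1 where "c1 = c / (pi * b\<^sup>2)"
  define c2 where "c2 = 16 * b / (pi * a\<^sup>2)"
  let ?L = "\<lambda>k. emeasure intensity (shell z k)"
  have lower: "ennreal (c1 * exp (real k)) \<le> ?L k" for k
  proof -
    let ?c = "exp (2 * real k) / b\<^sup>2"
    have "exp (2 * real k) * exp (- real k) = exp (real k)" by (simp add: exp_add[symmetric])
    hence "c1 * exp (real k) = 1 / pi * (?c * (c * exp (- real k)))" by (simp add: c1_def)
    hence "ennreal (c1 * exp (real k)) = ennreal (1 / pi) * (ennreal ?c * ennreal (c * exp (- real k)))"
      using ennreal_mult'[of "1 / pi" "?c * (c * exp (- real k))"] ennreal_mult'[of ?c "c * exp (- real k)"]
      by simp
    also have "\<dots> \<le> ennreal (1 / pi) * (ennreal ?c * emeasure lborel (shell z k))"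
      by (intro mult_left_mono c) auto
    also have "ennreal ?c * emeasure lborel (shell z k)
        = (\<integral>\<^sup>+ x. ennreal ?c * indicator (shell z k) x \<partial>lborel)" by (simp add: nn_integral_cmult)
    also have "\<dots> \<le> (\<integral>\<^sup>+ x. ennreal (1 / (1 - (cmod x)\<^sup>2)\<^sup>2) * indicator (shell z k) x * indicator (ball 0 1) x \<partial>lborel)"
    proof (intro nn_integral_mono)
      fix x
      show "ennreal ?c * indicator (shell z k) x
         \<le> ennreal (1 / (1 - (cmod x)\<^sup>2)\<^sup>2) * indicator (shell z k) x * indicator (ball 0 1) x"
      proof (cases "x \<in> shell z k")
        case True
        have p: "0 < 1 - (cmod x)\<^sup>2" using True by (intro one_minus_cmod_sq_pos) (auto simp: shell_def)
        have "(1 - (cmod x)\<^sup>2)\<^sup>2 \<le> (b * exp (- real k))\<^sup>2" using p b(2)[OF True] by (intro power_mono) auto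
        hence "1 / (b * exp (- real k))\<^sup>2 \<le> 1 / (1 - (cmod x)\<^sup>2)\<^sup>2"
          using p b(1) by (intro divide_left_mono mult_pos_pos zero_less_power) auto
        moreover have "1 / (b * exp (- real k))\<^sup>2 = ?c"
          by (simp add: power_mult_distrib power_divide exp_minus exp_double inverse_eq_divide)
        ultimately have "ennreal ?c \<le> ennreal (1 / (1 - (cmod x)\<^sup>2)\<^sup>2)" by (intro ennreal_leI) simp
        moreover have "x \<in> ball 0 1" using True by (auto simp: shell_def)
        ultimately show ?thesis using True by simp
      qed auto
    qed
    also have "ennreal (1 / pi) * \<dots> = ?L k"
      using nn_integral_intensity[of "indicator (shell z k)"] by simp
    finally show ?thesis by (simp add: mult_left_mono)
  qed
  have upper: "?L k \<le> ennreal (c2 * exp (real k))" if k: "b * exp (- real k) \<le> 1 / 2" for k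
  proof -
    let ?t = "b * exp (- real k)"
    \<comment> \<open>The constant 1 is dominated on the annulus by the indicator of
      \<open>[-1, 1]\<close> in either coordinate, whose integral is 2.\<close>
    have "1 \<le> (indicator {-1..1} (Re y - 0) :: ennreal)" "1 \<le> (indicator {-1..1} (Im y - 0) :: ennreal)"
      if "y \<in> annulus ?t" for y
    proof -
      have "cmod y < 1" using that by (simp add: annulus_def abs_square_less_1)
      hence "\<bar>Re y\<bar> \<le> 1" "\<bar>Im y\<bar> \<le> 1" using abs_Re_le_cmod[of y] abs_Im_le_cmod[of y] by linarith+
      thus "1 \<le> (indicator {-1..1} (Re y - 0) :: ennreal)" "1 \<le> (indicator {-1..1} (Im y - 0) :: ennreal)"
        by (auto simp: indicator_def abs_le_iff)
    qed
    hence ann: "(\<integral>\<^sup>+ x. 1 * indicator (annulus ?t) x \<partial>lborel) \<le> ennreal (8 * ?t) * (\<integral>\<^sup>+ u. indicator {-1..1} u \<partial>(lborel :: real measure))"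
      using k b(1) by (intro nn_integral_annulus_le[of "\<lambda>_. 1" "indicator {-1..1}" ?t 0 0]) auto
    have "?L k = (\<integral>\<^sup>+ x. 1 * indicator (shell z k) x \<partial>intensity)" by simp
    also have "\<dots> \<le> ennreal (exp (2 * real k) / (pi * a\<^sup>2)) * (\<integral>\<^sup>+ x. 1 * indicator (annulus ?t) x \<partial>lborel)"
      by (rule nn_integral_intensity_shell_le[OF _ a(1) a(2) b(2)]) auto
    also have "\<dots> \<le> ennreal (exp (2 * real k) / (pi * a\<^sup>2)) * (ennreal (8 * ?t) * (\<integral>\<^sup>+ u. indicator {-1..1} u \<partial>(lborel :: real measure)))"
      by (rule mult_left_mono[OF ann]) simp
    also have "(\<integral>\<^sup>+ u. indicator {-1..1} u \<partial>(lborel :: real measure)) = ennreal 2" by simp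
    also have "ennreal (exp (2 * real k) / (pi * a\<^sup>2)) * (ennreal (8 * ?t) * ennreal 2)
        = ennreal (exp (2 * real k) / (pi * a\<^sup>2) * (8 * ?t * 2))"
      using b(1) by (simp only: ennreal_mult'[symmetric] zero_le_divide_iff mult_nonneg_nonneg pi_ge_zero
        zero_le_power2 exp_ge_zero simp_thms less_imp_le zero_le_numeral)
    also have "exp (2 * real k) / (pi * a\<^sup>2) * (8 * ?t * 2) = c2 * (exp (2 * real k) * exp (- real k))"
      by (simp add: c2_def)
    also have "exp (2 * real k) * exp (- real k) = exp (real k)" by (simp add: exp_add[symmetric])
    finally show ?thesis .
  qed
  \<comment> \<open>Finiteness is needed for every \<open>k\<close>, also for the small ones to
    which \<open>upper\<close> does not apply.\<close>
  have fin: "?L k < \<infinity>" for k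
  proof -
    have "?L k = (\<integral>\<^sup>+ x. 1 * indicator (shell z k) x \<partial>intensity)" by simp
    also have "\<dots> \<le> ennreal (exp (2 * real k) / (pi * a\<^sup>2)) * (\<integral>\<^sup>+ x. 1 * indicator (annulus (b * exp (- real k))) x \<partial>lborel)"
      by (rule nn_integral_intensity_shell_le[OF _ a(1) a(2) b(2)]) auto
    also have "\<dots> \<le> ennreal (exp (2 * real k) / (pi * a\<^sup>2)) * emeasure lborel (ball (0 :: complex) 1)"
      by (auto intro!: mult_left_mono emeasure_mono simp: annulus_def abs_square_less_1)
    also have "\<dots> < \<infinity>" by (simp add: emeasure_ball ennreal_mult_less_top)
    finally show ?thesis .
  qed
  define l where "l = (\<lambda>k. enn2real (?L k))"
  have l: "?L k = ennreal (l k)" for k using fin[of k] by (simp add: l_def)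
  have l0: "l k \<ge> 0" for k by (simp add: l_def)
  show thesis
  proof (rule that[OF _ _ l])
    show "c1 > 0" "c2 > 0" using a b c by (auto simp: c1_def c2_def)
    show "c1 * exp (real k) \<le> l k" for k using lower[of k] l0 by (simp add: l)
    have "(\<lambda>k. b * exp (- real k)) \<longlonglongrightarrow> 0" by real_asymp
    hence "\<forall>\<^sub>F k in sequentially. b * exp (- real k) < 1/2" by (intro order_tendstoD) auto
    thus "\<forall>\<^sub>F k in sequentially. l k \<le> c2 * exp (real k)"
      by (rule eventually_mono) (use upper \<open>c2 > 0\<close> in \<open>auto simp: l\<close>)
  qed
qed

section \<open>Typical configurations\<close>

text \<open>Markov's inequality for the measurable majorant of the pair sum; the exceptional set is
  defined through the majorant, so measurability of the pair sum is never asked for.\<close>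

lemma DPP_pair_sum_bounded:
  fixes g :: "complex \<Rightarrow> complex \<Rightarrow> real"
  assumes dpp: "is_DPP P bergman_kernel" and B: "rc_borel B"
    and g0: "\<And>x y. 0 \<le> g x y"
    and gm: "(\<lambda>p. g (fst p) (snd p)) \<in> borel_measurable (borel \<Otimes>\<^sub>M borel)"
    and cont: "\<And>x y. x \<in> B \<Longrightarrow> y \<in> B \<Longrightarrow> x \<noteq> y \<Longrightarrow> isCont (\<lambda>p. g (fst p) (snd p)) (x, y)"
    and int: "(\<integral>\<^sup>+ x. (\<integral>\<^sup>+ y. ennreal (g x y) * indicator B y \<partial>intensity) * indicator B x \<partial>intensity) \<le> ennreal c"
    and T: "0 < T" and c: "0 \<le> c"
  obtains N where "N \<in> sets P" "measure P N \<le> c / T"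
    "\<And>X. X \<in> Conf \<Longrightarrow> X \<notin> N \<Longrightarrow> (\<Sum>x\<in>X \<inter> B. \<Sum>y\<in>X \<inter> B - {x}. g x y) \<le> T"
proof -
  interpret prob_space P using dpp by (rule DPP_prob_space)
  obtain h where h [measurable]: "h \<in> borel_measurable P"
    and hX: "\<And>X. X \<in> Conf \<Longrightarrow> ennreal (\<Sum>x\<in>X \<inter> B. \<Sum>y\<in>X \<inter> B - {x}. g x y) \<le> h X"
    and hint: "(\<integral>\<^sup>+ X. h X \<partial>P) \<le> (\<integral>\<^sup>+ x. (\<integral>\<^sup>+ y. ennreal (g x y) * indicator B y \<partial>intensity) * indicator B x \<partial>intensity)"
    by (rule DPP_pair_sum_majorant[OF dpp B g0 gm cont]) blast+
  define N where "N = {X \<in> space P. 1 \<le> ennreal (1 / T) * h X}"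
  have "emeasure P N \<le> ennreal (1 / T) * (\<integral>\<^sup>+ X. h X * indicator (space P) X \<partial>P)"
    unfolding N_def by (rule nn_integral_Markov_inequality) auto
  also have "(\<integral>\<^sup>+ X. h X * indicator (space P) X \<partial>P) = (\<integral>\<^sup>+ X. h X \<partial>P)"
    by (intro nn_integral_cong) auto
  also have "ennreal (1 / T) * \<dots> \<le> ennreal (1 / T) * ennreal c"
    using hint int by (intro mult_left_mono) auto
  also have "\<dots> = ennreal (c / T)" using T c by (simp add: ennreal_mult[symmetric])
  finally have "emeasure P N \<le> ennreal (c / T)" .
  hence m: "measure P N \<le> c / T" using T c by (simp add: emeasure_eq_measure)
  show thesis
  proof (rule that[of N])
    show "N \<in> sets P" unfolding N_def by measurable
    fix X assume X: "X \<in> Conf" "X \<notin> N"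
    let ?S = "\<Sum>x\<in>X \<inter> B. \<Sum>y\<in>X \<inter> B - {x}. g x y"
    show "?S \<le> T"
    proof (rule ccontr)
      assume "\<not> ?S \<le> T"
      hence "1 \<le> 1 / T * ?S" using T by (simp add: field_simps)
      hence "1 \<le> ennreal (1 / T * ?S)" by (simp add: ennreal_leI)
      also have "\<dots> = ennreal (1 / T) * ennreal ?S" using T by (intro ennreal_mult') auto
      also have "\<dots> \<le> ennreal (1 / T) * h X" by (intro mult_left_mono hX X) auto
      finally show False using X by (simp add: N_def DPP_space[OF dpp])
    qed
  qed (rule m)
qed

text \<open>For the constant \<open>g = 1\<close> the pair sum is \<open>n * (n - 1)\<close>, so its
  mean is at most \<open>l\<^sup>2\<close>. Together with the mean \<open>l\<close> this bounds the
  variance by \<open>l\<close>, and Chebyshev's inequality for deviations of \<open>l / 2\<close>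
  gives \<open>4 / l\<close>.\<close>

lemma DPP_count_concentrated:
  assumes dpp: "is_DPP P bergman_kernel" and B: "rc_borel B"
    and l: "emeasure intensity B = ennreal l" "0 < l"
  obtains N where "N \<in> sets P" "measure P N \<le> 4 / l"
    "\<And>X. X \<in> Conf \<Longrightarrow> X \<notin> N \<Longrightarrow> l / 2 \<le> real (card (X \<inter> B)) \<and> real (card (X \<inter> B)) \<le> 2 * l"
proof -
  interpret prob_space P using dpp by (rule DPP_prob_space)
  define n where "n = (\<lambda>X. real (card (X \<inter> B)))"
  have [measurable]: "n \<in> borel_measurable P"
    unfolding n_def using measurable_compose[OF DPP_card_measurable[OF dpp B], of real borel] by simp
  have n0: "n X \<ge> 0" for X by (simp add: n_def)
  have [measurable]: "B \<in> sets borel" using B by (rule rc_borel_sets)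
  obtain h where h [measurable]: "h \<in> borel_measurable P"
    and hX: "\<And>X. X \<in> Conf \<Longrightarrow> ennreal (\<Sum>x\<in>X \<inter> B. \<Sum>y\<in>X \<inter> B - {x}. 1) \<le> h X"
    and hint: "(\<integral>\<^sup>+ X. h X \<partial>P) \<le> (\<integral>\<^sup>+ x. (\<integral>\<^sup>+ y. ennreal 1 * indicator B y \<partial>intensity) * indicator B x \<partial>intensity)"
    by (rule DPP_pair_sum_majorant[OF dpp B, of "\<lambda>_ _. 1"]) (simp, simp, simp, blast)
  have E1: "(\<integral>\<^sup>+ X. ennreal (n X) \<partial>P) = ennreal l"
    using DPP_mean[OF dpp B] l by (simp add: n_def ennreal_of_nat_eq_real_of_nat)
  have int1: "integrable P n"
    by (rule integrableI_bounded) (use E1 n0 in auto)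
  have mean: "expectation n = l"
    using E1 l n0 by (subst integral_eq_nn_integral) auto
  have "(\<integral>\<^sup>+ X. ennreal ((n X)\<^sup>2) \<partial>P) \<le> (\<integral>\<^sup>+ X. h X + ennreal (n X) \<partial>P)"
  proof (intro nn_integral_mono)
    fix X assume "X \<in> space P"
    hence X: "X \<in> Conf" by (simp add: DPP_space[OF dpp])
    have fin: "finite (X \<inter> B)" by (rule Conf_finite_Int[OF X B])
    have "(\<Sum>x\<in>X \<inter> B. \<Sum>y\<in>X \<inter> B - {x}. 1 :: real) = (\<Sum>x\<in>X \<inter> B. n X - 1)"
    proof (intro sum.cong refl)
      fix x assume x: "x \<in> X \<inter> B"
      hence "card (X \<inter> B) \<noteq> 0" using fin by auto
      hence "real (card (X \<inter> B) - 1) = n X - 1" by (simp add: n_def of_nat_diff)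
      moreover have "card (X \<inter> B - {x}) = card (X \<inter> B) - 1" using x by (rule card_Diff_singleton)
      ultimately show "(\<Sum>y\<in>X \<inter> B - {x}. 1 :: real) = n X - 1" by simp
    qed
    also have "\<dots> = n X * (n X - 1)" by (simp add: n_def)
    finally have eq: "(\<Sum>x\<in>X \<inter> B. \<Sum>y\<in>X \<inter> B - {x}. 1 :: real) = n X * (n X - 1)" .
    have nn: "n X * (n X - 1) \<ge> 0" unfolding eq[symmetric] by (intro sum_nonneg) auto
    have "ennreal ((n X)\<^sup>2) = ennreal (n X * (n X - 1) + n X)"
      by (simp add: power2_eq_square algebra_simps)
    also have "\<dots> = ennreal (n X * (n X - 1)) + ennreal (n X)" using nn n0 by (rule ennreal_plus)
    also have "\<dots> \<le> h X + ennreal (n X)"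
      using hX[OF X] unfolding eq by (intro add_mono) auto
    finally show "ennreal ((n X)\<^sup>2) \<le> h X + ennreal (n X)" .
  qed
  also have "\<dots> = (\<integral>\<^sup>+ X. h X \<partial>P) + ennreal l" by (simp add: nn_integral_add E1)
  also have "\<dots> \<le> ennreal l * ennreal l + ennreal l"
    using hint l by (intro add_mono) (auto simp: nn_integral_cmult_indicator)
  also have "\<dots> = ennreal (l\<^sup>2 + l)" using l by (simp add: ennreal_mult[symmetric] power2_eq_square)
  finally have E2: "(\<integral>\<^sup>+ X. ennreal ((n X)\<^sup>2) \<partial>P) \<le> ennreal (l\<^sup>2 + l)" .
  have int2: "integrable P (\<lambda>X. (n X)\<^sup>2)"
    by (rule integrableI_bounded) (use E2 in \<open>auto intro: le_less_trans\<close>)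
  have "expectation (\<lambda>X. (n X)\<^sup>2) \<le> l\<^sup>2 + l"
    using E2 l by (subst integral_eq_nn_integral) (auto intro!: enn2real_leI)
  hence var: "variance n \<le> l" by (subst variance_eq[OF int1 int2]) (simp add: mean)
  define N where "N = {X \<in> space P. l / 2 \<le> \<bar>n X - expectation n\<bar>}"
  show thesis
  proof (rule that[of N])
    show "N \<in> sets P" unfolding N_def by measurable
    have "prob N \<le> variance n / (l / 2)\<^sup>2" unfolding N_def using l int2 by (intro Chebyshev_inequality) auto
    also have "\<dots> \<le> l / (l / 2)\<^sup>2" using var by (intro divide_right_mono) auto
    also have "\<dots> = 4 / l" using l by (simp add: power2_eq_square field_simps)
    finally show "measure P N \<le> 4 / l" .
    fix X assume "X \<in> Conf" "X \<notin> N"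
    hence "\<bar>n X - l\<bar> < l / 2" by (simp add: N_def mean DPP_space[OF dpp])
    hence "l / 2 \<le> n X \<and> n X \<le> 2 * l" using l(2) by linarith
    thus "l / 2 \<le> real (card (X \<inter> B)) \<and> real (card (X \<inter> B)) \<le> 2 * l" by (simp add: n_def)
  qed
qed

text \<open>The sum of the two quantities that must be small, so that one application of Markov's
  inequality controls both: the logarithmic energy and the squared kernel. On the shell the latter
  can reach order \<open>exp (4 * k)\<close>, which the prefactor normalizes. The maximum with 0
  provides nonnegativity for all complex arguments; in the disc it changes nothing.\<close>

definition pair_energy :: "nat \<Rightarrow> complex \<Rightarrow> complex \<Rightarrow> real" where
  "pair_energy k x y = max 0 (- ln (cmod (moebius x y))) + exp (- 4 * real k) * (cmod (bergman_kernel x y))\<^sup>2"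

lemma pair_energy_nonneg: "0 \<le> pair_energy k x y"
  by (simp add: pair_energy_def)

lemma pair_energy_measurable [measurable]:
  "(\<lambda>p. pair_energy k (fst p) (snd p)) \<in> borel_measurable (borel \<Otimes>\<^sub>M borel)"
proof -
  have [measurable]: "(\<lambda>p :: complex \<times> complex. cnj (fst p)) \<in> borel_measurable (borel \<Otimes>\<^sub>M borel)"
    "(\<lambda>p :: complex \<times> complex. cnj (snd p)) \<in> borel_measurable (borel \<Otimes>\<^sub>M borel)"
    unfolding borel_prod by (intro borel_measurable_continuous_onI continuous_intros)+
  show ?thesis unfolding pair_energy_def moebius_def bergman_kernel_def by measurable
qed

lemma isCont_pair_energy:
  assumes "cmod x < 1" "cmod y < 1" "x \<noteq> y"
  shows "isCont (\<lambda>p. pair_energy k (fst p) (snd p)) (x, y)"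
proof -
  have "1 - cnj x * y \<noteq> 0" "1 - cnj y * x \<noteq> 0"
    using one_minus_cnj_mult_bounds(5)[OF assms(1,2)] one_minus_cnj_mult_bounds(5)[OF assms(2,1)] by auto
  thus ?thesis unfolding pair_energy_def moebius_def bergman_kernel_def
    using assms by (intro continuous_intros) (auto simp: mult.commute)
qed

text \<open>For fixed \<open>x\<close> the inner integral is bounded independently of
  \<open>k\<close>: density of order \<open>exp (2 * k)\<close>, thickness of order
  \<open>exp (- k)\<close>, and a one-dimensional profile of width of order
  \<open>exp (- k)\<close>. The outer integral then contributes the mass of the shell.\<close>

lemma pair_energy_integral_le:
  assumes z: "cmod z < 1"
  obtains c where "0 < c" "\<forall>\<^sub>F k in sequentially.
    (\<integral>\<^sup>+ x. (\<integral>\<^sup>+ y. ennreal (pair_energy k x y) * indicator (shell z k) y \<partial>intensity) * indicator (shell z k) x \<partial>intensity)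
      \<le> ennreal (c * exp (real k))"
proof -
  obtain a b where a: "0 < a" "\<And>k x. x \<in> shell z k \<Longrightarrow> a * exp (- real k) \<le> 1 - (cmod x)\<^sup>2"
    and b: "0 < b" "\<And>k x. x \<in> shell z k \<Longrightarrow> 1 - (cmod x)\<^sup>2 \<le> b * exp (- real k)"
    using shell_bounds[OF z] by metis
  obtain l c1 c2 where l: "\<And>k. emeasure intensity (shell z k) = ennreal (l k)"
    and c2: "0 < c2" "\<forall>\<^sub>F k in sequentially. l k \<le> c2 * exp (real k)"
    using emeasure_intensity_shell[OF z] by metis
  obtain I where I: "(\<integral>\<^sup>+ u. log_majorant u \<partial>lborel) = ennreal I" "0 \<le> I"
    using nn_integral_log_majorant_finite by (cases "\<integral>\<^sup>+ u. log_majorant u \<partial>lborel") auto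
  define C where "C = 8 * b * (b + 16 / a ^ 3) * I / (pi * a\<^sup>2)"
  have C0: "C \<ge> 0" using a b I by (simp add: C_def)
  have inner: "(\<integral>\<^sup>+ y. ennreal (pair_energy k x y) * indicator (shell z k) y \<partial>intensity) \<le> ennreal C"
    if x: "x \<in> shell z k" and k: "b * exp (- real k) \<le> 1 / 2" for x k
  proof -
    define t where "t = b * exp (- real k)"
    \<comment> \<open>Halved because \<open>1 - (cmod x)\<^sup>2\<close> is at most twice
      \<open>1 - cmod x\<close>; thus \<open>d\<close> is a lower bound for
      \<open>cmod (1 - cnj y * x)\<close>.\<close>
    define d where "d = a * exp (- real k) / 2"
    have t: "0 < t" "t \<le> 1/2" and d: "0 < d" using a b k by (auto simp: t_def d_def)
    have x1: "cmod x < 1" using x by (auto simp: shell_def)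
    \<comment> \<open>The factor 32 is 16, from writing \<open>exp (- 4 * k)\<close> through
      \<open>d ^ 4\<close>, times 2, from bounding \<open>d\<^sup>2 + u\<^sup>2\<close> by twice the
      square of \<open>cmod (1 - cnj y * x)\<close>.\<close>
    define h where "h = (\<lambda>u. log_majorant (u / t) + ennreal (32 / a ^ 4) * log_majorant (u / d))"
    have [measurable]: "h \<in> borel_measurable borel" unfolding h_def by measurable
    define f where "f = (\<lambda>y. ennreal (pair_energy k x y) * indicator (shell z k) y)"
    have "(\<lambda>y. pair_energy k x y) \<in> borel_measurable borel"
      using measurable_compose[OF measurable_Pair1'[of x borel borel] pair_energy_measurable] by simp
    hence [measurable]: "f \<in> borel_measurable borel" unfolding f_def by measurable
    \<comment> \<open>Stated for any \<open>u\<close> bounded by the distance, so that it applies to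
      the real and to the imaginary part alike.\<close>
    have fh: "f y \<le> h u" if u: "\<bar>u\<bar> \<le> cmod (x - y)" for y u
    proof (cases "y \<in> shell z k \<and> y \<noteq> x")
      case True
      hence y: "y \<in> shell z k" "x \<noteq> y" by auto
      have y1: "cmod y < 1" using y by (auto simp: shell_def)
      let ?D = "cmod (x - y)"
      have D: "?D > 0" using y by simp
      let ?q = "(1 - (cmod x)\<^sup>2) * (1 - (cmod y)\<^sup>2) / ?D\<^sup>2"
      have px: "0 < 1 - (cmod x)\<^sup>2" and py: "0 < 1 - (cmod y)\<^sup>2"
        using one_minus_cmod_sq_pos[OF x1] one_minus_cmod_sq_pos[OF y1] .
      have q0: "0 \<le> ?q" using px py by simp
      have "(1 - (cmod x)\<^sup>2) * (1 - (cmod y)\<^sup>2) \<le> t * t"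
        using px py b(2)[OF x] b(2)[OF y(1)] t by (intro mult_mono) (auto simp: t_def)
      hence q: "?q \<le> t\<^sup>2 / ?D\<^sup>2" by (simp add: divide_right_mono power2_eq_square)
      have "max 0 (- ln (cmod (moebius x y))) \<le> ln (1 + ?q)"
        unfolding minus_ln_cmod_moebius[OF x1 y1 y(2)] using q0 by simp
      hence 1: "ennreal (max 0 (- ln (cmod (moebius x y)))) \<le> log_majorant (u / t)"
        using log_majorant_ge_ln[OF t(1) u D q q0] by (meson ennreal_leI order_trans)
      let ?e = "cmod (1 - cnj y * x)"
      note e = one_minus_cnj_mult_bounds[OF y1 x1]
      have "(1 - cmod x) * (1 + cmod x) \<le> (1 - cmod x) * 2" using x1 by (intro mult_left_mono) auto
      hence "(1 - (cmod x)\<^sup>2) / 2 \<le> 1 - cmod x" by (simp add: power2_eq_square field_simps)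
      moreover have "d \<le> (1 - (cmod x)\<^sup>2) / 2" unfolding d_def by (intro divide_right_mono a(2) x) simp
      ultimately have ed: "d \<le> ?e" using e(2) by linarith
      have eu: "\<bar>u\<bar> \<le> ?e" using e(3) u by (simp add: norm_minus_commute)
      have "d\<^sup>2 \<le> ?e\<^sup>2" "u\<^sup>2 \<le> ?e\<^sup>2"
        using ed d eu by (auto intro: power_mono simp: abs_le_square_iff[symmetric])
      hence "d\<^sup>2 * (d\<^sup>2 + u\<^sup>2) \<le> ?e\<^sup>2 * (2 * ?e\<^sup>2)" by (intro mult_mono) auto
      hence "1 / (?e\<^sup>2 * (2 * ?e\<^sup>2)) \<le> 1 / (d\<^sup>2 * (d\<^sup>2 + u\<^sup>2))"
        using d e(5) by (intro divide_left_mono mult_pos_pos add_pos_nonneg) (auto simp del: zero_less_norm_iff)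
      moreover have "exp (- 4 * real k) = (exp (- real k)) ^ 4" by (simp add: exp_of_nat_mult[symmetric])
      hence "exp (- 4 * real k) = 16 / a ^ 4 * d ^ 4" using a by (simp add: d_def power_mult_distrib power_divide)
      moreover have "(cmod (bergman_kernel x y))\<^sup>2 = 2 * (1 / (?e\<^sup>2 * (2 * ?e\<^sup>2)))"
        by (simp add: bergman_kernel_def norm_divide norm_mult power_divide power2_eq_square mult.commute)
      ultimately have "exp (- 4 * real k) * (cmod (bergman_kernel x y))\<^sup>2 \<le> 16 / a ^ 4 * d ^ 4 * (2 * (1 / (d\<^sup>2 * (d\<^sup>2 + u\<^sup>2))))"
        using a d by (simp only:) (intro mult_left_mono, auto)
      also have "\<dots> = 32 / a ^ 4 * (d\<^sup>2 / (d\<^sup>2 + u\<^sup>2))"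
        using d by (simp add: power2_eq_square power4_eq_xxxx)
      finally have "ennreal (exp (- 4 * real k) * (cmod (bergman_kernel x y))\<^sup>2) \<le> ennreal (32 / a ^ 4) * ennreal (d\<^sup>2 / (d\<^sup>2 + u\<^sup>2))"
        using a by (subst ennreal_mult'[symmetric]) (auto intro: ennreal_leI)
      also have "\<dots> \<le> ennreal (32 / a ^ 4) * log_majorant (u / d)"
        by (intro mult_left_mono log_majorant_ge_inverse d) auto
      finally have 2: "ennreal (exp (- 4 * real k) * (cmod (bergman_kernel x y))\<^sup>2) \<le> ennreal (32 / a ^ 4) * log_majorant (u / d)" .
      have "f y = ennreal (pair_energy k x y)" using y by (simp add: f_def)
      also have "\<dots> = ennreal (max 0 (- ln (cmod (moebius x y)))) + ennreal (exp (- 4 * real k) * (cmod (bergman_kernel x y))\<^sup>2)"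
        unfolding pair_energy_def by (intro ennreal_plus) auto
      also have "\<dots> \<le> h u" unfolding h_def by (intro add_mono 1 2)
      finally show ?thesis .
    next
      case False
      \<comment> \<open>On the diagonal \<open>u\<close> can only be 0, where the majorant is
        infinite; off the shell \<open>f\<close> vanishes.\<close>
      hence "y \<notin> shell z k \<or> u = 0" using u by auto
      thus ?thesis by (auto simp: f_def h_def log_majorant_def)
    qed
    have int_h: "(\<integral>\<^sup>+ u. h u \<partial>lborel) = ennreal ((b + 16 / a ^ 3) * I * exp (- real k))"
    proof -
      have "(\<integral>\<^sup>+ u. h u \<partial>lborel) = ennreal t * ennreal I + ennreal (32 / a ^ 4) * (ennreal d * ennreal I)"
        unfolding h_def by (simp add: nn_integral_add nn_integral_cmult nn_integral_log_majorant_scaled[OF t(1)]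
          nn_integral_log_majorant_scaled[OF d] I)
      also have "\<dots> = ennreal (t * I + 32 / a ^ 4 * (d * I))"
        using t d a I by (simp add: ennreal_mult[symmetric] ennreal_plus[symmetric] del: ennreal_plus)
      also have "t * I + 32 / a ^ 4 * (d * I) = (b + 16 / a ^ 3) * I * exp (- real k)"
        using a by (simp add: t_def d_def field_simps eval_nat_numeral)
      finally show ?thesis .
    qed
    have "(\<integral>\<^sup>+ y. ennreal (pair_energy k x y) * indicator (shell z k) y \<partial>intensity)
        = (\<integral>\<^sup>+ y. f y * indicator (shell z k) y \<partial>intensity)"
      by (intro nn_integral_cong) (auto simp: f_def indicator_def)
    also have "\<dots> \<le> ennreal (exp (2 * real k) / (pi * a\<^sup>2)) * (\<integral>\<^sup>+ y. f y * indicator (annulus t) y \<partial>lborel)"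
      unfolding t_def by (rule nn_integral_intensity_shell_le[OF _ a(1) a(2) b(2)]) auto
    also have "\<dots> \<le> ennreal (exp (2 * real k) / (pi * a\<^sup>2)) * (ennreal (8 * t) * (\<integral>\<^sup>+ u. h u \<partial>lborel))"
    proof (rule mult_left_mono)
      have "f y \<le> h (Re y - Re x)" "f y \<le> h (Im y - Im x)" for y
        using abs_Re_le_cmod[of "x - y"] abs_Im_le_cmod[of "x - y"] by (auto intro!: fh)
      thus "(\<integral>\<^sup>+ y. f y * indicator (annulus t) y \<partial>lborel) \<le> ennreal (8 * t) * (\<integral>\<^sup>+ u. h u \<partial>lborel)"
        using t by (intro nn_integral_annulus_le[of f h t "Re x" "Im x"]) auto
    qed simp
    also have "\<dots> = ennreal (exp (2 * real k) / (pi * a\<^sup>2) * (8 * t * ((b + 16 / a ^ 3) * I * exp (- real k))))"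
      unfolding int_h using t a b I by (simp add: ennreal_mult[symmetric])
    also have "exp (2 * real k) / (pi * a\<^sup>2) * (8 * t * ((b + 16 / a ^ 3) * I * exp (- real k)))
        = C * (exp (2 * real k) * exp (- real k) * exp (- real k))"
      by (simp add: C_def t_def)
    also have "exp (2 * real k) * exp (- real k) * exp (- real k) = 1" by (simp add: exp_add[symmetric])
    finally show ?thesis by simp
  qed
  show thesis
  \<comment> \<open>\<open>C\<close> is only known to be nonnegative; the added 1 makes the constant
    positive.\<close>
  proof (rule that[of "(C + 1) * c2"])
    show "0 < (C + 1) * c2" using C0 c2 by simp
    have "(\<lambda>k. b * exp (- real k)) \<longlonglongrightarrow> 0" by real_asymp
    hence "\<forall>\<^sub>F k in sequentially. b * exp (- real k) < 1/2" by (intro order_tendstoD) auto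
    with c2(2) show "\<forall>\<^sub>F k in sequentially.
      (\<integral>\<^sup>+ x. (\<integral>\<^sup>+ y. ennreal (pair_energy k x y) * indicator (shell z k) y \<partial>intensity) * indicator (shell z k) x \<partial>intensity)
      \<le> ennreal ((C + 1) * c2 * exp (real k))"
    proof eventually_elim
      case (elim k)
      have "(\<integral>\<^sup>+ x. (\<integral>\<^sup>+ y. ennreal (pair_energy k x y) * indicator (shell z k) y \<partial>intensity) * indicator (shell z k) x \<partial>intensity)
          \<le> (\<integral>\<^sup>+ x. ennreal (C + 1) * indicator (shell z k) x \<partial>intensity)"
      proof (intro nn_integral_mono)
        fix x
        have "ennreal C \<le> ennreal (C + 1)" by (simp add: ennreal_leI)
        thus "(\<integral>\<^sup>+ y. ennreal (pair_energy k x y) * indicator (shell z k) y \<partial>intensity) * indicator (shell z k) x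
            \<le> ennreal (C + 1) * indicator (shell z k) x"
          using inner[of x k] elim by (cases "x \<in> shell z k") (auto intro: order_trans)
      qed
      also have "\<dots> = ennreal (C + 1) * ennreal (l k)" by (simp add: nn_integral_cmult_indicator l)
      also have "\<dots> \<le> ennreal (C + 1) * ennreal (c2 * exp (real k))"
        using elim by (intro mult_left_mono ennreal_leI) auto
      also have "\<dots> = ennreal ((C + 1) * c2 * exp (real k))"
        using C0 by (subst ennreal_mult'[symmetric]) (auto simp: mult.assoc)
      finally show ?case .
    qed
  qed
qed

section \<open>Interpolating functions\<close>

text \<open>The power 4 makes the bump match the square of the kernel modulus,
  \<open>1 / (cmod (1 - cnj x * w)) ^ 4\<close>, and gives the growth bound
  \<open>1 / (1 - cmod y) ^ 4\<close>. Without the conjugated sign the values at different points of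
  \<open>S\<close> could cancel in the weighted sum.\<close>

definition interp :: "complex set \<Rightarrow> complex \<Rightarrow> complex" where
  "interp S y = (\<Sum>x\<in>S. cnj (sgn (\<Prod>w\<in>S - {x}. moebius w x)) * (\<Prod>w\<in>S - {x}. moebius w y) *
     (of_real (1 - (cmod x)\<^sup>2) / (1 - cnj x * y)) ^ 4)"

lemma interp_holomorphic:
  assumes "finite S" "S \<subseteq> ball 0 1"
  shows "interp S holomorphic_on ball 0 1"
proof -
  have "1 - cnj x * y \<noteq> 0" if "x \<in> S" "y \<in> ball 0 1" for x y
    using one_minus_cnj_mult_bounds(5)[of x y] assms that by auto
  thus ?thesis unfolding interp_def moebius_def by (intro holomorphic_intros) auto
qed

lemma interp_measurable [measurable]: "interp S \<in> borel_measurable borel"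
  unfolding interp_def moebius_def by measurable

text \<open>At \<open>x\<close> every other summand contains the vanishing factor
  \<open>moebius x x\<close>; in the remaining one the bump equals 1 and the unimodular constant
  turns the product into its modulus.\<close>

lemma interp_eq:
  assumes S: "finite S" "S \<subseteq> ball 0 1" and x: "x \<in> S"
  shows "interp S x = of_real (\<Prod>w\<in>S - {x}. cmod (moebius w x))"
proof -
  let ?t = "\<lambda>v. cnj (sgn (\<Prod>w\<in>S - {v}. moebius w v)) * (\<Prod>w\<in>S - {v}. moebius w x) *
     (of_real (1 - (cmod v)\<^sup>2) / (1 - cnj v * x)) ^ 4"
  have "?t v = 0" if "v \<in> S - {x}" for v
  proof -
    have "(\<Prod>w\<in>S - {v}. moebius w x) = 0"
      using S that x by (intro prod_zero bexI[of _ x]) (auto simp: moebius_def)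
    thus ?thesis by simp
  qed
  hence "(\<Sum>v\<in>S - {x}. ?t v) = 0" by (rule sum.neutral[OF ballI])
  moreover have "interp S x = ?t x + (\<Sum>v\<in>S - {x}. ?t v)"
    unfolding interp_def by (rule sum.remove[OF S(1) x])
  ultimately have "interp S x = ?t x" by (simp only: add_0_right)
  also have "of_real (1 - (cmod x)\<^sup>2) = 1 - cnj x * x"
    by (simp only: of_real_diff of_real_1 complex_norm_square mult.commute)
  also have "(1 - cnj x * x) / (1 - cnj x * x) = 1"
    using one_minus_cnj_mult_bounds(5)[of x x] S x by auto
  also have "cnj (sgn b) * b * 1 ^ 4 = of_real (cmod b)" for b :: complex
  proof (cases "b = 0")
    case False
    have "cnj (sgn b) * b = (b * cnj b) / of_real (cmod b)"
      by (simp add: sgn_eq mult.commute)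
    also have "\<dots> = of_real (cmod b)"
      using False unfolding complex_norm_square[symmetric] by (simp add: power2_eq_square)
    finally show ?thesis by simp
  qed simp
  finally show ?thesis by (simp add: prod_norm)
qed

lemma cmod_interp_le:
  assumes S: "finite S" "S \<subseteq> ball 0 1" and y: "cmod y < 1"
  shows "cmod (interp S y) \<le> (\<Sum>x\<in>S. ((1 - (cmod x)\<^sup>2) / cmod (1 - cnj x * y)) ^ 4)"
  unfolding interp_def
proof (rule sum_norm_le)
  fix x assume x: "x \<in> S"
  have "cmod (\<Prod>w\<in>S - {x}. moebius w y) \<le> 1"
    unfolding prod_norm[symmetric] using S y
    by (intro prod_le_1) (auto intro!: less_imp_le[OF cmod_moebius_less_1])
  moreover have "cmod (cnj (sgn (\<Prod>w\<in>S - {x}. moebius w x))) \<le> 1" by (simp add: norm_sgn)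
  ultimately have "cmod (cnj (sgn (\<Prod>w\<in>S - {x}. moebius w x))) * cmod (\<Prod>w\<in>S - {x}. moebius w y) \<le> 1"
    by (intro mult_le_one) auto
  moreover have "cmod ((of_real (1 - (cmod x)\<^sup>2) / (1 - cnj x * y)) ^ 4) = ((1 - (cmod x)\<^sup>2) / cmod (1 - cnj x * y)) ^ 4"
  proof -
    have "0 < 1 - (cmod x)\<^sup>2" using S x by (intro one_minus_cmod_sq_pos) auto
    thus ?thesis by (simp add: norm_power norm_divide del: of_real_diff)
  qed
  ultimately show "cmod (cnj (sgn (\<Prod>w\<in>S - {x}. moebius w x)) * (\<Prod>w\<in>S - {x}. moebius w y) *
     (of_real (1 - (cmod x)\<^sup>2) / (1 - cnj x * y)) ^ 4) \<le> ((1 - (cmod x)\<^sup>2) / cmod (1 - cnj x * y)) ^ 4"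
    unfolding norm_mult by (metis mult_left_le_one_le mult_nonneg_nonneg norm_ge_zero)
qed

text \<open>By \<open>cmod (1 - cnj x * w) \<le> cmod (1 - cnj x * y) + cmod (1 - cnj w * y)\<close>, one of the two factors on
  the left is small when \<open>x\<close> and \<open>w\<close> are far apart.\<close>
lemma bump_product_le:
  assumes x: "cmod x < 1" and w: "cmod w < 1" and y: "cmod y < 1"
    and m: "1 - (cmod x)\<^sup>2 \<le> m" "1 - (cmod w)\<^sup>2 \<le> m"
  defines "q \<equiv> \<lambda>v. ((1 - (cmod v)\<^sup>2) / cmod (1 - cnj v * y)) ^ 4"
  shows "q x * q w \<le> 16 * m ^ 4 * (cmod (bergman_kernel x w))\<^sup>2 * (q x + q w)"
proof -
  let ?D = "cmod (1 - cnj w * x)"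
  have D: "?D > 0" using one_minus_cnj_mult_bounds(5)[OF w x] .
  have px: "0 < 1 - (cmod x)\<^sup>2" and pw: "0 < 1 - (cmod w)\<^sup>2"
    using one_minus_cmod_sq_pos[OF x] one_minus_cmod_sq_pos[OF w] .
  have m0: "m > 0" using px m by linarith
  have q0: "q v \<ge> 0" for v by (simp add: q_def)
  have K: "(cmod (bergman_kernel x w))\<^sup>2 = 1 / ?D ^ 4"
    by (simp add: bergman_kernel_def norm_divide norm_power power_divide mult.commute power_mult[symmetric])
  have tri: "?D \<le> cmod (1 - cnj x * y) + cmod (1 - cnj w * y)"
  proof -
    have "1 - cnj w * x = (1 - cnj w * y) + cnj w * (y - x)" by (simp add: algebra_simps)
    hence "?D \<le> cmod (1 - cnj w * y) + cmod (cnj w * (y - x))" by (metis norm_triangle_ineq)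
    also have "cmod (cnj w * (y - x)) \<le> 1 * cmod (x - y)"
      unfolding norm_mult complex_mod_cnj norm_minus_commute[of y x] using w by (intro mult_right_mono) auto
    also have "1 * cmod (x - y) \<le> cmod (1 - cnj x * y)" using one_minus_cnj_mult_bounds(3)[OF x y] by simp
    finally show ?thesis by simp
  qed
  have small: "q v \<le> 16 * m ^ 4 * (1 / ?D ^ 4)"
    if v: "?D / 2 \<le> cmod (1 - cnj v * y)" "0 < 1 - (cmod v)\<^sup>2" "1 - (cmod v)\<^sup>2 \<le> m" for v
  proof -
    have "q v \<le> (m / (?D / 2)) ^ 4"
      unfolding q_def using v D m0 by (intro power_mono frac_le divide_nonneg_nonneg) auto
    also have "\<dots> = 16 * m ^ 4 * (1 / ?D ^ 4)" by (simp add: power_divide)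
    finally show ?thesis .
  qed
  have c0: "0 \<le> 16 * m ^ 4 * (1 / ?D ^ 4)" using m0 by simp
  consider "?D / 2 \<le> cmod (1 - cnj x * y)" | "?D / 2 \<le> cmod (1 - cnj w * y)" using tri by linarith
  thus ?thesis
  proof cases
    case 1
    have "q x * q w \<le> 16 * m ^ 4 * (1 / ?D ^ 4) * (q x + q w)"
      using small[OF 1 px m(1)] c0 by (intro mult_mono) (auto simp: q0)
    thus ?thesis unfolding K .
  next
    case 2
    have "q w * q x \<le> 16 * m ^ 4 * (1 / ?D ^ 4) * (q x + q w)"
      using small[OF 2 pw m(2)] c0 by (intro mult_mono) (auto simp: q0)
    thus ?thesis unfolding K by (simp add: mult.commute)
  qed
qed

text \<open>Both \<open>d\<close> and \<open>cmod (y - x)\<close> are at most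
  \<open>cmod (1 - cnj x * y)\<close>, so twice its square dominates
  \<open>d\<^sup>2 + (cmod (y - x))\<^sup>2\<close> and the planar integral at scale
  \<open>d\<close> applies. The added 1 in \<open>c\<close> only secures positivity.\<close>

lemma nn_integral_bump_le:
  obtains c where "0 < c"
    "\<And>x. cmod x < 1 \<Longrightarrow> (\<integral>\<^sup>+ y. ennreal (((1 - (cmod x)\<^sup>2) / cmod (1 - cnj x * y)) ^ 4) \<partial>disc_mu)
      \<le> ennreal (c * (1 - (cmod x)\<^sup>2)\<^sup>2)"
proof -
  obtain I where I: "(\<integral>\<^sup>+ u. log_majorant u \<partial>lborel) = ennreal I" "0 \<le> I"
    using nn_integral_log_majorant_finite by (cases "\<integral>\<^sup>+ u. log_majorant u \<partial>lborel") auto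
  define c where "c = 16 * I\<^sup>2 / pi + 1"
  show thesis
  proof (rule that[of c])
    show "c > 0" using I by (auto simp: c_def intro!: add_nonneg_pos)
    fix x assume x: "cmod x < 1"
    define d where "d = (1 - (cmod x)\<^sup>2) / 2"
    have d: "d > 0" using one_minus_cmod_sq_pos[OF x] by (simp add: d_def)
    have "(1 - cmod x) * (1 + cmod x) \<le> (1 - cmod x) * 2" using x by (intro mult_left_mono) auto
    hence dx: "d \<le> 1 - cmod x" by (simp add: d_def power2_eq_square field_simps)
    have "(\<integral>\<^sup>+ y. ennreal (((1 - (cmod x)\<^sup>2) / cmod (1 - cnj x * y)) ^ 4) \<partial>disc_mu)
      = ennreal (1 / pi) * (\<integral>\<^sup>+ y. ennreal (((1 - (cmod x)\<^sup>2) / cmod (1 - cnj x * y)) ^ 4) * indicator (ball 0 1) y \<partial>lborel)"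
      by (rule nn_integral_disc_mu) measurable
    also have "\<dots> \<le> ennreal (1 / pi) * (\<integral>\<^sup>+ y. ennreal (64 * d ^ 4) * ennreal (1 / (d\<^sup>2 + (cmod (y - x))\<^sup>2)\<^sup>2) \<partial>lborel)"
    proof (intro mult_left_mono nn_integral_mono)
      fix y
      show "ennreal (((1 - (cmod x)\<^sup>2) / cmod (1 - cnj x * y)) ^ 4) * indicator (ball 0 1) y
         \<le> ennreal (64 * d ^ 4) * ennreal (1 / (d\<^sup>2 + (cmod (y - x))\<^sup>2)\<^sup>2)"
      proof (cases "cmod y < 1")
        case True
        let ?e = "cmod (1 - cnj x * y)"
        note e = one_minus_cnj_mult_bounds[OF x True]
        have "d\<^sup>2 \<le> ?e\<^sup>2" using d dx e(1) by (intro power_mono) auto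
        moreover have "(cmod (y - x))\<^sup>2 \<le> ?e\<^sup>2"
          using e(3) by (intro power_mono) (auto simp: norm_minus_commute)
        ultimately have "d\<^sup>2 + (cmod (y - x))\<^sup>2 \<le> 2 * ?e\<^sup>2" by linarith
        hence "(d\<^sup>2 + (cmod (y - x))\<^sup>2)\<^sup>2 \<le> (2 * ?e\<^sup>2)\<^sup>2" by (rule power_mono) simp
        hence le: "1 / (2 * ?e\<^sup>2)\<^sup>2 \<le> 1 / (d\<^sup>2 + (cmod (y - x))\<^sup>2)\<^sup>2"
          using d e(5) by (intro divide_left_mono mult_pos_pos zero_less_power add_pos_nonneg) (auto simp del: zero_less_norm_iff)
        have "((1 - (cmod x)\<^sup>2) / ?e) ^ 4 = 64 * d ^ 4 * (1 / (2 * ?e\<^sup>2)\<^sup>2)"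
          by (simp add: d_def power_divide power_mult_distrib power_mult[symmetric])
        also have "\<dots> \<le> 64 * d ^ 4 * (1 / (d\<^sup>2 + (cmod (y - x))\<^sup>2)\<^sup>2)"
          using d by (intro mult_left_mono le) auto
        finally show ?thesis using True d by (simp add: ennreal_mult'[symmetric] ennreal_leI)
      qed auto
    qed simp
    also have "\<dots> = ennreal (1 / pi) * (ennreal (64 * d ^ 4) * (\<integral>\<^sup>+ y. ennreal (1 / (d\<^sup>2 + (cmod (y - x))\<^sup>2)\<^sup>2) \<partial>lborel))"
      by (subst nn_integral_cmult) auto
    also have "\<dots> \<le> ennreal (1 / pi) * (ennreal (64 * d ^ 4) * (ennreal (1 / d\<^sup>2) * (ennreal I)\<^sup>2))"
      using nn_integral_inverse_square_le[OF d, of x] unfolding I by (intro mult_left_mono) auto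
    also have "\<dots> = ennreal (1 / pi * (64 * d ^ 4 * (1 / d\<^sup>2 * I\<^sup>2)))"
      using d I by (simp add: ennreal_mult[symmetric] ennreal_power)
    also have "1 / pi * (64 * d ^ 4 * (1 / d\<^sup>2 * I\<^sup>2)) = 16 * I\<^sup>2 / pi * (1 - (cmod x)\<^sup>2)\<^sup>2"
    proof -
      have "d ^ 4 * (1 / d\<^sup>2) = d\<^sup>2" using d by (simp add: power2_eq_square power4_eq_xxxx)
      moreover have "(1 - (cmod x)\<^sup>2)\<^sup>2 = 4 * d\<^sup>2" by (simp add: d_def power_divide)
      moreover have "1 / pi * (64 * d ^ 4 * (1 / d\<^sup>2 * I\<^sup>2)) = 64 * I\<^sup>2 / pi * (d ^ 4 * (1 / d\<^sup>2))" by simp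
      ultimately show ?thesis by simp
    qed
    also have "\<dots> \<le> c * (1 - (cmod x)\<^sup>2)\<^sup>2" by (intro mult_right_mono) (auto simp: c_def)
    finally show "(\<integral>\<^sup>+ y. ennreal (((1 - (cmod x)\<^sup>2) / cmod (1 - cnj x * y)) ^ 4) \<partial>disc_mu)
      \<le> ennreal (c * (1 - (cmod x)\<^sup>2)\<^sup>2)" by (simp add: ennreal_leI)
  qed
qed

lemma interp_norm_le:
  obtains c where "0 < c"
    "\<And>S m. finite S \<Longrightarrow> S \<subseteq> ball 0 1 \<Longrightarrow> (\<And>x. x \<in> S \<Longrightarrow> 1 - (cmod x)\<^sup>2 \<le> m) \<Longrightarrow>
      (\<integral>\<^sup>+ y. ennreal ((cmod (interp S y))\<^sup>2) \<partial>disc_mu)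
        \<le> ennreal (c * m ^ 6 * (\<Sum>x\<in>S. \<Sum>w\<in>S. (cmod (bergman_kernel x w))\<^sup>2))"
proof -
  obtain c where c: "0 < c" "\<And>x. cmod x < 1 \<Longrightarrow>
      (\<integral>\<^sup>+ y. ennreal (((1 - (cmod x)\<^sup>2) / cmod (1 - cnj x * y)) ^ 4) \<partial>disc_mu) \<le> ennreal (c * (1 - (cmod x)\<^sup>2)\<^sup>2)"
    using nn_integral_bump_le by metis
  show thesis
  proof (rule that[of "32 * c"])
    show "0 < 32 * c" using c by simp
    fix S m assume S: "finite S" "S \<subseteq> ball 0 1" and m: "\<And>x. x \<in> S \<Longrightarrow> 1 - (cmod x)\<^sup>2 \<le> m"
    have S1: "cmod x < 1" if "x \<in> S" for x using S that by auto
    define q where "q = (\<lambda>x y. ((1 - (cmod x)\<^sup>2) / cmod (1 - cnj x * y)) ^ 4)"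
    have q0: "q x y \<ge> 0" for x y by (simp add: q_def)
    have [measurable]: "q x \<in> borel_measurable borel" for x unfolding q_def by measurable
    let ?K = "\<lambda>x w. 16 * m ^ 4 * (cmod (bergman_kernel x w))\<^sup>2"
    have K0: "?K x w \<ge> 0" for x w by simp
    have qint: "(\<integral>\<^sup>+ y. ennreal (q x y) \<partial>disc_mu) \<le> ennreal (c * m\<^sup>2)" if x: "x \<in> S" for x
    proof -
      have "0 < 1 - (cmod x)\<^sup>2" by (rule one_minus_cmod_sq_pos[OF S1[OF x]])
      hence "(1 - (cmod x)\<^sup>2)\<^sup>2 \<le> m\<^sup>2" using m[OF x] by (intro power_mono) auto
      hence "ennreal (c * (1 - (cmod x)\<^sup>2)\<^sup>2) \<le> ennreal (c * m\<^sup>2)" using c by (intro ennreal_leI mult_left_mono) auto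
      thus ?thesis using c(2)[OF S1[OF x]] unfolding q_def by (rule order_trans[rotated])
    qed
    have AE_ball: "AE y in disc_mu. cmod y < 1"
      unfolding disc_mu_def by (subst AE_density) (auto simp: indicator_def)
    have "(\<integral>\<^sup>+ y. ennreal ((cmod (interp S y))\<^sup>2) \<partial>disc_mu)
        \<le> (\<integral>\<^sup>+ y. (\<Sum>x\<in>S. \<Sum>w\<in>S. ennreal (?K x w) * (ennreal (q x y) + ennreal (q w y))) \<partial>disc_mu)"
    proof (rule nn_integral_mono_AE, use AE_ball in eventually_elim)
      fix y assume y: "cmod y < 1"
      have "(cmod (interp S y))\<^sup>2 \<le> (\<Sum>x\<in>S. q x y)\<^sup>2"
        using cmod_interp_le[OF S y] unfolding q_def by (intro power_mono) auto
      also have "\<dots> = (\<Sum>x\<in>S. \<Sum>w\<in>S. q x y * q w y)" by (simp add: power2_eq_square sum_product)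
      also have "\<dots> \<le> (\<Sum>x\<in>S. \<Sum>w\<in>S. ?K x w * (q x y + q w y))"
        unfolding q_def by (intro sum_mono bump_product_le y m S1)
      finally have "ennreal ((cmod (interp S y))\<^sup>2) \<le> ennreal (\<Sum>x\<in>S. \<Sum>w\<in>S. ?K x w * (q x y + q w y))"
        by (rule ennreal_leI)
      also have "\<dots> = (\<Sum>x\<in>S. \<Sum>w\<in>S. ennreal (?K x w * (q x y + q w y)))"
        by (subst sum_ennreal[symmetric], intro sum_nonneg mult_nonneg_nonneg K0 add_nonneg_nonneg q0,
            intro sum.cong refl sum_ennreal[symmetric] mult_nonneg_nonneg K0 add_nonneg_nonneg q0)
      also have "\<dots> = (\<Sum>x\<in>S. \<Sum>w\<in>S. ennreal (?K x w) * (ennreal (q x y) + ennreal (q w y)))"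
        by (intro sum.cong refl) (simp only: ennreal_mult'[OF K0] ennreal_plus[OF q0 q0])
      finally show "ennreal ((cmod (interp S y))\<^sup>2) \<le> (\<Sum>x\<in>S. \<Sum>w\<in>S. ennreal (?K x w) * (ennreal (q x y) + ennreal (q w y)))" .
    qed
    also have "\<dots> = (\<Sum>x\<in>S. \<Sum>w\<in>S. ennreal (?K x w) * ((\<integral>\<^sup>+ y. ennreal (q x y) \<partial>disc_mu) + (\<integral>\<^sup>+ y. ennreal (q w y) \<partial>disc_mu)))"
      by (simp add: nn_integral_sum nn_integral_cmult nn_integral_add)
    also have "\<dots> \<le> (\<Sum>x\<in>S. \<Sum>w\<in>S. ennreal (?K x w) * (ennreal (c * m\<^sup>2) + ennreal (c * m\<^sup>2)))"
      by (intro sum_mono mult_left_mono add_mono qint) auto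
    also have "\<dots> = (\<Sum>x\<in>S. \<Sum>w\<in>S. ennreal (?K x w * (2 * (c * m\<^sup>2))))"
    proof (intro sum.cong refl)
      fix x w
      have "ennreal (c * m\<^sup>2) + ennreal (c * m\<^sup>2) = ennreal (2 * (c * m\<^sup>2))"
        using c by (subst ennreal_plus[symmetric]) auto
      thus "ennreal (?K x w) * (ennreal (c * m\<^sup>2) + ennreal (c * m\<^sup>2)) = ennreal (?K x w * (2 * (c * m\<^sup>2)))"
        by (simp only: ennreal_mult'[OF K0])
    qed
    also have "\<dots> = ennreal (\<Sum>x\<in>S. \<Sum>w\<in>S. ?K x w * (2 * (c * m\<^sup>2)))"
      using c by (subst sum_ennreal, simp, subst sum_ennreal) (auto intro!: sum_nonneg)
    also have "(\<Sum>x\<in>S. \<Sum>w\<in>S. ?K x w * (2 * (c * m\<^sup>2)))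
        = 32 * c * m ^ 6 * (\<Sum>x\<in>S. \<Sum>w\<in>S. (cmod (bergman_kernel x w))\<^sup>2)"
    proof -
      have "m ^ 6 = m ^ 4 * m\<^sup>2" by (simp add: power_add[symmetric])
      thus ?thesis by (simp add: sum_distrib_left mult_ac)
    qed
    finally show "(\<integral>\<^sup>+ y. ennreal ((cmod (interp S y))\<^sup>2) \<partial>disc_mu)
        \<le> ennreal (32 * c * m ^ 6 * (\<Sum>x\<in>S. \<Sum>w\<in>S. (cmod (bergman_kernel x w))\<^sup>2))" .
  qed
qed

lemma cmod_moebius_swap: "cmod (moebius x y) = cmod (moebius y x)"
proof -
  have "cmod (1 - cnj x * y) = cmod (cnj (1 - cnj x * y))" by (simp only: complex_mod_cnj)
  also have "\<dots> = cmod (1 - cnj y * x)" by (simp add: mult.commute)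
  finally show ?thesis by (simp add: cmod_moebius norm_minus_commute)
qed

text \<open>Jensen's inequality for \<open>exp\<close>, through the tangent at \<open>-A\<close>.\<close>
lemma sum_prod_moebius_ge:
  fixes A :: real
  assumes S: "finite S" "S \<subseteq> ball 0 1"
    and A: "(\<Sum>x\<in>S. \<Sum>w\<in>S - {x}. - ln (cmod (moebius x w))) \<le> A * card S"
  shows "exp (- A) * card S \<le> (\<Sum>x\<in>S. \<Prod>w\<in>S - {x}. cmod (moebius w x))"
proof -
  let ?L = "\<lambda>x. \<Sum>w\<in>S - {x}. - ln (cmod (moebius x w))"
  have "exp (- A) * (1 + A - ?L x) \<le> (\<Prod>w\<in>S - {x}. cmod (moebius w x))" if x: "x \<in> S" for x
  proof -
    have pos: "cmod (moebius w x) > 0" if "w \<in> S - {x}" for w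
    proof -
      have "cmod w < 1" "cmod x < 1" using S x that by auto
      thus ?thesis unfolding cmod_moebius using that
        by (intro divide_pos_pos one_minus_cnj_mult_bounds(5)) auto
    qed
    have "exp (- A) * (1 + (A - ?L x)) \<le> exp (- A) * exp (A - ?L x)"
      by (intro mult_left_mono exp_ge_add_one_self) auto
    also have "\<dots> = exp (\<Sum>w\<in>S - {x}. ln (cmod (moebius w x)))"
      by (simp add: exp_add[symmetric] sum_negf cmod_moebius_swap[of x])
    also have "\<dots> = (\<Prod>w\<in>S - {x}. exp (ln (cmod (moebius w x))))" using S by (simp add: exp_sum)
    also have "\<dots> = (\<Prod>w\<in>S - {x}. cmod (moebius w x))" using pos by (intro prod.cong refl exp_ln) auto
    finally show ?thesis by (simp add: algebra_simps)
  qed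
  hence "(\<Sum>x\<in>S. exp (- A) * (1 + A - ?L x)) \<le> (\<Sum>x\<in>S. \<Prod>w\<in>S - {x}. cmod (moebius w x))" by (rule sum_mono)
  moreover have "(\<Sum>x\<in>S. exp (- A) * (1 + A - ?L x)) = exp (- A) * ((1 + A) * card S - (\<Sum>x\<in>S. ?L x))"
    by (simp add: sum_distrib_left[symmetric] sum_subtractf)
  moreover have "exp (- A) * card S \<le> exp (- A) * ((1 + A) * card S - (\<Sum>x\<in>S. ?L x))"
    using A by (intro mult_left_mono) (auto simp: algebra_simps)
  ultimately show ?thesis by linarith
qed

section \<open>Gliding hump\<close>

text \<open>The function is a sum of some of the \<open>u j\<close>. If the functional of block
  \<open>j\<close> is below half its value at \<open>u j\<close> on the partial sum built so far,
  adding \<open>u j\<close> pushes it above that half; otherwise \<open>u j\<close> is skipped. All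
  later terms together change it by at most the sum of \<open>\<delta>\<close>. The weight
  \<open>2 ^ j\<close> in \<open>v\<close> pays for the triangle inequality in the norm, and
  \<open>\<beta>\<close> gives locally uniform convergence.\<close>

lemma gliding_hump:
  fixes S :: "nat \<Rightarrow> complex set" and w u :: "nat \<Rightarrow> complex \<Rightarrow> complex" and v \<beta> \<delta> :: "nat \<Rightarrow> real"
  assumes S: "\<And>i. finite (S i)" "\<And>i. S i \<subseteq> ball 0 1"
    and hol: "\<And>j. u j holomorphic_on ball 0 1"
    and meas [measurable]: "\<And>j. u j \<in> borel_measurable borel"
    and L2: "\<And>j. (\<integral>\<^sup>+ y. ennreal ((cmod (u j y))\<^sup>2) \<partial>disc_mu) \<le> ennreal (v j)"
    and v: "\<And>j. 0 \<le> v j" "summable (\<lambda>j. 2 ^ j * v j)"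
    and bd: "\<And>j y. cmod y < 1 \<Longrightarrow> cmod (u j y) \<le> \<beta> j / (1 - cmod y) ^ 4"
    and \<beta>: "\<And>j. 0 \<le> \<beta> j" "summable \<beta>"
    and tail: "\<And>i j. i < j \<Longrightarrow> (\<Sum>x\<in>S i. cmod (w i x) / (1 - cmod x) ^ 4) * \<beta> j \<le> \<delta> j"
    and \<delta>: "\<And>j. 0 \<le> \<delta> j" "summable \<delta>"
    and hump: "\<And>M. \<exists>j. M \<le> cmod (\<Sum>x\<in>S j. w j x * u j x)"
  obtains f where "f \<in> bergman_space" "\<And>M. \<exists>j. M \<le> cmod (\<Sum>x\<in>S j. w j x * f x)"
proof -
  define T where "T = (\<lambda>j f. \<Sum>x\<in>S j. w j x * f x)"
  \<comment> \<open>The partial sums, with the choice made by recursion. The test in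
    \<open>\<epsilon>\<close> below is the same, which turns \<open>g\<close> into a partial sum of
    a fixed series.\<close>
  define g where "g = rec_nat (\<lambda>_. 0) (\<lambda>j G. if cmod (T j (u j)) / 2 \<le> cmod (T j G) then G else (\<lambda>y. G y + u j y))"
  have g0: "g 0 = (\<lambda>_. 0)" by (simp add: g_def)
  have gS: "g (Suc j) = (if cmod (T j (u j)) / 2 \<le> cmod (T j (g j)) then g j else (\<lambda>y. g j y + u j y))" for j
    by (simp add: g_def)
  define \<epsilon> :: "nat \<Rightarrow> complex" where
    "\<epsilon> = (\<lambda>j. if cmod (T j (u j)) / 2 \<le> cmod (T j (g j)) then 0 else 1)"
  have \<epsilon>1: "cmod (\<epsilon> j) \<le> 1" for j by (simp add: \<epsilon>_def)
  define U where "U = (\<lambda>j y. \<epsilon> j * u j y)"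
  have [measurable]: "U j \<in> borel_measurable borel" for j unfolding U_def by measurable
  have U_le: "cmod (U j y) \<le> cmod (u j y)" for j y
    using mult_right_mono[OF \<epsilon>1[of j], of "cmod (u j y)"] by (simp add: U_def norm_mult)
  have g_sum: "g n y = (\<Sum>j<n. U j y)" for n y
    by (induction n) (auto simp: g0 gS U_def \<epsilon>_def)
  have big: "cmod (T j (u j)) / 2 \<le> cmod (T j (g (Suc j)))" for j
  proof (cases "cmod (T j (u j)) / 2 \<le> cmod (T j (g j))")
    case False
    hence "g (Suc j) = (\<lambda>y. g j y + u j y)" by (simp add: gS)
    hence "T j (g (Suc j)) = T j (u j) + T j (g j)"
      by (simp add: T_def sum.distrib algebra_simps)
    moreover have "cmod (T j (u j)) - cmod (T j (g j)) \<le> cmod (T j (u j) + T j (g j))" by (rule norm_diff_ineq)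
    ultimately have "cmod (T j (u j)) - cmod (T j (g j)) \<le> cmod (T j (g (Suc j)))" by (simp only:)
    thus ?thesis using False by linarith
  qed (simp add: gS)
  have bU: "cmod (U j y) \<le> \<beta> j / (1 - cmod y) ^ 4" if "cmod y < 1" for j y
    using U_le[of j y] bd[OF that, of j] by linarith
  have sum\<beta>: "summable (\<lambda>j. \<beta> j / (1 - r) ^ 4)" for r by (intro summable_divide \<beta>)
  have sumN: "summable (\<lambda>j. cmod (U j y))" if "cmod y < 1" for y
    by (rule summable_comparison_test'[OF sum\<beta>[of "cmod y"]]) (use bU[OF that] in auto)
  have sumU: "summable (\<lambda>j. U j y)" if "cmod y < 1" for y
    using sumN[OF that] by (rule summable_norm_cancel)
  define f where "f = (\<lambda>y. \<Sum>j. U j y)"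

  have f_hol: "f holomorphic_on ball 0 1"
  proof (rule holomorphic_uniform_sequence[where f = g])
    show "g n holomorphic_on ball 0 1" for n
      unfolding g_sum[abs_def] U_def by (intro holomorphic_intros hol)
    fix x :: complex assume x: "x \<in> ball 0 1"
    define d where "d = (1 - cmod x) / 2"
    have d: "d > 0" using x by (simp add: d_def)
    have in_ball: "cmod y \<le> cmod x + d" if "y \<in> cball x d" for y
      using that norm_triangle_sub[of y x] by (simp add: dist_norm norm_minus_commute)
    have r: "cmod x + d < 1" using x by (simp add: d_def field_simps)
    have "uniform_limit (cball x d) (\<lambda>n y. \<Sum>j<n. U j y) (\<lambda>y. \<Sum>j. U j y) sequentially"
    proof (rule Weierstrass_m_test)
      show "summable (\<lambda>j. \<beta> j / (1 - (cmod x + d)) ^ 4)" by (rule sum\<beta>)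
      fix j y assume y: "y \<in> cball x d"
      have "cmod y < 1" using in_ball[OF y] r by linarith
      hence "cmod (U j y) \<le> \<beta> j / (1 - cmod y) ^ 4" by (rule bU)
      also have "\<dots> \<le> \<beta> j / (1 - (cmod x + d)) ^ 4"
        using \<beta> in_ball[OF y] r by (intro divide_left_mono power_mono mult_pos_pos zero_less_power) auto
      finally show "norm (U j y) \<le> \<beta> j / (1 - (cmod x + d)) ^ 4" .
    qed
    hence "uniform_limit (cball x d) g f sequentially" by (simp add: f_def g_sum[abs_def])
    moreover have "cball x d \<subseteq> ball 0 1" using in_ball r by fastforce
    ultimately show "\<exists>d>0. cball x d \<subseteq> ball 0 1 \<and> uniform_limit (cball x d) g f sequentially" using d by blast
  qed simp

  have "(\<integral>\<^sup>+ y. ennreal ((cmod (f y))\<^sup>2) \<partial>disc_mu) < \<infinity>"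
  proof -
    define V where "V = (\<Sum>j. 2 ^ j * v j)"
    have AE_ball: "AE y in disc_mu. cmod y < 1"
      unfolding disc_mu_def by (subst AE_density) (auto simp: indicator_def)
    have [measurable]: "g n \<in> borel_measurable borel" for n unfolding g_sum[abs_def] by measurable
    have part: "(\<integral>\<^sup>+ y. ennreal ((cmod (g n y))\<^sup>2) \<partial>disc_mu) \<le> ennreal (2 * V)" for n
    proof -
      have "(\<integral>\<^sup>+ y. ennreal ((cmod (g n y))\<^sup>2) \<partial>disc_mu)
          \<le> (\<integral>\<^sup>+ y. (\<Sum>j<n. ennreal (2 * 2 ^ j) * ennreal ((cmod (u j y))\<^sup>2)) \<partial>disc_mu)"
      proof (intro nn_integral_mono)
        fix y
        have "cmod (g n y) \<le> (\<Sum>j<n. cmod (u j y))"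
          unfolding g_sum by (rule order_trans[OF norm_sum sum_mono]) (rule U_le)
        \<comment> \<open>The geometric weights split for Cauchy-Schwarz: one factor sums to at most
          2, the other produces the series of \<open>2 ^ j * v j\<close>.\<close>
        also have "\<dots> = (\<Sum>j<n. sqrt ((1/2) ^ j) * (sqrt (2 ^ j) * cmod (u j y)))"
          by (intro sum.cong refl) (simp add: mult.assoc[symmetric] real_sqrt_mult[symmetric] power_one_over)
        finally have "(cmod (g n y))\<^sup>2 \<le> (\<Sum>j<n. sqrt ((1/2) ^ j) * (sqrt (2 ^ j) * cmod (u j y)))\<^sup>2"
          by (rule power_mono) simp
        also have "\<dots> \<le> (\<Sum>j<n. (sqrt ((1/2) ^ j))\<^sup>2) * (\<Sum>j<n. (sqrt (2 ^ j) * cmod (u j y))\<^sup>2)"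
          by (rule Cauchy_Schwarz_ineq_sum)
        also have "\<dots> = (\<Sum>j<n. (1/2 :: real) ^ j) * (\<Sum>j<n. 2 ^ j * (cmod (u j y))\<^sup>2)"
          by (simp add: power_mult_distrib)
        also have "\<dots> \<le> 2 * (\<Sum>j<n. 2 ^ j * (cmod (u j y))\<^sup>2)"
        proof (intro mult_right_mono sum_nonneg)
          show "(\<Sum>j<n. (1/2 :: real) ^ j) \<le> 2" by (subst sum_gp_strict) (auto simp: field_simps)
        qed auto
        also have "\<dots> = (\<Sum>j<n. 2 * 2 ^ j * (cmod (u j y))\<^sup>2)" by (simp add: sum_distrib_left mult.assoc)
        finally have "ennreal ((cmod (g n y))\<^sup>2) \<le> ennreal (\<Sum>j<n. 2 * 2 ^ j * (cmod (u j y))\<^sup>2)" by (rule ennreal_leI)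
        also have "\<dots> = (\<Sum>j<n. ennreal (2 * 2 ^ j) * ennreal ((cmod (u j y))\<^sup>2))"
          by (subst sum_ennreal[symmetric]) (auto simp: ennreal_mult'[symmetric])
        finally show "ennreal ((cmod (g n y))\<^sup>2) \<le> (\<Sum>j<n. ennreal (2 * 2 ^ j) * ennreal ((cmod (u j y))\<^sup>2))" .
      qed
      also have "\<dots> = (\<Sum>j<n. ennreal (2 * 2 ^ j) * (\<integral>\<^sup>+ y. ennreal ((cmod (u j y))\<^sup>2) \<partial>disc_mu))"
        by (simp add: nn_integral_sum nn_integral_cmult)
      also have "\<dots> \<le> (\<Sum>j<n. ennreal (2 * 2 ^ j) * ennreal (v j))"
        by (intro sum_mono mult_left_mono L2) auto
      also have "\<dots> = ennreal (\<Sum>j<n. 2 * (2 ^ j * v j))"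
        using v by (subst sum_ennreal[symmetric]) (auto simp: ennreal_mult'[symmetric] mult.assoc)
      also have "(\<Sum>j<n. 2 * (2 ^ j * v j)) = 2 * (\<Sum>j<n. 2 ^ j * v j)" by (simp add: sum_distrib_left)
      also have "ennreal \<dots> \<le> ennreal (2 * V)"
        unfolding V_def using v by (intro ennreal_leI mult_left_mono sum_le_suminf) auto
      finally show ?thesis .
    qed
    \<comment> \<open>Fatou's lemma transfers the uniform bound on the partial sums to the limit;
      pointwise convergence in the disc suffices.\<close>
    have "(\<integral>\<^sup>+ y. ennreal ((cmod (f y))\<^sup>2) \<partial>disc_mu) \<le> (\<integral>\<^sup>+ y. liminf (\<lambda>n. ennreal ((cmod (g n y))\<^sup>2)) \<partial>disc_mu)"
    proof (rule nn_integral_mono_AE, use AE_ball in eventually_elim)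
      fix y :: complex assume y: "cmod y < 1"
      have "(\<lambda>n. g n y) \<longlonglongrightarrow> f y"
        unfolding g_sum f_def by (rule summable_LIMSEQ[OF sumU[OF y]])
      hence "(\<lambda>n. ennreal ((cmod (g n y))\<^sup>2)) \<longlonglongrightarrow> ennreal ((cmod (f y))\<^sup>2)"
        by (intro tendsto_intros)
      hence "liminf (\<lambda>n. ennreal ((cmod (g n y))\<^sup>2)) = ennreal ((cmod (f y))\<^sup>2)"
        by (intro lim_imp_Liminf) auto
      thus "ennreal ((cmod (f y))\<^sup>2) \<le> liminf (\<lambda>n. ennreal ((cmod (g n y))\<^sup>2))" by simp
    qed
    also have "\<dots> \<le> liminf (\<lambda>n. \<integral>\<^sup>+ y. ennreal ((cmod (g n y))\<^sup>2) \<partial>disc_mu)"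
      by (rule nn_integral_liminf) measurable
    also have "\<dots> \<le> liminf (\<lambda>n::nat. ennreal (2 * V))" by (intro Liminf_mono always_eventually allI part)
    also have "\<dots> = ennreal (2 * V)" by (simp add: Liminf_const)
    also have "\<dots> < \<infinity>" by simp
    finally show ?thesis .
  qed
  with f_hol have f_mem: "f \<in> bergman_space" by (simp add: bergman_space_def)

  have close: "cmod (T j f - T j (g (Suc j))) \<le> (\<Sum>i. \<delta> i)" for j
  proof -
    have S1: "cmod x < 1" if "x \<in> S j" for x using S(2)[of j] that by auto
    let ?G = "\<Sum>x\<in>S j. cmod (w j x) / (1 - cmod x) ^ 4"
    have sB: "summable (\<lambda>i. \<beta> (i + Suc j))" using \<beta>(2) by (rule summable_ignore_initial_segment)
    have "cmod (f x - g (Suc j) x) \<le> (\<Sum>i. \<beta> (i + Suc j)) / (1 - cmod x) ^ 4" if x: "x \<in> S j" for x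
    proof -
      have "f x = (\<Sum>i. U (i + Suc j) x) + g (Suc j) x"
        unfolding f_def g_sum by (rule suminf_split_initial_segment[OF sumU[OF S1[OF x]]])
      hence "cmod (f x - g (Suc j) x) = cmod (\<Sum>i. U (i + Suc j) x)" by simp
      also have "\<dots> \<le> (\<Sum>i. \<beta> (i + Suc j) / (1 - cmod x) ^ 4)"
        by (rule norm_suminf_le[OF bU[OF S1[OF x]] summable_divide[OF sB]])
      also have "\<dots> = (\<Sum>i. \<beta> (i + Suc j)) / (1 - cmod x) ^ 4" using sB by (rule suminf_divide)
      finally show ?thesis .
    qed
    hence "cmod (\<Sum>x\<in>S j. w j x * (f x - g (Suc j) x)) \<le> (\<Sum>x\<in>S j. cmod (w j x) * ((\<Sum>i. \<beta> (i + Suc j)) / (1 - cmod x) ^ 4))"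
      by (intro sum_norm_le) (unfold norm_mult, intro mult_left_mono, auto)
    also have "\<dots> = ?G * (\<Sum>i. \<beta> (i + Suc j))" by (simp add: sum_distrib_right)
    also have "\<dots> = (\<Sum>i. ?G * \<beta> (i + Suc j))" using suminf_mult[OF sB] by simp
    also have "\<dots> \<le> (\<Sum>i. \<delta> (i + Suc j))"
      using \<delta>(2) \<beta>(2) by (intro suminf_le tail summable_mult summable_ignore_initial_segment) auto
    also have "\<dots> \<le> (\<Sum>i. \<delta> i)"
      using suminf_split_initial_segment[OF \<delta>(2), of "Suc j"] \<delta>(1) sum_nonneg[of "{..<Suc j}" \<delta>] by simp
    finally show ?thesis by (simp add: T_def sum_subtractf algebra_simps)
  qed
  show thesis
  proof (rule that[OF f_mem])
    fix M
    define r where "r = (\<Sum>i. \<delta> i)"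
    \<comment> \<open>The factor 2 compensates the halving in \<open>big\<close>, and
      \<open>r\<close> the contribution of the terms after \<open>j\<close>.\<close>
    obtain j where j: "2 * (M + r) \<le> cmod (T j (u j))" using hump unfolding T_def by blast
    have "cmod (T j (g (Suc j))) \<le> cmod (T j f) + cmod (T j f - T j (g (Suc j)))"
      by (metis norm_triangle_sub norm_minus_commute)
    moreover have "cmod (T j f - T j (g (Suc j))) \<le> r" unfolding r_def by (rule close)
    moreover have "M + r \<le> cmod (T j (u j)) / 2" using j by simp
    hence "M + r \<le> cmod (T j (g (Suc j)))" using big[of j] by (rule order_trans)
    ultimately have "M \<le> cmod (T j f)" by linarith
    thus "\<exists>j. M \<le> cmod (\<Sum>x\<in>S j. w j x * f x)" unfolding T_def by blast
  qed
qed

section \<open>Combination of the probabilistic and analytic estimates on a shell\<close>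

text \<open>The count fails with probability of order \<open>exp (- k)\<close>. The energy has mean
  of order \<open>exp k\<close> and threshold of order \<open>\<eta> * k * exp k\<close>, so it
  fails with probability of order \<open>1 / k\<close>, which dominates.\<close>

lemma DPP_shell_typical:
  assumes dpp: "is_DPP P bergman_kernel" and z: "cmod z < 1" and \<eta>: "0 < \<eta>"
  obtains c1 c2 C where "0 < c1" "0 < c2" "0 < C"
    "\<forall>\<^sub>F k in sequentially. \<exists>N\<in>sets P. measure P N \<le> C / real k \<and>
      (\<forall>X\<in>Conf. X \<notin> N \<longrightarrow>
        c1 * exp (real k) \<le> card (X \<inter> shell z k) \<and> card (X \<inter> shell z k) \<le> c2 * exp (real k) \<and>
        (\<Sum>x\<in>X \<inter> shell z k. \<Sum>y\<in>X \<inter> shell z k - {x}. pair_energy k x y) \<le> \<eta> * real k * card (X \<inter> shell z k))"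
proof -
  interpret prob_space P using dpp by (rule DPP_prob_space)
  obtain l a1 a2 where a10: "0 < a1" and a2: "0 < a2"
    and l: "\<And>k. emeasure intensity (shell z k) = ennreal (l k)"
    and a1l: "\<And>k. a1 * exp (real k) \<le> l k"
    and ev1: "\<forall>\<^sub>F k in sequentially. l k \<le> a2 * exp (real k)"
  proof (rule emeasure_intensity_shell[OF z], goal_cases)
    case (1 l c1 c2)
    show ?case by (rule 1(1)[OF 1(2-6)])
  qed
  note a1 = a10 a1l
  obtain c where c: "0 < c" and ev2: "\<forall>\<^sub>F k in sequentially.
    (\<integral>\<^sup>+ x. (\<integral>\<^sup>+ y. ennreal (pair_energy k x y) * indicator (shell z k) y \<partial>intensity) * indicator (shell z k) x \<partial>intensity)
      \<le> ennreal (c * exp (real k))"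
    by (rule pair_energy_integral_le[OF z]) (rule that; blast)
  define c1 where "c1 = a1 / 2"
  have c1: "c1 > 0" using a1 by (simp add: c1_def)
  define C where "C = 4 / a1 + c / (\<eta> * c1)"
  have C: "C > 0" using a1 c \<eta> c1 by (auto simp: C_def intro!: add_pos_pos)
  show thesis
  proof (rule that[OF c1 _ C])
    show "0 < 2 * a2" using a2 by simp
    from ev1 ev2 eventually_ge_at_top[of 1]
    show "\<forall>\<^sub>F k in sequentially. \<exists>N\<in>sets P. measure P N \<le> C / real k \<and>
      (\<forall>X\<in>Conf. X \<notin> N \<longrightarrow>
        c1 * exp (real k) \<le> card (X \<inter> shell z k) \<and> card (X \<inter> shell z k) \<le> 2 * a2 * exp (real k) \<and>
        (\<Sum>x\<in>X \<inter> shell z k. \<Sum>y\<in>X \<inter> shell z k - {x}. pair_energy k x y) \<le> \<eta> * real k * card (X \<inter> shell z k))"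
    proof eventually_elim
      case (elim k)
      have k: "real k > 0" using elim by simp
      have rc: "rc_borel (shell z k)" by (rule rc_borel_shell[OF z])
      have "0 < a1 * exp (real k)" using a1 by simp
      hence lk: "l k > 0" using a1(2)[of k] by linarith
      obtain N1 where N1: "N1 \<in> sets P" "measure P N1 \<le> 4 / l k"
        "\<And>X. X \<in> Conf \<Longrightarrow> X \<notin> N1 \<Longrightarrow> l k / 2 \<le> real (card (X \<inter> shell z k)) \<and> real (card (X \<inter> shell z k)) \<le> 2 * l k"
        using DPP_count_concentrated[OF dpp rc l lk] by blast
      \<comment> \<open>Markov's inequality needs a deterministic threshold, so the lower bound
        \<open>c1 * exp k\<close> stands in for the number of points and is replaced by it at the
        end.\<close>
      have T: "0 < \<eta> * real k * (c1 * exp (real k))" using \<eta> k c1 by simp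
      have ball: "cmod x < 1" if "x \<in> shell z k" for x using that by (simp add: shell_def)
      obtain N2 where N2: "N2 \<in> sets P" "measure P N2 \<le> c * exp (real k) / (\<eta> * real k * (c1 * exp (real k)))"
        "\<And>X. X \<in> Conf \<Longrightarrow> X \<notin> N2 \<Longrightarrow>
          (\<Sum>x\<in>X \<inter> shell z k. \<Sum>y\<in>X \<inter> shell z k - {x}. pair_energy k x y) \<le> \<eta> * real k * (c1 * exp (real k))"
        using DPP_pair_sum_bounded[OF dpp rc pair_energy_nonneg pair_energy_measurable
            isCont_pair_energy[OF ball ball] elim(2) T] c by auto
      have "real k \<le> exp (real k)" using exp_ge_add_one_self[of "real k"] by linarith
      hence "a1 * real k \<le> a1 * exp (real k)" using a1(1) by (intro mult_left_mono) auto
      hence "a1 * real k \<le> l k" using a1(2)[of k] by linarith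
      hence "4 / l k \<le> 4 / (a1 * real k)" using a1 k lk by (intro divide_left_mono) auto
      moreover have "c * exp (real k) / (\<eta> * real k * (c1 * exp (real k))) = c / (\<eta> * c1) / real k"
        using k by simp
      moreover have "measure P (N1 \<union> N2) \<le> measure P N1 + measure P N2"
        using N1(1) N2(1) by (rule measure_Un_le)
      moreover have "C / real k = 4 / (a1 * real k) + c / (\<eta> * c1) / real k"
        by (simp add: C_def add_divide_distrib)
      ultimately have m: "measure P (N1 \<union> N2) \<le> C / real k"
        using N1(2) N2(2) by linarith
      show ?case
      proof (rule bexI[of _ "N1 \<union> N2"], intro conjI ballI impI)
        show "N1 \<union> N2 \<in> sets P" using N1 N2 by auto
        fix X assume X: "X \<in> Conf" "X \<notin> N1 \<union> N2"
        have n: "l k / 2 \<le> real (card (X \<inter> shell z k))" "real (card (X \<inter> shell z k)) \<le> 2 * l k"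
          using N1(3)[OF X(1)] X(2) by auto
        show n1: "c1 * exp (real k) \<le> card (X \<inter> shell z k)" using n(1) a1(2)[of k] unfolding c1_def by simp
        show "card (X \<inter> shell z k) \<le> 2 * a2 * exp (real k)" using n(2) elim(1) by simp
        have "(\<Sum>x\<in>X \<inter> shell z k. \<Sum>y\<in>X \<inter> shell z k - {x}. pair_energy k x y) \<le> \<eta> * real k * (c1 * exp (real k))"
          using N2(3)[OF X(1)] X(2) by auto
        also have "\<dots> \<le> \<eta> * real k * card (X \<inter> shell z k)" using n1 \<eta> by (intro mult_left_mono) auto
        finally show "(\<Sum>x\<in>X \<inter> shell z k. \<Sum>y\<in>X \<inter> shell z k - {x}. pair_energy k x y) \<le> \<eta> * real k * card (X \<inter> shell z k)" .
      qed (rule m)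
    qed
  qed
qed

text \<open>A deterministic statement; the exponents are bookkeeping over about \<open>exp k\<close>
  points at depth about \<open>exp (- k)\<close>. Squared norm: \<open>exp (- 6 * k)\<close> times a
  kernel sum of \<open>k * exp (5 * k)\<close>. Pointwise: \<open>exp k\<close> bumps of size
  \<open>exp (- 4 * k)\<close>. Weighted sum: weights at least \<open>exp (- s * (k + 1))\<close>,
  values of mean at least \<open>exp (- \<eta> * k)\<close>. The last bound prepares the
  \<open>tail\<close> condition of the gliding hump.\<close>

lemma interp_typical:
  assumes z: "cmod z < 1" and c1: "0 < c1" and c2: "0 < c2" and \<eta>: "0 < \<eta>" and s: "1 \<le> s"
  obtains D where "0 < D"
    "\<And>k S. 1 \<le> k \<Longrightarrow> finite S \<Longrightarrow> S \<subseteq> shell z k \<Longrightarrow> c1 * exp (real k) \<le> card S \<Longrightarrow> card S \<le> c2 * exp (real k) \<Longrightarrow>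
      (\<Sum>x\<in>S. \<Sum>y\<in>S - {x}. pair_energy k x y) \<le> \<eta> * real k * card S \<Longrightarrow>
      (\<integral>\<^sup>+ y. ennreal ((cmod (interp S y))\<^sup>2) \<partial>disc_mu) \<le> ennreal (D * real k * exp (- real k)) \<and>
      (\<forall>y. cmod y < 1 \<longrightarrow> cmod (interp S y) \<le> D * exp (- 3 * real k) / (1 - cmod y) ^ 4) \<and>
      exp (- s) * c1 * exp ((1 - s - \<eta>) * real k)
        \<le> cmod (\<Sum>x\<in>S. complex_of_real (exp (- s * hyp_dist z x)) * interp S x) \<and>
      (\<Sum>x\<in>S. cmod (complex_of_real (exp (- s * hyp_dist z x))) / (1 - cmod x) ^ 4) \<le> D * exp (4 * real k)"
proof -
  obtain a b where a: "0 < a" "\<And>k x. x \<in> shell z k \<Longrightarrow> a * exp (- real k) \<le> 1 - (cmod x)\<^sup>2"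
    and b: "0 < b" "\<And>k x. x \<in> shell z k \<Longrightarrow> 1 - (cmod x)\<^sup>2 \<le> b * exp (- real k)"
    using shell_bounds[OF z] by metis
  obtain c where c: "0 < c"
    "\<And>S m. finite S \<Longrightarrow> S \<subseteq> ball 0 1 \<Longrightarrow> (\<And>x. x \<in> S \<Longrightarrow> 1 - (cmod x)\<^sup>2 \<le> m) \<Longrightarrow>
      (\<integral>\<^sup>+ y. ennreal ((cmod (interp S y))\<^sup>2) \<partial>disc_mu)
        \<le> ennreal (c * m ^ 6 * (\<Sum>x\<in>S. \<Sum>w\<in>S. (cmod (bergman_kernel x w))\<^sup>2))"
    by (rule interp_norm_le) (rule that; blast)
  define D1 where "D1 = c * b ^ 6 * (c2 * (1 / a ^ 4 + \<eta>))"
  define D2 where "D2 = c2 * b ^ 4"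
  define D3 where "D3 = c2 * (16 / a ^ 4)"
  \<comment> \<open>One constant for three estimates: \<open>D1\<close> for the norm,
    \<open>D2\<close> for the pointwise bound, \<open>D3\<close> for the weights.\<close>
  define D where "D = D1 + D2 + D3"
  have D0: "D1 > 0" "D2 > 0" "D3 > 0" using a b c c2 \<eta> by (auto simp: D1_def D2_def D3_def intro!: mult_pos_pos add_pos_pos)
  show thesis
  proof (rule that[of D], goal_cases)
    case 1
    show ?case using D0 by (simp add: D_def)
  next
    case (2 k S)
    note k = 2(1) and fin = 2(2) and sub = 2(3) and n1 = 2(4) and n2 = 2(5) and en = 2(6)
    let ?n = "real (card S)" and ?E = "exp (real k)"
    have SB: "S \<subseteq> ball 0 1" using sub by (auto simp: shell_def)
    have S1: "cmod x < 1" if "x \<in> S" for x using SB that by auto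
    have E4: "exp (4 * real k) = ?E ^ 4" by (simp add: exp_of_nat_mult[symmetric])
    have Em: "exp (- real k) = 1 / ?E" by (simp add: exp_minus inverse_eq_divide)
    have E0: "?E > 0" by simp

    have diag: "(cmod (bergman_kernel x x))\<^sup>2 \<le> exp (4 * real k) * (1 / a ^ 4)" if x: "x \<in> S" for x
    proof -
      have p: "0 < a * exp (- real k)" using a by simp
      have q: "a * exp (- real k) \<le> 1 - (cmod x)\<^sup>2" using a(2) sub x by blast
      have r: "0 < 1 - (cmod x)\<^sup>2" using p q by linarith
      have le: "(a * exp (- real k)) ^ 4 \<le> (1 - (cmod x)\<^sup>2) ^ 4" using p q by (intro power_mono) auto
      have "1 / (1 - (cmod x)\<^sup>2) ^ 4 \<le> 1 / (a * exp (- real k)) ^ 4"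
        by (rule divide_left_mono[OF le]) (intro mult_pos_pos[OF zero_less_power[OF r] zero_less_power[OF p]] zero_le_one)+
      moreover have "(cmod (bergman_kernel x x))\<^sup>2 = 1 / (1 - (cmod x)\<^sup>2) ^ 4"
        unfolding bergman_kernel_diag norm_of_real power2_abs by (simp add: power_divide)
      moreover have "1 / (a * exp (- real k)) ^ 4 = exp (4 * real k) * (1 / a ^ 4)"
        unfolding E4 Em by (simp add: power_mult_distrib power_divide)
      ultimately show ?thesis by simp
    qed
    have off: "(\<Sum>w\<in>S - {x}. (cmod (bergman_kernel x w))\<^sup>2) \<le> exp (4 * real k) * (\<Sum>w\<in>S - {x}. pair_energy k x w)" for x
      unfolding sum_distrib_left
    proof (rule sum_mono)
      fix w
      have "(cmod (bergman_kernel x w))\<^sup>2 = exp (4 * real k) * (exp (- 4 * real k) * (cmod (bergman_kernel x w))\<^sup>2)"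
        by (simp add: mult.assoc[symmetric] exp_add[symmetric])
      also have "\<dots> \<le> exp (4 * real k) * pair_energy k x w"
        by (intro mult_left_mono) (auto simp: pair_energy_def)
      finally show "(cmod (bergman_kernel x w))\<^sup>2 \<le> exp (4 * real k) * pair_energy k x w" .
    qed
    have "(\<Sum>x\<in>S. \<Sum>w\<in>S. (cmod (bergman_kernel x w))\<^sup>2)
        = (\<Sum>x\<in>S. (cmod (bergman_kernel x x))\<^sup>2 + (\<Sum>w\<in>S - {x}. (cmod (bergman_kernel x w))\<^sup>2))"
      using fin by (intro sum.cong refl) (simp add: sum.remove)
    also have "\<dots> \<le> (\<Sum>x\<in>S. exp (4 * real k) * (1 / a ^ 4) + exp (4 * real k) * (\<Sum>w\<in>S - {x}. pair_energy k x w))"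
      by (intro sum_mono add_mono diag off)
    also have "\<dots> = exp (4 * real k) * (?n * (1 / a ^ 4) + (\<Sum>x\<in>S. \<Sum>w\<in>S - {x}. pair_energy k x w))"
      by (simp add: sum.distrib sum_distrib_left[symmetric] algebra_simps)
    \<comment> \<open>The diagonal terms carry no factor \<open>k\<close>; since
      \<open>1 \<le> k\<close> they can be merged with the energy term.\<close>
    also have "\<dots> \<le> exp (4 * real k) * (?n * (real k * (1 / a ^ 4)) + \<eta> * real k * ?n)"
    proof (intro mult_left_mono add_mono en)
      have "1 * (1 / a ^ 4) \<le> real k * (1 / a ^ 4)" using k a by (intro mult_right_mono) auto
      thus "1 / a ^ 4 \<le> real k * (1 / a ^ 4)" by simp
    qed auto
    also have "\<dots> = exp (4 * real k) * ((1 / a ^ 4 + \<eta>) * real k) * ?n" by (simp add: algebra_simps)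
    also have "\<dots> \<le> exp (4 * real k) * ((1 / a ^ 4 + \<eta>) * real k) * (c2 * ?E)"
      using a \<eta> by (intro mult_left_mono n2) auto
    finally have KK: "(\<Sum>x\<in>S. \<Sum>w\<in>S. (cmod (bergman_kernel x w))\<^sup>2)
        \<le> exp (4 * real k) * ((1 / a ^ 4 + \<eta>) * real k) * (c2 * ?E)" .
    have "(\<integral>\<^sup>+ y. ennreal ((cmod (interp S y))\<^sup>2) \<partial>disc_mu)
        \<le> ennreal (c * (b * exp (- real k)) ^ 6 * (\<Sum>x\<in>S. \<Sum>w\<in>S. (cmod (bergman_kernel x w))\<^sup>2))"
      using b(2) sub by (intro c(2) fin SB) blast
    also have "\<dots> \<le> ennreal (D * real k * exp (- real k))"
    proof (rule ennreal_leI)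
      have "c * (b * exp (- real k)) ^ 6 * (\<Sum>x\<in>S. \<Sum>w\<in>S. (cmod (bergman_kernel x w))\<^sup>2)
          \<le> c * (b * exp (- real k)) ^ 6 * (exp (4 * real k) * ((1 / a ^ 4 + \<eta>) * real k) * (c2 * ?E))"
        using c b by (intro mult_left_mono KK) auto
      also have "\<dots> = D1 * real k * ((exp (- real k)) ^ 6 * exp (4 * real k) * ?E)"
        by (simp add: D1_def power_mult_distrib)
      also have "(exp (- real k)) ^ 6 * exp (4 * real k) * ?E = exp (- real k)"
        unfolding exp_of_nat_mult[symmetric] exp_add[symmetric] by simp
      also have "D1 * real k * exp (- real k) \<le> D * real k * exp (- real k)"
        using D0 by (intro mult_right_mono) (auto simp: D_def)
      finally show "c * (b * exp (- real k)) ^ 6 * (\<Sum>x\<in>S. \<Sum>w\<in>S. (cmod (bergman_kernel x w))\<^sup>2)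
          \<le> D * real k * exp (- real k)" .
    qed
    finally have P1: "(\<integral>\<^sup>+ y. ennreal ((cmod (interp S y))\<^sup>2) \<partial>disc_mu) \<le> ennreal (D * real k * exp (- real k))" .

    have P2: "cmod (interp S y) \<le> D * exp (- 3 * real k) / (1 - cmod y) ^ 4" if y: "cmod y < 1" for y
    proof -
      have "cmod (interp S y) \<le> (\<Sum>x\<in>S. ((1 - (cmod x)\<^sup>2) / cmod (1 - cnj x * y)) ^ 4)"
        by (rule cmod_interp_le[OF fin SB y])
      also have "\<dots> \<le> (\<Sum>x\<in>S. (b * exp (- real k) / (1 - cmod y)) ^ 4)"
      proof (intro sum_mono power_mono frac_le)
        fix x assume x: "x \<in> S"
        show "1 - (cmod x)\<^sup>2 \<le> b * exp (- real k)" using b(2) sub x by blast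
        show "1 - cmod y \<le> cmod (1 - cnj x * y)" by (rule one_minus_cnj_mult_bounds(2)[OF S1[OF x] y])
        show "0 \<le> (1 - (cmod x)\<^sup>2) / cmod (1 - cnj x * y)"
          using one_minus_cmod_sq_pos[OF S1[OF x]] by simp
      qed (use y b in auto)
      also have "\<dots> = ?n * ((b * exp (- real k)) ^ 4 / (1 - cmod y) ^ 4)" by (simp add: power_divide)
      also have "\<dots> \<le> (c2 * ?E) * ((b * exp (- real k)) ^ 4 / (1 - cmod y) ^ 4)"
        using b y by (intro mult_right_mono n2) auto
      also have "\<dots> = D2 * (?E * (exp (- real k)) ^ 4) / (1 - cmod y) ^ 4"
        by (simp add: D2_def power_mult_distrib)
      also have "?E * (exp (- real k)) ^ 4 = exp (- 3 * real k)"
        unfolding exp_of_nat_mult[symmetric] exp_add[symmetric] by simp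
      also have "D2 * exp (- 3 * real k) / (1 - cmod y) ^ 4 \<le> D * exp (- 3 * real k) / (1 - cmod y) ^ 4"
        using D0 y by (intro divide_right_mono mult_right_mono) (auto simp: D_def)
      finally show ?thesis .
    qed

    have d: "real k \<le> hyp_dist z x" "hyp_dist z x < real k + 1" if "x \<in> S" for x
      using sub that by (auto simp: shell_def)
    let ?p = "\<lambda>x. \<Prod>w\<in>S - {x}. cmod (moebius w x)"
    have p0: "?p x \<ge> 0" for x by (intro prod_nonneg) auto
    have P3: "exp (- s) * c1 * exp ((1 - s - \<eta>) * real k)
        \<le> cmod (\<Sum>x\<in>S. complex_of_real (exp (- s * hyp_dist z x)) * interp S x)"
    proof -
      have "(\<Sum>x\<in>S. \<Sum>w\<in>S - {x}. - ln (cmod (moebius x w))) \<le> (\<Sum>x\<in>S. \<Sum>y\<in>S - {x}. pair_energy k x y)"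
        by (intro sum_mono) (auto simp: pair_energy_def intro!: add_increasing2)
      also have "\<dots> \<le> \<eta> * real k * ?n" by (rule en)
      finally have "exp (- (\<eta> * real k)) * ?n \<le> (\<Sum>x\<in>S. ?p x)" by (rule sum_prod_moebius_ge[OF fin SB])
      moreover have "exp (- (\<eta> * real k)) * (c1 * ?E) \<le> exp (- (\<eta> * real k)) * ?n"
        by (intro mult_left_mono n1) auto
      ultimately have "exp (- (\<eta> * real k)) * (c1 * ?E) \<le> (\<Sum>x\<in>S. ?p x)" by linarith
      hence "exp (- s * (real k + 1)) * (exp (- (\<eta> * real k)) * (c1 * ?E)) \<le> exp (- s * (real k + 1)) * (\<Sum>x\<in>S. ?p x)"
        by (rule mult_left_mono) simp
      also have "\<dots> \<le> (\<Sum>x\<in>S. exp (- s * hyp_dist z x) * ?p x)"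
        unfolding sum_distrib_left using less_imp_le[OF d(2)] s p0 by (intro sum_mono mult_right_mono) (auto simp: mult_left_mono)
      also have "\<dots> = cmod (of_real (\<Sum>x\<in>S. exp (- s * hyp_dist z x) * ?p x))"
        unfolding norm_of_real using p0 by (intro abs_of_nonneg[symmetric] sum_nonneg mult_nonneg_nonneg) auto
      also have "of_real (\<Sum>x\<in>S. exp (- s * hyp_dist z x) * ?p x)
          = (\<Sum>x\<in>S. complex_of_real (exp (- s * hyp_dist z x)) * interp S x)"
        unfolding of_real_sum by (intro sum.cong refl) (simp add: interp_eq[OF fin SB])
      finally have "exp (- s * (real k + 1)) * (exp (- (\<eta> * real k)) * (c1 * ?E))
          \<le> cmod (\<Sum>x\<in>S. complex_of_real (exp (- s * hyp_dist z x)) * interp S x)" .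
      moreover have "exp (- s * (real k + 1)) * (exp (- (\<eta> * real k)) * (c1 * ?E)) = exp (- s) * c1 * exp ((1 - s - \<eta>) * real k)"
      proof -
        have "exp (- s * (real k + 1)) * exp (- (\<eta> * real k)) * ?E = exp (- s) * exp ((1 - s - \<eta>) * real k)"
          unfolding exp_add[symmetric] by (simp add: algebra_simps)
        thus ?thesis by (simp add: mult_ac)
      qed
      ultimately show ?thesis by (simp only:)
    qed

    have P4: "(\<Sum>x\<in>S. cmod (complex_of_real (exp (- s * hyp_dist z x))) / (1 - cmod x) ^ 4) \<le> D * exp (4 * real k)"
    proof -
      have "(\<Sum>x\<in>S. cmod (complex_of_real (exp (- s * hyp_dist z x))) / (1 - cmod x) ^ 4)
          \<le> (\<Sum>x\<in>S. exp (- real k) / (a * exp (- real k) / 2) ^ 4)"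
      proof (intro sum_mono frac_le power_mono)
        fix x assume x: "x \<in> S"
        \<comment> \<open>From \<open>1 \<le> s\<close> alone; the cruder weight
          \<open>exp (- k)\<close> is enough and cancels the number of points.\<close>
        have "real k \<le> s * hyp_dist z x" using d(1)[OF x] mult_right_mono[OF s, of "hyp_dist z x"] by simp
        thus "cmod (complex_of_real (exp (- s * hyp_dist z x))) \<le> exp (- real k)" by simp
        have "(1 - cmod x) * (1 + cmod x) \<le> (1 - cmod x) * 2" using S1[OF x] by (intro mult_left_mono) auto
        hence "(1 - (cmod x)\<^sup>2) / 2 \<le> 1 - cmod x" by (simp add: power2_eq_square field_simps)
        moreover have "a * exp (- real k) \<le> 1 - (cmod x)\<^sup>2" using a(2) sub x by blast
        hence "a * exp (- real k) / 2 \<le> (1 - (cmod x)\<^sup>2) / 2" by (rule divide_right_mono) simp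
        ultimately show "a * exp (- real k) / 2 \<le> 1 - cmod x" by linarith
      qed (use a in auto)
      also have "\<dots> = ?n * (exp (- real k) / (a * exp (- real k) / 2) ^ 4)" by simp
      also have "\<dots> \<le> c2 * ?E * (exp (- real k) / (a * exp (- real k) / 2) ^ 4)"
        using a by (intro mult_right_mono n2) auto
      also have "\<dots> = D3 * exp (4 * real k)"
        unfolding E4 Em by (simp add: D3_def power_divide power_mult_distrib)
      also have "\<dots> \<le> D * exp (4 * real k)" using D0 by (intro mult_right_mono) (auto simp: D_def)
      finally show ?thesis .
    qed
    show ?case using P1 P2 P3 P4 by blast
  qed
qed

theorem theorem1p1:
  fixes P :: "complex set measure" and s :: real and z :: complex
  assumes "is_DPP P bergman_kernel"
    and "1 < s" and "s < 3/2"
    and "z \<in> ball 0 1"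
  shows "\<exists>N \<in> sets P. emeasure P N = 0 \<and>
           {X \<in> Conf. \<forall>f \<in> bergman_space.
              summable (\<lambda>k::nat. \<Sum>x \<in> {x \<in> X. real k \<le> hyp_dist z x \<and> hyp_dist z x < real k + 1}.
                 complex_of_real (exp (- s * hyp_dist z x)) * f x)} \<subseteq> N"
proof -
  note dpp = assms(1)
  have z: "cmod z < 1" using assms(4) by simp
  interpret prob_space P using dpp by (rule DPP_prob_space)
  \<comment> \<open>\<open>\<sigma>\<close> is the rate of rescaling, the midpoint of the admissible
    range from \<open>s - 1\<close> to 1/2, and \<open>\<eta>\<close> is a quarter of the margin
    \<open>3/2 - s\<close>. The rescaled squared norms are then of order
    \<open>k * exp (- 4 * \<eta> * k)\<close>, while the weighted sums still grow at least like
    \<open>exp (\<eta> * k)\<close> after the Jensen loss.\<close>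
  define \<eta> where "\<eta> = (3/2 - s) / 4"
  define \<sigma> where "\<sigma> = (s - 1/2) / 2"
  have \<eta>: "\<eta> > 0" using assms(3) by (simp add: \<eta>_def)
  have \<sigma>: "2 * \<sigma> = 1 - 4 * \<eta>" "\<sigma> = s - 1 + 2 * \<eta>" "\<sigma> \<le> 1/2" "0 \<le> \<sigma>"
    using assms(2,3) by (auto simp: \<eta>_def \<sigma>_def field_simps)
  define good where "good = (\<lambda>c1 c2 k X. c1 * exp (real k) \<le> card (X \<inter> shell z k) \<and>
        card (X \<inter> shell z k) \<le> c2 * exp (real k) \<and>
        (\<Sum>x\<in>X \<inter> shell z k. \<Sum>y\<in>X \<inter> shell z k - {x}. pair_energy k x y) \<le> \<eta> * real k * card (X \<inter> shell z k))"
  obtain c1 c2 C where c: "0 < c1" "0 < c2" "0 < C"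
    and ev: "\<forall>\<^sub>F k in sequentially. \<exists>N\<in>sets P. measure P N \<le> C / real k \<and> (\<forall>X\<in>Conf. X \<notin> N \<longrightarrow> good c1 c2 k X)"
    unfolding good_def by (rule DPP_shell_typical[OF dpp z \<eta>])
  have s1: "1 \<le> s" using assms(2) by simp
  obtain D where D: "0 < D" and typical: "\<And>k S. 1 \<le> k \<Longrightarrow> finite S \<Longrightarrow> S \<subseteq> shell z k \<Longrightarrow> c1 * exp (real k) \<le> card S \<Longrightarrow> card S \<le> c2 * exp (real k) \<Longrightarrow>
      (\<Sum>x\<in>S. \<Sum>y\<in>S - {x}. pair_energy k x y) \<le> \<eta> * real k * card S \<Longrightarrow>
      (\<integral>\<^sup>+ y. ennreal ((cmod (interp S y))\<^sup>2) \<partial>disc_mu) \<le> ennreal (D * real k * exp (- real k)) \<and>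
      (\<forall>y. cmod y < 1 \<longrightarrow> cmod (interp S y) \<le> D * exp (- 3 * real k) / (1 - cmod y) ^ 4) \<and>
      exp (- s) * c1 * exp ((1 - s - \<eta>) * real k)
        \<le> cmod (\<Sum>x\<in>S. complex_of_real (exp (- s * hyp_dist z x)) * interp S x) \<and>
      (\<Sum>x\<in>S. cmod (complex_of_real (exp (- s * hyp_dist z x))) / (1 - cmod x) ^ 4) \<le> D * exp (4 * real k)"
    by (rule interp_typical[OF z c(1,2) \<eta> s1]) blast

  have pow: "filterlim (\<lambda>j::nat. 2 ^ j :: nat) at_top sequentially"
    by (rule filterlim_subseq) (auto simp: strict_mono_def)
  have "\<forall>\<^sub>F j in sequentially. \<exists>N\<in>sets P. measure P N \<le> C / real (2 ^ j) \<and> (\<forall>X\<in>Conf. X \<notin> N \<longrightarrow> good c1 c2 (2 ^ j) X)"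
    using eventually_compose_filterlim[OF ev pow] .
  then obtain J0 where "\<forall>j\<ge>J0. \<exists>N\<in>sets P. measure P N \<le> C / real (2 ^ j) \<and> (\<forall>X\<in>Conf. X \<notin> N \<longrightarrow> good c1 c2 (2 ^ j) X)"
    unfolding eventually_sequentially by blast
  hence "\<forall>j. \<exists>N. j \<ge> J0 \<longrightarrow> N \<in> sets P \<and> measure P N \<le> C / real (2 ^ j) \<and> (\<forall>X\<in>Conf. X \<notin> N \<longrightarrow> good c1 c2 (2 ^ j) X)"
    by blast
  then obtain N where N: "\<And>j. j \<ge> J0 \<Longrightarrow> N j \<in> sets P \<and> measure P (N j) \<le> C / real (2 ^ j) \<and> (\<forall>X\<in>Conf. X \<notin> N j \<longrightarrow> good c1 c2 (2 ^ j) X)"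
    by metis
  have sumN: "summable (\<lambda>j. measure P (N (j + J0)))"
  proof (rule summable_comparison_test')
    show "summable (\<lambda>j. C * (1/2) ^ j)" by (intro summable_mult summable_geometric) auto
    fix j :: nat
    have "measure P (N (j + J0)) \<le> C / real (2 ^ (j + J0))" using N[of "j + J0"] by simp
    also have "\<dots> \<le> C / 2 ^ j" using c(3) by (intro divide_left_mono) (auto simp: power_add)
    finally show "norm (measure P (N (j + J0))) \<le> C * (1/2) ^ j" by (simp add: power_one_over field_simps)
  qed
  have "AE X in P. \<forall>\<^sub>F j in sequentially. X \<in> space P - N (j + J0)"
    using N by (intro borel_cantelli_AE1 sumN) (auto simp: emeasure_eq_measure)
  hence "AE X in P. \<forall>\<^sub>F j in sequentially. good c1 c2 (2 ^ (j + J0)) X"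
  proof (rule AE_mp, intro AE_I2 impI)
    fix X assume "X \<in> space P" "\<forall>\<^sub>F j in sequentially. X \<in> space P - N (j + J0)"
    thus "\<forall>\<^sub>F j in sequentially. good c1 c2 (2 ^ (j + J0)) X"
      using N by (auto elim!: eventually_mono simp: DPP_space[OF dpp])
  qed
  then obtain N0 where N0: "{X \<in> space P. \<not> (\<forall>\<^sub>F j in sequentially. good c1 c2 (2 ^ (j + J0)) X)} \<subseteq> N0"
    "emeasure P N0 = 0" "N0 \<in> sets P"
    by (rule AE_E)

  \<comment> \<open>From here on the configuration is fixed and the argument is
    deterministic.\<close>
  have unsum: "\<exists>f\<in>bergman_space. \<not> summable (\<lambda>k::nat. \<Sum>x \<in> {x \<in> X. real k \<le> hyp_dist z x \<and> hyp_dist z x < real k + 1}.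
                 complex_of_real (exp (- s * hyp_dist z x)) * f x)"
    if X: "X \<in> Conf" and gd: "\<forall>\<^sub>F j in sequentially. good c1 c2 (2 ^ (j + J0)) X" for X
  proof -
    have XB: "X \<subseteq> ball 0 1" using X by (simp add: Conf_def)
    have set_eq: "{x \<in> X. real k \<le> hyp_dist z x \<and> hyp_dist z x < real k + 1} = X \<inter> shell z k" for k :: nat
      using XB by (auto simp: shell_def)
    have gd': "\<forall>\<^sub>F j in sequentially. good c1 c2 (2 ^ j) X"
      using gd by (rule eventually_sequentially_seg[THEN iffD1])
    have "\<forall>\<^sub>F k in sequentially. 1 \<le> k"
      by (rule eventually_ge_at_top)
    moreover have "\<forall>\<^sub>F k :: nat in sequentially. D * real k * exp (- 4 * \<eta> * real k) \<le> 1 / (real k)\<^sup>2"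
      using D \<eta> by real_asymp
    moreover have "\<forall>\<^sub>F k :: nat in sequentially. D * D * exp (- (1/2) * real k) \<le> 1 / real k"
      using D by real_asymp
    moreover have "\<forall>\<^sub>F k :: nat in sequentially. D * exp (- (5/2) * real k) \<le> 1 / real k"
      using D by real_asymp
    moreover have "\<forall>\<^sub>F k :: nat in sequentially. real k \<le> exp (- s) * c1 * exp (\<eta> * real k)"
      using c(1) \<eta> by real_asymp
    \<comment> \<open>After \<open>1 \<le> k\<close>, the four conditions provide, in this order,
      the summability of the norms, the smallness on earlier shells, the summability of the
      pointwise bounds and the growth of the hump.\<close>
    ultimately have "\<forall>\<^sub>F k :: nat in sequentially. 1 \<le> k \<and> D * real k * exp (- 4 * \<eta> * real k) \<le> 1 / (real k)\<^sup>2 \<and>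
        D * D * exp (- (1/2) * real k) \<le> 1 / real k \<and> D * exp (- (5/2) * real k) \<le> 1 / real k \<and>
        real k \<le> exp (- s) * c1 * exp (\<eta> * real k)"
      by eventually_elim blast
    from eventually_conj[OF eventually_compose_filterlim[OF this pow] gd']
    obtain J where J: "\<And>j. j \<ge> J \<Longrightarrow> D * real (2 ^ j) * exp (- 4 * \<eta> * real (2 ^ j)) \<le> 1 / (real (2 ^ j))\<^sup>2 \<and>
        D * D * exp (- (1/2) * real (2 ^ j)) \<le> 1 / real (2 ^ j) \<and> D * exp (- (5/2) * real (2 ^ j)) \<le> 1 / real (2 ^ j) \<and>
        real (2 ^ j) \<le> exp (- s) * c1 * exp (\<eta> * real (2 ^ j)) \<and> good c1 c2 (2 ^ j) X"
      unfolding eventually_sequentially by blast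
    \<comment> \<open>Shifted by \<open>J\<close>, so that all eventual conditions hold from the
      first index on.\<close>
    define k :: "nat \<Rightarrow> nat" where "k = (\<lambda>j. 2 ^ (j + J))"
    have k1: "1 \<le> k j" for j by (simp add: k_def)
    have k2: "2 ^ j \<le> real (k j)" for j by (simp add: k_def power_add)
    have kinv: "1 / real (k j) \<le> (1/2) ^ j" for j
      using k2[of j] k1[of j] by (simp add: power_one_over divide_left_mono)
    \<comment> \<open>The doubling gives \<open>4 * k i \<le> 2 * k j\<close>, so the growth
      \<open>exp (4 * k i)\<close> from an earlier shell is absorbed by the decay
      \<open>exp (- (5/2) * k j)\<close>, with \<open>exp (- (1/2) * k j)\<close> to spare.\<close>
    have kk: "2 * real (k i) \<le> real (k j)" if "i < j" for i j
    proof -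
      have "(2::real) ^ Suc (i + J) \<le> 2 ^ (j + J)" using that by (intro power_increasing) auto
      thus ?thesis by (simp add: k_def)
    qed
    have Jk: "D * real (k j) * exp (- 4 * \<eta> * real (k j)) \<le> 1 / (real (k j))\<^sup>2"
        "D * D * exp (- (1/2) * real (k j)) \<le> 1 / real (k j)" "D * exp (- (5/2) * real (k j)) \<le> 1 / real (k j)"
        "real (k j) \<le> exp (- s) * c1 * exp (\<eta> * real (k j))" "good c1 c2 (k j) X" for j
      using J[of "j + J"] by (auto simp: k_def)
    define S where "S = (\<lambda>j. X \<inter> shell z (k j))"
    have Sfin: "finite (S j)" for j unfolding S_def by (rule Conf_finite_Int[OF X rc_borel_shell[OF z]])
    have SB: "S j \<subseteq> ball 0 1" for j using XB by (auto simp: S_def)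
    have T: "(\<integral>\<^sup>+ y. ennreal ((cmod (interp (S j) y))\<^sup>2) \<partial>disc_mu) \<le> ennreal (D * real (k j) * exp (- real (k j)))"
      "\<And>y. cmod y < 1 \<Longrightarrow> cmod (interp (S j) y) \<le> D * exp (- 3 * real (k j)) / (1 - cmod y) ^ 4"
      "exp (- s) * c1 * exp ((1 - s - \<eta>) * real (k j))
        \<le> cmod (\<Sum>x\<in>S j. complex_of_real (exp (- s * hyp_dist z x)) * interp (S j) x)"
      "(\<Sum>x\<in>S j. cmod (complex_of_real (exp (- s * hyp_dist z x))) / (1 - cmod x) ^ 4) \<le> D * exp (4 * real (k j))" for j
    proof -
      have "S j \<subseteq> shell z (k j)" by (auto simp: S_def)
      moreover have "c1 * exp (real (k j)) \<le> card (S j)" "card (S j) \<le> c2 * exp (real (k j))"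
        "(\<Sum>x\<in>S j. \<Sum>y\<in>S j - {x}. pair_energy (k j) x y) \<le> \<eta> * real (k j) * card (S j)"
        using Jk(5)[of j] unfolding good_def S_def by blast+
      ultimately have t: "(\<integral>\<^sup>+ y. ennreal ((cmod (interp (S j) y))\<^sup>2) \<partial>disc_mu) \<le> ennreal (D * real (k j) * exp (- real (k j))) \<and>
        (\<forall>y. cmod y < 1 \<longrightarrow> cmod (interp (S j) y) \<le> D * exp (- 3 * real (k j)) / (1 - cmod y) ^ 4) \<and>
        exp (- s) * c1 * exp ((1 - s - \<eta>) * real (k j))
          \<le> cmod (\<Sum>x\<in>S j. complex_of_real (exp (- s * hyp_dist z x)) * interp (S j) x) \<and>
        (\<Sum>x\<in>S j. cmod (complex_of_real (exp (- s * hyp_dist z x))) / (1 - cmod x) ^ 4) \<le> D * exp (4 * real (k j))"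
        by (intro typical k1 Sfin)
      show "(\<integral>\<^sup>+ y. ennreal ((cmod (interp (S j) y))\<^sup>2) \<partial>disc_mu) \<le> ennreal (D * real (k j) * exp (- real (k j)))"
        "\<And>y. cmod y < 1 \<Longrightarrow> cmod (interp (S j) y) \<le> D * exp (- 3 * real (k j)) / (1 - cmod y) ^ 4"
        "exp (- s) * c1 * exp ((1 - s - \<eta>) * real (k j))
          \<le> cmod (\<Sum>x\<in>S j. complex_of_real (exp (- s * hyp_dist z x)) * interp (S j) x)"
        "(\<Sum>x\<in>S j. cmod (complex_of_real (exp (- s * hyp_dist z x))) / (1 - cmod x) ^ 4) \<le> D * exp (4 * real (k j))"
        using t by blast+
    qed
    define w where "w = (\<lambda>(j::nat) x. complex_of_real (exp (- s * hyp_dist z x)))"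
    define u where "u = (\<lambda>j y. of_real (exp (\<sigma> * real (k j))) * interp (S j) y)"
    define v where "v = (\<lambda>j. 1 / (real (k j))\<^sup>2)"
    define \<beta> where "\<beta> = (\<lambda>j. exp (\<sigma> * real (k j)) * (D * exp (- 3 * real (k j))))"
    define \<delta> where "\<delta> = (\<lambda>j. D * D * exp (- (1/2) * real (k j)))"
    have \<beta>_le: "\<beta> j \<le> D * exp (- (5/2) * real (k j))" for j
    proof -
      have "\<sigma> * real (k j) \<le> 1/2 * real (k j)" using \<sigma>(3) by (intro mult_right_mono) auto
      hence "exp (\<sigma> * real (k j) + (- 3 * real (k j))) \<le> exp (- (5/2) * real (k j))" by simp
      hence "D * exp (\<sigma> * real (k j) + (- 3 * real (k j))) \<le> D * exp (- (5/2) * real (k j))"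
        using D by (intro mult_left_mono) auto
      moreover have "\<beta> j = D * exp (\<sigma> * real (k j) + (- 3 * real (k j)))"
        unfolding \<beta>_def exp_add by (rule mult.left_commute)
      ultimately show ?thesis by (simp only:)
    qed
    have geo: "summable (\<lambda>j. (1/2 :: real) ^ j)" by (rule summable_geometric) simp
    obtain f where f: "f \<in> bergman_space" "\<And>M. \<exists>j. M \<le> cmod (\<Sum>x\<in>S j. w j x * f x)"
    proof (rule gliding_hump[of S u v \<beta> w \<delta>])
      show "finite (S j)" "S j \<subseteq> ball 0 1" for j by (rule Sfin, rule SB)
      show "u j holomorphic_on ball 0 1" for j
        unfolding u_def by (intro holomorphic_intros interp_holomorphic Sfin SB)
      show "u j \<in> borel_measurable borel" for j unfolding u_def by measurable
      show "(\<integral>\<^sup>+ y. ennreal ((cmod (u j y))\<^sup>2) \<partial>disc_mu) \<le> ennreal (v j)" for j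
      proof -
        have sq: "(exp (\<sigma> * real (k j)))\<^sup>2 = exp (2 * \<sigma> * real (k j))" by (simp add: exp_double[symmetric] mult.assoc)
        have "(\<integral>\<^sup>+ y. ennreal ((cmod (u j y))\<^sup>2) \<partial>disc_mu)
            = (\<integral>\<^sup>+ y. ennreal (exp (2 * \<sigma> * real (k j))) * ennreal ((cmod (interp (S j) y))\<^sup>2) \<partial>disc_mu)"
          unfolding u_def by (intro nn_integral_cong) (simp add: norm_mult power_mult_distrib ennreal_mult' sq)
        also have "\<dots> = ennreal (exp (2 * \<sigma> * real (k j))) * (\<integral>\<^sup>+ y. ennreal ((cmod (interp (S j) y))\<^sup>2) \<partial>disc_mu)"
          by (rule nn_integral_cmult) measurable
        also have "\<dots> \<le> ennreal (exp (2 * \<sigma> * real (k j))) * ennreal (D * real (k j) * exp (- real (k j)))"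
          by (intro mult_left_mono T) auto
        also have "\<dots> = ennreal (D * real (k j) * (exp (2 * \<sigma> * real (k j)) * exp (- real (k j))))"
          by (subst ennreal_mult'[symmetric]) (auto simp: mult_ac)
        also have "exp (2 * \<sigma> * real (k j)) * exp (- real (k j)) = exp (- 4 * \<eta> * real (k j))"
          unfolding exp_add[symmetric] \<sigma>(1) by (simp add: algebra_simps)
        also have "ennreal (D * real (k j) * exp (- 4 * \<eta> * real (k j))) \<le> ennreal (v j)"
          unfolding v_def by (intro ennreal_leI Jk)
        finally show ?thesis .
      qed
      show "0 \<le> v j" for j by (simp add: v_def)
      show "summable (\<lambda>j. 2 ^ j * v j)"
      proof (rule summable_comparison_test'[OF geo])
        fix j
        have "2 ^ j * v j \<le> real (k j) * v j" unfolding v_def by (intro mult_right_mono k2) auto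
        also have "\<dots> = 1 / real (k j)" using k1[of j] by (simp add: v_def power2_eq_square)
        also have "\<dots> \<le> (1/2) ^ j" by (rule kinv)
        finally show "norm (2 ^ j * v j) \<le> (1/2) ^ j" by (simp add: v_def)
      qed
      show "cmod (u j y) \<le> \<beta> j / (1 - cmod y) ^ 4" if "cmod y < 1" for j y
      proof -
        have "cmod (u j y) = exp (\<sigma> * real (k j)) * cmod (interp (S j) y)" by (simp add: u_def norm_mult)
        also have "\<dots> \<le> exp (\<sigma> * real (k j)) * (D * exp (- 3 * real (k j)) / (1 - cmod y) ^ 4)"
          by (intro mult_left_mono T that) auto
        finally show ?thesis by (simp add: \<beta>_def)
      qed
      show b0: "0 \<le> \<beta> j" for j using D by (simp add: \<beta>_def)
      show "summable \<beta>"
      proof (rule summable_comparison_test'[OF geo])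
        fix j
        have "\<beta> j \<le> (1/2) ^ j" using \<beta>_le[of j] Jk(3)[of j] kinv[of j] by linarith
        thus "norm (\<beta> j) \<le> (1/2) ^ j" using b0[of j] by simp
      qed
      show "(\<Sum>x\<in>S i. cmod (w i x) / (1 - cmod x) ^ 4) * \<beta> j \<le> \<delta> j" if "i < j" for i j
      proof -
        have "(\<Sum>x\<in>S i. cmod (w i x) / (1 - cmod x) ^ 4) * \<beta> j \<le> (D * exp (4 * real (k i))) * (D * exp (- (5/2) * real (k j)))"
          unfolding w_def using D by (intro mult_mono T \<beta>_le b0) auto
        also have "\<dots> = D * D * exp (4 * real (k i) + (- (5/2) * real (k j)))" unfolding exp_add by simp
        also have "\<dots> \<le> D * D * exp (- (1/2) * real (k j))"
          using D kk[OF that] by (intro mult_left_mono) auto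
        finally show ?thesis by (simp add: \<delta>_def)
      qed
      show d0: "0 \<le> \<delta> j" for j using D by (simp add: \<delta>_def)
      show "summable \<delta>"
      proof (rule summable_comparison_test'[OF geo])
        fix j
        have "\<delta> j \<le> (1/2) ^ j" using Jk(2)[of j] kinv[of j] unfolding \<delta>_def by linarith
        thus "norm (\<delta> j) \<le> (1/2) ^ j" using d0[of j] by simp
      qed
      show "\<exists>j. M \<le> cmod (\<Sum>x\<in>S j. w j x * u j x)" for M
      proof -
        obtain j where j: "M < 2 ^ j" using real_arch_pow[of 2 M] by auto
        have "(\<Sum>x\<in>S j. w j x * u j x) = of_real (exp (\<sigma> * real (k j))) *
            (\<Sum>x\<in>S j. complex_of_real (exp (- s * hyp_dist z x)) * interp (S j) x)"
          by (simp add: u_def w_def sum_distrib_left mult_ac)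
        hence eq: "cmod (\<Sum>x\<in>S j. w j x * u j x) = exp (\<sigma> * real (k j)) *
            cmod (\<Sum>x\<in>S j. complex_of_real (exp (- s * hyp_dist z x)) * interp (S j) x)"
          by (simp add: norm_mult)
        have "M \<le> real (k j)" using j k2[of j] by linarith
        also have "\<dots> \<le> exp (- s) * c1 * exp (\<eta> * real (k j))" by (rule Jk)
        also have "exp (\<eta> * real (k j)) = exp (\<sigma> * real (k j)) * exp ((1 - s - \<eta>) * real (k j))"
          unfolding exp_add[symmetric] \<sigma>(2) by (simp add: algebra_simps)
        also have "exp (- s) * c1 * (exp (\<sigma> * real (k j)) * exp ((1 - s - \<eta>) * real (k j)))
            = exp (\<sigma> * real (k j)) * (exp (- s) * c1 * exp ((1 - s - \<eta>) * real (k j)))" by simp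
        also have "\<dots> \<le> cmod (\<Sum>x\<in>S j. w j x * u j x)" unfolding eq by (intro mult_left_mono T) auto
        finally show ?thesis by blast
      qed
    qed blast
    \<comment> \<open>The gliding hump makes the terms of the series themselves unbounded, which is
      more than divergence.\<close>
    have "\<not> summable (\<lambda>k::nat. \<Sum>x\<in>X \<inter> shell z k. complex_of_real (exp (- s * hyp_dist z x)) * f x)"
    proof
      assume "summable (\<lambda>k::nat. \<Sum>x\<in>X \<inter> shell z k. complex_of_real (exp (- s * hyp_dist z x)) * f x)"
      hence "Bseq (\<lambda>k::nat. \<Sum>x\<in>X \<inter> shell z k. complex_of_real (exp (- s * hyp_dist z x)) * f x)"
        by (rule summable_imp_Bseq)
      then obtain B where B: "\<And>k. cmod (\<Sum>x\<in>X \<inter> shell z k. complex_of_real (exp (- s * hyp_dist z x)) * f x) \<le> B"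
        unfolding Bseq_def by blast
      obtain j where "B + 1 \<le> cmod (\<Sum>x\<in>S j. w j x * f x)" using f(2) by blast
      thus False using B[of "k j"] by (simp add: S_def w_def)
    qed
    thus ?thesis using f(1) unfolding set_eq by blast
  qed
  show ?thesis
  proof (rule bexI[of _ N0], intro conjI subsetI)
    show "emeasure P N0 = 0" "N0 \<in> sets P" by fact+
    fix X assume X: "X \<in> {X \<in> Conf. \<forall>f \<in> bergman_space.
              summable (\<lambda>k::nat. \<Sum>x \<in> {x \<in> X. real k \<le> hyp_dist z x \<and> hyp_dist z x < real k + 1}.
                 complex_of_real (exp (- s * hyp_dist z x)) * f x)}"
    hence "\<not> (\<forall>\<^sub>F j in sequentially. good c1 c2 (2 ^ (j + J0)) X)" using unsum[of X] by blast
    thus "X \<in> N0" using X N0(1) by (auto simp: DPP_space[OF dpp])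
  qed
qed

end
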